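(* Let $P=((V,E),(V_1,V_R),\delta)$ be an MDP with $m$ edges and let $\mathrm{RP}=\{(L_i,U_i)\mid 1\le i\le k\}$ be Rabin pairs with $b=\sum_{i=1}^k(|L_i|+|U_i|)$. Let $\textsc{MEC}$ denote the time to compute a MEC-decomposition. (1) The almost-sure winning set $\langle\langle1\rangle\rangle_{as}(P,\mathrm{Rabin}(\mathrm{RP}))$ can be computed in $O(k\cdot\textsc{MEC})$ time. (2) If $U_i=\emptyset$ for all $i$ (i.e., the pairs are Büchi objectives), then the almost-sure winning set for the disjunctive objective over the pairs can be computed in $O(\textsc{MEC}+b)$ time and for the disjunctive query in $O(k\cdot m+\textsc{MEC})$ time. (3) If $L_i=V$ for all $i$ (i.e., the pairs are coBüchi objectives), then the almost-sure winning sets for the disjunctive objective and for the disjunctive query over the pairs can be computed in $O(k\cdot m+\textsc{MEC})$ time.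
   Context: An MDP: finite directed graph $(V,E)$, vertices partitioned into player-1 vertices $V_1$ and random vertices $V_R$, each $v\in V_R$ with a probability distribution $\delta(v)$ over its out-neighbours (positive on each). Player-1 strategies choose successors at $V_1$ vertices based on the history; $\langle\langle1\rangle\rangle_{as}(P,\psi)$ is the set of vertices from which player 1 can satisfy $\psi$ with probability 1. $\mathrm{Inf}(\omega)$: vertices occurring infinitely often in play $\omega$. $\mathrm{Rabin}(\mathrm{RP})$: plays $\omega$ with $L_i\cap\mathrm{Inf}(\omega)\neq\emptyset$ and $U_i\cap\mathrm{Inf}(\omega)=\emptyset$ for some $i$. For the single pair $(L_i,U_i)$ the one-pair Rabin objective is the same with that fixed $i$; the disjunctive objective over the pairs is the Rabin objective, and the disjunctive query's winning set is $\bigcup_i\langle\langle1\rangle\rangle_{as}(P,\mathrm{Rabin}(\{(L_i,U_i)\}))$. An end-component is $X\subseteq V$ inducing a strongly connected sub-MDP with at least one edge such that no random vertex of $X$ has an edge leaving $X$; MECs are the inclusion-maximal end-components. It is assumed $\textsc{MEC}=\Omega(m)$. *)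

theory Defs
  imports "HOL-Probability.Probability"
begin

section \<open>Markov decision processes\<close>

record 'v mdp =
  verts :: "'v set"
  edges :: "('v \<times> 'v) set"
  player1 :: "'v set"
  random :: "'v set"
  delta :: "'v \<Rightarrow> 'v pmf"

text \<open>Every vertex has a successor, so that all plays are infinite. Edges and the support of the
  transition function agree at random vertices; \<^term>\<open>delta P\<close> is irrelevant elsewhere.\<close>

definition is_mdp :: "'v mdp \<Rightarrow> bool" where
  "is_mdp P \<longleftrightarrow>
     finite (verts P) \<and> verts P \<noteq> {} \<and>
     edges P \<subseteq> verts P \<times> verts P \<and>
     player1 P \<union> random P = verts P \<and> player1 P \<inter> random P = {} \<and>
     (\<forall>v\<in>verts P. edges P `` {v} \<noteq> {}) \<and>
     (\<forall>v\<in>random P. set_pmf (delta P v) = edges P `` {v})"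

definition is_strategy :: "'v mdp \<Rightarrow> ('v list \<Rightarrow> 'v) \<Rightarrow> bool" where
  "is_strategy P \<sigma> \<longleftrightarrow>
     (\<forall>h. h \<noteq> [] \<and> set h \<subseteq> verts P \<and> last h \<in> player1 P \<longrightarrow> (last h, \<sigma> h) \<in> edges P)"

text \<open>The distribution of the vertex at position \<open>i\<close> of a play from \<open>v\<^sub>0\<close>, given that
  the vertices at the positions \<open>0, \<dots>, i - 1\<close> are \<open>h 0, \<dots>, h (i - 1)\<close>.\<close>

fun play_kernel :: "'v mdp \<Rightarrow> ('v list \<Rightarrow> 'v) \<Rightarrow> 'v \<Rightarrow> nat \<Rightarrow> (nat \<Rightarrow> 'v) \<Rightarrow> 'v pmf" where
  "play_kernel P \<sigma> v\<^sub>0 0 h = return_pmf v\<^sub>0"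
| "play_kernel P \<sigma> v\<^sub>0 (Suc i) h =
     (if h i \<in> player1 P then return_pmf (\<sigma> (map h [0..<Suc i])) else delta P (h i))"

text \<open>The measure on plays is the projective limit given by the Ionescu-Tulcea theorem.\<close>

definition play_measure :: "'v mdp \<Rightarrow> ('v list \<Rightarrow> 'v) \<Rightarrow> 'v \<Rightarrow> (nat \<Rightarrow> 'v) measure" where
  "play_measure P \<sigma> v\<^sub>0 =
     projective_family.lim UNIV
       (Ionescu_Tulcea.CI (\<lambda>i h. measure_pmf (play_kernel P \<sigma> v\<^sub>0 i h)) (\<lambda>_. count_space UNIV))
       (\<lambda>_. count_space UNIV)"

lemma Ionescu_Tulcea_kernel:
  fixes P :: "'v::countable mdp"
  shows "Ionescu_Tulcea (\<lambda>i h. measure_pmf (play_kernel P \<sigma> v\<^sub>0 i h)) (\<lambda>_. count_space UNIV)"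
proof
  fix i :: nat
  let ?M = "PiM {0..<i} (\<lambda>_. count_space (UNIV :: 'v set))"
  have sp: "space ?M = ({0..<i} \<rightarrow>\<^sub>E UNIV)"
    by (simp add: space_PiM)
  have "countable (space ?M)"
    unfolding sp by (rule countable_PiE) auto
  moreover have "{h} \<in> sets ?M" if "h \<in> space ?M" for h
  proof -
    have "{h} = Pi\<^sub>E {0..<i} (\<lambda>j. {h j})"
      using that unfolding sp by (auto simp: PiE_iff extensional_def fun_eq_iff) (metis atLeastLessThan_iff zero_le)
    also have "\<dots> \<in> sets ?M"
      by (intro sets_PiM_I_finite) auto
    finally show ?thesis .
  qed
  ultimately have "sets ?M = sets (count_space (space ?M))"
    by (simp add: sets_eq_countable[OF _ refl])
  moreover have "(\<lambda>h. measure_pmf (play_kernel P \<sigma> v\<^sub>0 i h)) \<in>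
      measurable (count_space (space ?M)) (subprob_algebra (count_space UNIV))"
    by (auto simp: space_subprob_algebra intro: prob_space_imp_subprob_space measure_pmf.prob_space_axioms)
  ultimately show "(\<lambda>h. measure_pmf (play_kernel P \<sigma> v\<^sub>0 i h)) \<in>
      measurable ?M (subprob_algebra (count_space UNIV))"
    using measurable_cong_sets[OF _ refl] by blast
qed

definition as_win :: "'v mdp \<Rightarrow> (nat \<Rightarrow> 'v) set \<Rightarrow> 'v set" where
  "as_win P \<Psi> =
     {v \<in> verts P. \<exists>\<sigma>. is_strategy P \<sigma> \<and> (AE \<omega> in play_measure P \<sigma> v. \<omega> \<in> \<Psi>)}"

definition Inf_verts :: "(nat \<Rightarrow> 'v) \<Rightarrow> 'v set" where
  "Inf_verts \<omega> = {v. \<exists>\<^sub>\<infinity>i. \<omega> i = v}"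

text \<open>Pairs are indexed by their position in a list, so that \<open>k\<close> is the length of the list.\<close>

type_synonym 'v rabin_pairs = "('v set \<times> 'v set) list"

definition is_rabin_pairs :: "'v mdp \<Rightarrow> 'v rabin_pairs \<Rightarrow> bool" where
  "is_rabin_pairs P RP \<longleftrightarrow> (\<forall>(L, U)\<in>set RP. L \<subseteq> verts P \<and> U \<subseteq> verts P)"

definition Rabin :: "'v rabin_pairs \<Rightarrow> (nat \<Rightarrow> 'v) set" where
  "Rabin RP = {\<omega>. \<exists>(L, U)\<in>set RP. L \<inter> Inf_verts \<omega> \<noteq> {} \<and> U \<inter> Inf_verts \<omega> = {}}"

definition win_objective :: "'v mdp \<Rightarrow> 'v rabin_pairs \<Rightarrow> 'v set" where
  "win_objective P RP = as_win P (Rabin RP)"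

definition win_query :: "'v mdp \<Rightarrow> 'v rabin_pairs \<Rightarrow> 'v set" where
  "win_query P RP = (\<Union>i<length RP. as_win P (Rabin [RP ! i]))"

definition pairs_size :: "'v rabin_pairs \<Rightarrow> nat" where
  "pairs_size RP = (\<Sum>(L, U)\<leftarrow>RP. card L + card U)"

definition end_component :: "'v mdp \<Rightarrow> 'v set \<Rightarrow> bool" where
  "end_component P X \<longleftrightarrow>
     X \<subseteq> verts P \<and>
     edges P \<inter> X \<times> X \<noteq> {} \<and>
     (\<forall>u\<in>X. \<forall>v\<in>X. (u, v) \<in> (edges P \<inter> X \<times> X)\<^sup>*) \<and>
     (\<forall>v\<in>X \<inter> random P. edges P `` {v} \<subseteq> X)"

definition mecs :: "'v mdp \<Rightarrow> 'v set set" where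
  "mecs P = {X. end_component P X \<and> (\<forall>Y. end_component P Y \<and> X \<subseteq> Y \<longrightarrow> Y = X)}"

section \<open>A random access machine\<close>

text \<open>Structured programs over natural number registers and arrays, with truncated subtraction
  and without multiplication. Every operator evaluated, memory access and command costs one unit.\<close>

record state =
  reg :: "nat \<Rightarrow> nat"
  arr :: "nat \<Rightarrow> nat \<Rightarrow> nat"

datatype aexp = Const nat | Reg nat | Read nat aexp | Plus aexp aexp | Minus aexp aexp

datatype bexp = Less aexp aexp | Eq aexp aexp | Neg bexp | Conj bexp bexp

datatype com =
    Skip
  | Assign nat aexp
  | Write nat aexp aexp
  | Seq com com
  | Cond bexp com com
  | While bexp com

fun aval :: "aexp \<Rightarrow> state \<Rightarrow> nat" where
  "aval (Const n) s = n"
| "aval (Reg x) s = reg s x"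
| "aval (Read a e) s = arr s a (aval e s)"
| "aval (Plus e f) s = aval e s + aval f s"
| "aval (Minus e f) s = aval e s - aval f s"

fun bval :: "bexp \<Rightarrow> state \<Rightarrow> bool" where
  "bval (Less e f) s \<longleftrightarrow> aval e s < aval f s"
| "bval (Eq e f) s \<longleftrightarrow> aval e s = aval f s"
| "bval (Neg b) s \<longleftrightarrow> \<not> bval b s"
| "bval (Conj b c) s \<longleftrightarrow> bval b s \<and> bval c s"

fun acost :: "aexp \<Rightarrow> nat" where
  "acost (Const n) = 1"
| "acost (Reg x) = 1"
| "acost (Read a e) = 1 + acost e"
| "acost (Plus e f) = 1 + acost e + acost f"
| "acost (Minus e f) = 1 + acost e + acost f"

fun bcost :: "bexp \<Rightarrow> nat" where
  "bcost (Less e f) = 1 + acost e + acost f"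
| "bcost (Eq e f) = 1 + acost e + acost f"
| "bcost (Neg b) = 1 + bcost b"
| "bcost (Conj b c) = 1 + bcost b + bcost c"

text \<open>\<open>exec c s t s'\<close>: started in \<open>s\<close>, the program \<open>c\<close> halts in \<open>s'\<close> after \<open>t\<close> steps.\<close>

inductive exec :: "com \<Rightarrow> state \<Rightarrow> nat \<Rightarrow> state \<Rightarrow> bool" where
  Skip: "exec Skip s 1 s"
| Assign: "exec (Assign x e) s (1 + acost e) (s\<lparr>reg := (reg s)(x := aval e s)\<rparr>)"
| Write: "exec (Write a e f) s (1 + acost e + acost f)
    (s\<lparr>arr := (arr s)(a := (arr s a)(aval e s := aval f s))\<rparr>)"
| Seq: "exec c s t s' \<Longrightarrow> exec d s' t' s'' \<Longrightarrow> exec (Seq c d) s (1 + t + t') s''"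
| CondTrue: "bval b s \<Longrightarrow> exec c s t s' \<Longrightarrow> exec (Cond b c d) s (1 + bcost b + t) s'"
| CondFalse: "\<not> bval b s \<Longrightarrow> exec d s t s' \<Longrightarrow> exec (Cond b c d) s (1 + bcost b + t) s'"
| WhileFalse: "\<not> bval b s \<Longrightarrow> exec (While b c) s (1 + bcost b) s"
| WhileTrue: "bval b s \<Longrightarrow> exec c s t s' \<Longrightarrow> exec (While b c) s' t' s'' \<Longrightarrow>
    exec (While b c) s (1 + bcost b + t + t') s''"

section \<open>Inputs and outputs\<close>

text \<open>A list of finite sets is stored contiguously: the elements of the \<open>i\<close>-th set, without
  repetition and in any order, occupy the cells \<open>start i, \<dots>, start (i + 1) - 1\<close> of
  \<open>data\<close>.\<close>

definition stores_sets :: "(nat \<Rightarrow> nat) \<Rightarrow> (nat \<Rightarrow> nat) \<Rightarrow> nat set list \<Rightarrow> bool" where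
  "stores_sets start data Xs \<longleftrightarrow>
     start 0 = 0 \<and>
     (\<forall>i<length Xs. start i \<le> start (Suc i) \<and>
        distinct (map data [start i..<start (Suc i)]) \<and>
        set (map data [start i..<start (Suc i)]) = Xs ! i)"

text \<open>Vertices are numbered \<open>0, \<dots>, n - 1\<close>, register 0 holds \<open>n\<close>, arrays 0 and 1 hold the
  adjacency lists and array 2 the owners of the vertices. The probabilities are not part of the
  input: programs know the support of \<^term>\<open>delta P\<close> only. Memory outside the input is
  arbitrary, that is, programs cannot rely on cleared memory.\<close>

definition stores_mdp :: "state \<Rightarrow> nat mdp \<Rightarrow> bool" where
  "stores_mdp s P \<longleftrightarrow>
     verts P = {..<reg s 0} \<and>
     stores_sets (arr s 0) (arr s 1) (map (\<lambda>v. edges P `` {v}) [0..<reg s 0]) \<and>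
     (\<forall>v<reg s 0. arr s 2 v = (if v \<in> random P then 1 else 0))"

definition stores_pairs :: "state \<Rightarrow> nat rabin_pairs \<Rightarrow> bool" where
  "stores_pairs s RP \<longleftrightarrow>
     reg s 1 = length RP \<and>
     stores_sets (arr s 3) (arr s 4) (map fst RP) \<and>
     stores_sets (arr s 5) (arr s 6) (map snd RP)"

text \<open>A MEC-decomposition is returned as a labelling of the vertices in array 7, with label 0 for
  the vertices outside all MECs, and a set of vertices as its characteristic function in array 7.\<close>

definition returns_mecs :: "state \<Rightarrow> nat mdp \<Rightarrow> bool" where
  "returns_mecs s P \<longleftrightarrow>
     (\<forall>v\<in>verts P. arr s 7 v \<le> card (verts P)) \<and>
     {{v \<in> verts P. arr s 7 v = l} |l. l \<in> arr s 7 ` verts P \<and> l \<noteq> 0} = mecs P"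

definition returns_set :: "state \<Rightarrow> nat mdp \<Rightarrow> nat set \<Rightarrow> bool" where
  "returns_set s P W \<longleftrightarrow> (\<forall>v\<in>verts P. arr s 7 v = (if v \<in> W then 1 else 0))"

text \<open>\<open>T n m\<close> bounds the running time of \<open>M\<close> on all MDPs with at most \<open>n\<close> vertices and at most
  \<open>m\<close> edges.\<close>

definition computes_mecs_in :: "com \<Rightarrow> (nat \<Rightarrow> nat \<Rightarrow> nat) \<Rightarrow> bool" where
  "computes_mecs_in M T \<longleftrightarrow>
     (\<forall>P s n m. is_mdp P \<and> stores_mdp s P \<and> card (verts P) \<le> n \<and> card (edges P) \<le> m \<longrightarrow>
        (\<exists>t s'. exec M s t s' \<and> t \<le> T n m \<and> returns_mecs s' P))"

text \<open>\<open>T = \<Omega>(m)\<close>, over the pairs \<open>(n, m)\<close> that are sizes of MDPs.\<close>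

definition at_least_linear :: "(nat \<Rightarrow> nat \<Rightarrow> nat) \<Rightarrow> bool" where
  "at_least_linear T \<longleftrightarrow>
     (\<exists>c::real. c > 0 \<and> (\<forall>n m. n \<le> m \<and> m \<le> n ^ 2 \<longrightarrow> c * real m \<le> real (T n m)))"

definition mdp_time :: "(nat \<Rightarrow> nat \<Rightarrow> nat) \<Rightarrow> 'v mdp \<Rightarrow> nat" where
  "mdp_time T P = T (card (verts P)) (card (edges P))"

definition computable_in_O ::
  "(nat mdp \<Rightarrow> nat rabin_pairs \<Rightarrow> bool) \<Rightarrow> (nat mdp \<Rightarrow> nat rabin_pairs \<Rightarrow> nat set) \<Rightarrow>
   (nat mdp \<Rightarrow> nat rabin_pairs \<Rightarrow> nat) \<Rightarrow> bool" where
  "computable_in_O D W f \<longleftrightarrow>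
     (\<exists>A C. \<forall>P RP s. is_mdp P \<and> is_rabin_pairs P RP \<and> D P RP \<and>
        stores_mdp s P \<and> stores_pairs s RP \<longrightarrow>
        (\<exists>t s'. exec A s t s' \<and> t \<le> C * f P RP \<and> returns_set s' P (W P RP)))"

end

theory Submission
  imports Defs
begin

text \<open>
  Call an end-component winning if it meets \<open>L\<close> and avoids \<open>U\<close> for some Rabin pair. Almost surely
  the vertices visited infinitely often form an end-component, since a random vertex visited
  infinitely often is almost surely left infinitely often along each of its edges. Hence the
  almost-sure winning set is the largest set that no random vertex leaves and inside which every
  vertex can reach a winning end-component.

  Once the MECs are contracted, this set is computed by a single linear-time attractor: a MEC without
  winning vertices is lost as soon as all edges leaving it lead to lost nodes, a random vertex outside
  the MECs as soon as one edge does. It remains to mark one winning vertex in every MEC that contains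
  a winning end-component. For Buechi pairs, mark the union of the \<open>L\<close>. For coBuechi pairs, mark the
  vertices from which player 1 can surely avoid \<open>U\<close>, the complement of another attractor. For general
  pairs, mark the vertices of \<open>L\<close> in the MECs of the MDP in which \<open>U\<close> has been made absorbing, with
  one MEC-decomposition per pair.

  The MEC program may overwrite all registers and arrays that it mentions, so the algorithms save
  their input to fresh ones.
\<close>

section \<open>The measure on plays\<close>

text \<open>Strategies may use the whole history, so a play is not a Markov chain and the visits to
  a random vertex are not independent trials. The claim about its edges is therefore proved with a
  weight whose expectation never grows, uniformly in the strategy.

  One attractor suffices, without repeated deletion, for the following reason. In a set that no
  random vertex leaves and in which every vertex has a successor, each vertex reaches a bottom
  component. This is an end-component, hence part of one MEC. If that MEC carried no mark, it would
  still have an edge to a node that is not lost, and following this edge would leave the bottom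
  component.

  Marks may be any winning vertices, as long as the MEC of every winning end-component receives one;
  this is why quite different marking programs share the same final program. Both kinds of attractor
  are one counter algorithm with different thresholds. As every vertex has an outgoing edge, n \<le>
  m, and the lower bound on MEC pays for each linear pass that is not repeated for every pair. A
  query shares one decomposition among all pairs and repeats only attractors.\<close>

lemma play_kernel_cong:
  "(\<And>j. j < i \<Longrightarrow> h j = h' j) \<Longrightarrow> play_kernel P \<sigma> v i h = play_kernel P \<sigma> v i h'"
proof (cases i)
  case (Suc j)
  moreover assume "\<And>j. j < i \<Longrightarrow> h j = h' j"
  ultimately have "map h [0..<Suc j] = map h' [0..<Suc j]" "h j = h' j"
    by (auto simp del: upt_Suc)
  then show ?thesis
    unfolding Suc play_kernel.simps by (simp only:)
qed simp

context
  fixes P :: "'v::countable mdp" and \<sigma> :: "'v list \<Rightarrow> 'v" and v\<^sub>0 :: 'v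
begin

interpretation IT: Ionescu_Tulcea "\<lambda>i h. measure_pmf (play_kernel P \<sigma> v\<^sub>0 i h)" "\<lambda>_. count_space UNIV"
  by (rule Ionescu_Tulcea_kernel)

lemma play_measure_eq: "play_measure P \<sigma> v\<^sub>0 = IT.PF.lim"
  by (simp add: play_measure_def)

lemma sets_play_measure [measurable_cong, simp]:
  "sets (play_measure P \<sigma> v\<^sub>0) = sets (PiM UNIV (\<lambda>_. count_space UNIV))"
  by (simp add: play_measure_eq)

lemma space_play_measure [simp]: "space (play_measure P \<sigma> v\<^sub>0) = UNIV"
  by (simp add: play_measure_eq space_PiM)

text \<open>The projective limit is determined by its finite-dimensional marginals. For the index
  set \<open>{0..<n}\<close> the marginal is the composition \<open>IT.C 0 n\<close> of the first
  \<open>n\<close> kernels, and embedding \<open>{0..<n}\<close> into itself changes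
  nothing.\<close>

lemma emeasure_play_measure_prefix:
  assumes "X \<in> sets (PiM {0..<n} (\<lambda>_. count_space UNIV))"
  shows "emeasure (play_measure P \<sigma> v\<^sub>0) {\<omega>. restrict \<omega> {0..<n} \<in> X} =
    emeasure (IT.C 0 n (\<lambda>_. undefined)) X"
proof -
  have "{\<omega>. restrict \<omega> {0..<n} \<in> X} = IT.PF.emb UNIV {0..<n} X"
    by (auto simp: prod_emb_def)
  moreover have "IT.PF.emb {0..<n} {0..<n} X = X"
    using sets.sets_into_space[OF assms]
    by (auto simp: prod_emb_def space_PiM)
  ultimately show ?thesis
    using IT.lim[of "{0..<n}" X] IT.emeasure_CI[of "{0..<n}" n X] assms
    by (simp add: play_measure_eq)
qed

text \<open>Chain rule: \<open>IT.C 0 (Suc n)\<close> is the bind of \<open>IT.C 0 n\<close> with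
  the kernel that appends coordinate \<open>n\<close>. Only one prefix can be extended to the
  prescribed one, so the integral collapses to a multiple of an indicator.\<close>

lemma emeasure_cylinder_Suc:
  "emeasure (play_measure P \<sigma> v\<^sub>0) {\<omega>. \<forall>i<Suc n. \<omega> i = h i} =
   emeasure (play_measure P \<sigma> v\<^sub>0) {\<omega>. \<forall>i<n. \<omega> i = h i} *
     ennreal (pmf (play_kernel P \<sigma> v\<^sub>0 n h) (h n))"
proof -
  let ?M = "\<lambda>n::nat. PiM {0..<n} (\<lambda>_. count_space (UNIV :: 'v set))"
  let ?C = "\<lambda>n. IT.C 0 n (\<lambda>_. undefined)"
  let ?r = "\<lambda>n. restrict h {0..<n}"
  have sing: "{?r n} \<in> sets (?M n)" for n
  proof -
    have "{?r n} = Pi\<^sub>E {0..<n} (\<lambda>j. {h j})"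
      by (auto simp: PiE_iff extensional_def fun_eq_iff)
    also have "\<dots> \<in> sets (?M n)"
      by (intro sets_PiM_I_finite) auto
    finally show ?thesis .
  qed
  have cyl: "emeasure (play_measure P \<sigma> v\<^sub>0) {\<omega>. \<forall>i<n. \<omega> i = h i} = emeasure (?C n) {?r n}" for n
  proof -
    have "{\<omega>. \<forall>i<n. \<omega> i = h i} = {\<omega>. restrict \<omega> {0..<n} \<in> {?r n}}"
      by (auto simp: restrict_def fun_eq_iff)
    then show ?thesis
      using emeasure_play_measure_prefix[OF sing] by simp
  qed
  have undef: "(\<lambda>_. undefined) \<in> space (?M 0)"
    by (simp add: space_PiM PiE_iff)
  have sp: "space (?C n) = space (?M n)" and st: "sets (?C n) = sets (?M n)"
    using IT.space_C[OF undef, of n] IT.sets_C[OF undef, of n] by simp_all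
  \<comment> \<open>Elements of the product space are \<open>undefined\<close> outside their index
    set, so updating at \<open>n\<close> loses no information about \<open>f\<close>.\<close>
  have upd: "(\<lambda>x. fun_upd f n x) -` {?r (Suc n)} = (if f = ?r n then {h n} else {})"
    (is "?L = ?R") if "f \<in> space (?M n)" for f
  proof -
    have fn: "f n = undefined"
      using that by (simp add: space_PiM PiE_iff extensional_def)
    have "f(n := x) = ?r (Suc n) \<longleftrightarrow> f = ?r n \<and> x = h n" for x
    proof
      assume eq: "f(n := x) = ?r (Suc n)"
      have "f i = ?r n i" for i
        using fun_cong[OF eq, of i] fn by (cases "i = n") (auto simp: less_Suc_eq)
      moreover have "x = h n"
        using fun_cong[OF eq, of n] by simp
      ultimately show "f = ?r n \<and> x = h n" by blast
    next
      have "(?r n)(n := h n) = ?r (Suc n)"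
        by (rule ext) (simp add: less_Suc_eq)
      then show "f = ?r n \<and> x = h n \<Longrightarrow> f(n := x) = ?r (Suc n)" by simp
    qed
    then have "x \<in> ?L \<longleftrightarrow> x \<in> ?R" for x
      by (simp only: vimage_eq singleton_iff) simp
    then show ?thesis by (rule set_eqI)
  qed
  have "emeasure (?C (Suc n)) {?r (Suc n)} = (\<integral>\<^sup>+ f. emeasure (IT.eP n f) {?r (Suc n)} \<partial>?C n)"
  proof -
    have "IT.eP n \<in> measurable (?C n) (subprob_algebra (?M (Suc n)))"
      unfolding measurable_cong_sets[OF st refl] by (rule IT.measurable_eP)
    from emeasure_bind[OF prob_space.not_empty[OF IT.prob_space_C[OF undef]] this sing]
    show ?thesis by simp
  qed
  also have "\<dots> = (\<integral>\<^sup>+ f. ennreal (pmf (play_kernel P \<sigma> v\<^sub>0 n h) (h n)) * indicator {?r n} f \<partial>?C n)"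
  proof (rule nn_integral_cong)
    fix f assume "f \<in> space (?C n)"
    then have f: "f \<in> space (?M n)" by (simp add: sp)
    have "play_kernel P \<sigma> v\<^sub>0 n (?r n) = play_kernel P \<sigma> v\<^sub>0 n h"
      by (rule play_kernel_cong) simp
    then show "emeasure (IT.eP n f) {?r (Suc n)} =
        ennreal (pmf (play_kernel P \<sigma> v\<^sub>0 n h) (h n)) * indicator {?r n} f"
      using IT.emeasure_eP[OF f sing] upd[OF f] by (auto simp: emeasure_pmf_single)
  qed
  also have "\<dots> = ennreal (pmf (play_kernel P \<sigma> v\<^sub>0 n h) (h n)) * emeasure (?C n) {?r n}"
    using sing[of n] by (subst nn_integral_cmult_indicator) (simp_all add: st)
  finally show ?thesis
    by (simp add: cyl mult.commute)
qed

text \<open>The cylinder over the empty prefix imposes no condition, so the total mass is that of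
  the composition of no kernels.\<close>

lemma prob_space_play_measure: "prob_space (play_measure P \<sigma> v\<^sub>0)"
proof
  have "(\<lambda>_. undefined) \<in> space (PiM {0..<0::nat} (\<lambda>_. count_space (UNIV :: 'v set)))"
    by (simp add: space_PiM PiE_iff)
  then interpret C: prob_space "IT.C 0 0 (\<lambda>_. undefined)"
    by (rule IT.prob_space_C)
  have sp: "space (PiM {0..<0::nat} (\<lambda>_. count_space UNIV)) = {\<lambda>_. undefined :: 'v}"
    by (auto simp: space_PiM PiE_iff extensional_def)
  have "emeasure (play_measure P \<sigma> v\<^sub>0) {\<omega>. restrict \<omega> {0..<0} \<in> space (PiM {0..<0} (\<lambda>_. count_space UNIV))} = 1"
    using C.emeasure_space_1 by (subst emeasure_play_measure_prefix[OF sets.top]) (simp del: IT.C.simps add: IT.space_C space_PiM PiE_iff)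
  then show "emeasure (play_measure P \<sigma> v\<^sub>0) (space (play_measure P \<sigma> v\<^sub>0)) = 1"
    unfolding sp by (simp add: restrict_def)
qed

end

section \<open>Finite histories as marginals of the play measure\<close>

fun history :: "'v mdp \<Rightarrow> ('v list \<Rightarrow> 'v) \<Rightarrow> 'v \<Rightarrow> nat \<Rightarrow> 'v list pmf" where
  "history P \<sigma> v 0 = return_pmf []"
| "history P \<sigma> v (Suc n) =
     bind_pmf (history P \<sigma> v n) (\<lambda>h. map_pmf (\<lambda>w. h @ [w]) (play_kernel P \<sigma> v n ((!) h)))"

lemma length_history: "h \<in> set_pmf (history P \<sigma> v n) \<Longrightarrow> length h = n"
  by (induction n arbitrary: h) auto

text \<open>The list \<open>h @ [w]\<close> determines both \<open>h\<close> and \<open>w\<close>,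
  so a single prefix contributes to the mixture.\<close>

lemma pmf_history_Suc:
  assumes "length h = n"
  shows "pmf (history P \<sigma> v (Suc n)) (h @ [w]) =
    pmf (history P \<sigma> v n) h * pmf (play_kernel P \<sigma> v n ((!) h)) w"
proof -
  have inj: "inj (\<lambda>w. h' @ [w])" for h' :: "'a list"
    by (rule injI) simp
  have eq: "pmf (map_pmf (\<lambda>w. h' @ [w]) (play_kernel P \<sigma> v n ((!) h'))) (h @ [w]) =
      indicator {h} h' * pmf (play_kernel P \<sigma> v n ((!) h)) w" for h'
  proof (cases "h' = h")
    case True
    then show ?thesis using pmf_map_inj'[OF inj, of h' _ w] by simp
  next
    case False
    then have "h @ [w] \<notin> set_pmf (map_pmf (\<lambda>w. h' @ [w]) (play_kernel P \<sigma> v n ((!) h')))"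
      by auto
    then show ?thesis
      using False by (simp add: set_pmf_iff del: set_map_pmf)
  qed
  show ?thesis
    by (simp add: pmf_bind eq measure_pmf_single)
qed

context
  fixes P :: "'v::countable mdp" and \<sigma> :: "'v list \<Rightarrow> 'v" and v\<^sub>0 :: 'v
begin

lemma measurable_prefix [measurable]:
  "(\<lambda>\<omega>. map \<omega> [0..<n]) \<in> measurable (PiM UNIV (\<lambda>_. count_space UNIV)) (count_space (UNIV :: 'v list set))"
proof (induction n)
  case (Suc n)
  have "(\<lambda>\<omega>. (\<lambda>(h, w). h @ [w]) (map \<omega> [0..<n], \<omega> n)) \<in>
      measurable (PiM UNIV (\<lambda>_. count_space UNIV)) (count_space (UNIV :: 'v list set))"
    \<comment> \<open>There are only countably many prefixes, so the appended vertex can be treated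
      with the prefix held fixed.\<close>
    using measurable_compose_countable[OF _ Suc, of "\<lambda>h \<omega>. h @ [\<omega> n]"]
    by (auto intro!: measurable_compose[OF measurable_component_singleton])
  then show ?case by simp
qed simp

lemma emeasure_prefix_eq:
  "length h = n \<Longrightarrow> emeasure (play_measure P \<sigma> v\<^sub>0) {\<omega>. map \<omega> [0..<n] = h} =
     ennreal (pmf (history P \<sigma> v\<^sub>0 n) h)"
proof (induction n arbitrary: h)
  case 0
  interpret prob_space "play_measure P \<sigma> v\<^sub>0" by (rule prob_space_play_measure)
  from 0 show ?case using emeasure_space_1 by simp
next
  case (Suc n)
  then obtain g w where h: "h = g @ [w]" "length g = n"
    by (metis append_butlast_last_id length_butlast diff_Suc_1 list.size(3) nat.distinct(1))
  have "{\<omega>. map \<omega> [0..<Suc n] = h} = {\<omega>. \<forall>i<Suc n. \<omega> i = h ! i}"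
    using Suc.prems by (auto simp: list_eq_iff_nth_eq simp del: upt_Suc)
  moreover have "{\<omega>. map \<omega> [0..<n] = g} = {\<omega>. \<forall>i<n. \<omega> i = h ! i}"
    using h by (auto simp: list_eq_iff_nth_eq nth_append)
  moreover have "play_kernel P \<sigma> v\<^sub>0 n ((!) h) = play_kernel P \<sigma> v\<^sub>0 n ((!) g)"
    using h by (intro play_kernel_cong) (simp add: nth_append)
  moreover have "h ! n = w" using h by (simp add: nth_append)
  ultimately show ?case
    using emeasure_cylinder_Suc[of P \<sigma> v\<^sub>0 n "(!) h"] Suc.IH[OF h(2)]
    by (simp add: h(1) pmf_history_Suc[OF h(2)] ennreal_mult'' del: upt_Suc history.simps)
qed

text \<open>Lists over a countable type are countable, so it suffices to compare singletons; those
  of the wrong length are null on both sides. Prefix events can then be handled in a discrete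
  distribution, by induction on the length and by supports.\<close>

lemma distr_prefix:
  "distr (play_measure P \<sigma> v\<^sub>0) (count_space UNIV) (\<lambda>\<omega>. map \<omega> [0..<n]) = measure_pmf (history P \<sigma> v\<^sub>0 n)"
proof (rule measure_eqI_countable[where A=UNIV])
  fix h :: "'v list"
  have [measurable]: "(\<lambda>\<omega>. map \<omega> [0..<n]) \<in> measurable (play_measure P \<sigma> v\<^sub>0) (count_space UNIV)"
    by (simp cong: measurable_cong_sets)
  have "emeasure (distr (play_measure P \<sigma> v\<^sub>0) (count_space UNIV) (\<lambda>\<omega>. map \<omega> [0..<n])) {h} =
    emeasure (play_measure P \<sigma> v\<^sub>0) {\<omega>. map \<omega> [0..<n] = h}"
    by (subst emeasure_distr) (auto simp: vimage_def)
  also have "\<dots> = ennreal (pmf (history P \<sigma> v\<^sub>0 n) h)"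
  proof (cases "length h = n")
    case False
    then have "{\<omega>. map \<omega> [0..<n] = h} = {}" "h \<notin> set_pmf (history P \<sigma> v\<^sub>0 n)"
      using length_history[of h P \<sigma> v\<^sub>0 n] by auto
    then show ?thesis by (simp add: set_pmf_iff del: map_eq_conv)
  qed (rule emeasure_prefix_eq)
  finally show "emeasure (distr (play_measure P \<sigma> v\<^sub>0) (count_space UNIV) (\<lambda>\<omega>. map \<omega> [0..<n])) {h} =
    emeasure (measure_pmf (history P \<sigma> v\<^sub>0 n)) {h}"
    by (simp add: emeasure_pmf_single)
qed auto

text \<open>Needed in both directions: to carry properties of the supported histories over to almost
  every play, and to find, outside a null set, a play with a given prefix of positive
  probability.\<close>

lemma AE_prefix:
  "(AE \<omega> in play_measure P \<sigma> v\<^sub>0. Q (map \<omega> [0..<n])) \<longleftrightarrow> (\<forall>h\<in>set_pmf (history P \<sigma> v\<^sub>0 n). Q h)"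
proof -
  have [measurable]: "(\<lambda>\<omega>. map \<omega> [0..<n]) \<in> measurable (play_measure P \<sigma> v\<^sub>0) (count_space UNIV)"
    by (simp cong: measurable_cong_sets)
  have "(AE \<omega> in play_measure P \<sigma> v\<^sub>0. Q (map \<omega> [0..<n])) =
    (AE h in distr (play_measure P \<sigma> v\<^sub>0) (count_space UNIV) (\<lambda>\<omega>. map \<omega> [0..<n]). Q h)"
    by (subst AE_distr_iff) simp_all
  then show ?thesis
    unfolding distr_prefix by (simp add: AE_measure_pmf_iff)
qed

lemma emeasure_prefix:
  "emeasure (play_measure P \<sigma> v\<^sub>0) {\<omega>. map \<omega> [0..<n] \<in> A} = emeasure (history P \<sigma> v\<^sub>0 n) A"
proof -
  have [measurable]: "(\<lambda>\<omega>. map \<omega> [0..<n]) \<in> measurable (play_measure P \<sigma> v\<^sub>0) (count_space UNIV)"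
    by (simp cong: measurable_cong_sets)
  show ?thesis
    unfolding distr_prefix[symmetric] by (subst emeasure_distr) (auto simp: vimage_def)
qed


lemma history_support:
  assumes "h \<in> set_pmf (history P \<sigma> v\<^sub>0 n)" and "i < n"
  shows "h ! i \<in> set_pmf (play_kernel P \<sigma> v\<^sub>0 i ((!) h))"
  using assms
proof (induction n arbitrary: h)
  case (Suc n)
  then obtain g w where h: "h = g @ [w]" "g \<in> set_pmf (history P \<sigma> v\<^sub>0 n)"
    "w \<in> set_pmf (play_kernel P \<sigma> v\<^sub>0 n ((!) g))"
    by auto
  have len: "length g = n" by (rule length_history[OF h(2)])
  have "play_kernel P \<sigma> v\<^sub>0 i ((!) h) = play_kernel P \<sigma> v\<^sub>0 i ((!) g)"
    using Suc.prems(2) len by (intro play_kernel_cong) (simp add: h(1) nth_append)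
  moreover have "g ! i \<in> set_pmf (play_kernel P \<sigma> v\<^sub>0 i ((!) g))" if "i < n"
    using Suc.IH[OF h(2) that] .
  ultimately show ?case
    using h(3) len Suc.prems(2) unfolding h(1)
    by (cases "i = n") (simp_all add: nth_append_left nth_append_length[of g w "[]", unfolded len])
qed simp

lemma AE_play_step:
  "AE \<omega> in play_measure P \<sigma> v\<^sub>0. \<forall>n. \<omega> n \<in> set_pmf (play_kernel P \<sigma> v\<^sub>0 n \<omega>)"
  unfolding AE_all_countable
proof
  fix n
  have eq: "play_kernel P \<sigma> v\<^sub>0 n ((!) (map \<omega> [0..<Suc n])) = play_kernel P \<sigma> v\<^sub>0 n \<omega>" for \<omega>
    by (rule play_kernel_cong) (simp del: upt_Suc)
  have "AE \<omega> in play_measure P \<sigma> v\<^sub>0. (map \<omega> [0..<Suc n]) ! n \<in>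
      set_pmf (play_kernel P \<sigma> v\<^sub>0 n ((!) (map \<omega> [0..<Suc n])))"
    by (subst AE_prefix[where Q="\<lambda>h. h ! n \<in> set_pmf (play_kernel P \<sigma> v\<^sub>0 n ((!) h))"])
      (auto intro: history_support simp del: history.simps)
  then show "AE \<omega> in play_measure P \<sigma> v\<^sub>0. \<omega> n \<in> set_pmf (play_kernel P \<sigma> v\<^sub>0 n \<omega>)"
    unfolding eq by (simp del: upt_Suc)
qed

end

text \<open>With \<open>c = 1 + p\<close>, where \<open>p\<close> is the probability of moving from the random vertex \<open>v\<close> to
  \<open>w\<close>, the following weights form a supermartingale, because \<open>(1 + p) * (1 - p) \<le> 1\<close>. They
  are at least \<open>c ^ r\<close> on the plays that visit \<open>v\<close> at least \<open>r\<close> times but never \<open>w\<close>.\<close>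

definition avoidance_weight :: "'v \<Rightarrow> 'v \<Rightarrow> real \<Rightarrow> nat \<Rightarrow> 'v list \<Rightarrow> ennreal" where
  "avoidance_weight v w c N h =
     (\<Prod>i\<in>{N..<length h - 1}. if h ! i = v then (if h ! Suc i = w then 0 else ennreal c) else 1)"

text \<open>The factor at position \<open>i\<close> inspects positions \<open>i\<close> and
  \<open>i + 1\<close>. The product therefore stops before \<open>length h - 1\<close>, and
  appending \<open>x\<close> adds the factor that belongs to the last vertex of
  \<open>h\<close>.\<close>

lemma avoidance_weight_snoc:
  assumes "h \<noteq> []"
  shows "avoidance_weight v w c N (h @ [x]) = avoidance_weight v w c N h *
    (if N < length h \<and> last h = v then (if x = w then 0 else ennreal c) else 1)"
proof -
  obtain n where n: "length h = Suc n" using assms by (cases h) auto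
  have "avoidance_weight v w c N (h @ [x]) =
      (\<Prod>i\<in>{N..<Suc n}. if (h @ [x]) ! i = v then (if (h @ [x]) ! Suc i = w then 0 else ennreal c) else 1)"
    by (simp add: avoidance_weight_def n)
  also have "\<dots> = (\<Prod>i\<in>{N..<n}. if h ! i = v then (if h ! Suc i = w then 0 else ennreal c) else 1) *
    (if N < length h \<and> last h = v then (if x = w then 0 else ennreal c) else 1)"
  proof (cases "N \<le> n")
    case True
    have "(\<Prod>i\<in>{N..<n}. if (h @ [x]) ! i = v then (if (h @ [x]) ! Suc i = w then 0 else ennreal c) else 1) =
      (\<Prod>i\<in>{N..<n}. if h ! i = v then (if h ! Suc i = w then 0 else ennreal c) else 1)"
      by (rule prod.cong) (auto simp: nth_append n)
    moreover have "(h @ [x]) ! n = last h" "(h @ [x]) ! Suc n = x"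
      using assms by (simp_all add: nth_append n last_conv_nth)
    ultimately show ?thesis
      using True by (simp add: n)
  qed (simp add: n)
  finally show ?thesis
    by (simp add: avoidance_weight_def n)
qed

context
  fixes P :: "'v::countable mdp" and \<sigma> :: "'v list \<Rightarrow> 'v" and v\<^sub>0 :: 'v
    and v w :: 'v and c :: real
  assumes v: "v \<notin> player1 P"
    and c_def: "c = 1 + pmf (delta P v) w"
begin

text \<open>Given the prefix, the next factor has mean at most 1 whatever the strategy does: it
  differs from 1 only if the prefix ends in \<open>v\<close>, and there the successor is drawn from
  \<open>delta P v\<close> regardless of the earlier history.\<close>

lemma avoidance_weight_expectation:
  "(\<integral>\<^sup>+h. avoidance_weight v w c N h \<partial>history P \<sigma> v\<^sub>0 n) \<le> 1"
proof (induction n)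
  case 0
  then show ?case by (simp add: nn_integral_return_pmf avoidance_weight_def)
next
  case (Suc n)
  have step: "(\<integral>\<^sup>+x. avoidance_weight v w c N (h @ [x]) \<partial>play_kernel P \<sigma> v\<^sub>0 n ((!) h)) \<le>
      avoidance_weight v w c N h" if h: "h \<in> set_pmf (history P \<sigma> v\<^sub>0 n)" for h
  proof (cases n)
    case 0
    then show ?thesis
      using length_history[OF h] by (simp add: nn_integral_return_pmf avoidance_weight_def)
  next
    case (Suc m)
    have len: "length h = Suc m" using length_history[OF h] Suc by simp
    then have ne: "h \<noteq> []" and lst: "last h = h ! m"
      by (auto simp: last_conv_nth[OF length_greater_0_conv[THEN iffD1]])
    let ?f = "\<lambda>x. if N < length h \<and> last h = v then (if x = w then 0 else ennreal c) else 1"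
    have "(\<integral>\<^sup>+x. ?f x \<partial>play_kernel P \<sigma> v\<^sub>0 n ((!) h)) \<le> 1"
    proof (cases "N < length h \<and> last h = v")
      case True
      let ?p = "pmf (delta P v) w"
      have "(\<integral>\<^sup>+x. ?f x \<partial>play_kernel P \<sigma> v\<^sub>0 n ((!) h)) = (\<integral>\<^sup>+x. ennreal c * indicator (-{w}) x \<partial>delta P v)"
        using True v lst Suc by (intro nn_integral_cong_AE arg_cong2[where f=nn_integral])
          (auto split: split_indicator)
      also have "\<dots> = ennreal c * emeasure (delta P v) (-{w})"
        by (subst nn_integral_cmult_indicator) simp_all
      also have "emeasure (delta P v) (-{w}) = ennreal (1 - ?p)"
        using measure_pmf.prob_compl[of "{w}" "delta P v"]
        by (simp add: measure_pmf.emeasure_eq_measure measure_pmf_single Compl_eq_Diff_UNIV)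
      also have "ennreal c * ennreal (1 - ?p) = ennreal (1 - ?p * ?p)"
        by (subst ennreal_mult[symmetric]) (auto simp: c_def pmf_le_1 algebra_simps)
      also have "\<dots> \<le> 1" by simp
      finally show ?thesis .
    next
      case False
      then have "(\<integral>\<^sup>+x. ?f x \<partial>play_kernel P \<sigma> v\<^sub>0 n ((!) h)) = (\<integral>\<^sup>+x. 1 \<partial>play_kernel P \<sigma> v\<^sub>0 n ((!) h))"
        by (intro nn_integral_cong) auto
      then show ?thesis by (simp add: measure_pmf.emeasure_space_1[simplified])
    qed
    then have "avoidance_weight v w c N h * (\<integral>\<^sup>+x. ?f x \<partial>play_kernel P \<sigma> v\<^sub>0 n ((!) h)) \<le>
        avoidance_weight v w c N h * 1"
      by (rule mult_left_mono) simp
    then show ?thesis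
      unfolding avoidance_weight_snoc[OF ne] by (subst nn_integral_cmult) simp_all
  qed
  have "(\<integral>\<^sup>+h. avoidance_weight v w c N h \<partial>history P \<sigma> v\<^sub>0 (Suc n)) =
    (\<integral>\<^sup>+h. (\<integral>\<^sup>+x. avoidance_weight v w c N (h @ [x]) \<partial>play_kernel P \<sigma> v\<^sub>0 n ((!) h)) \<partial>history P \<sigma> v\<^sub>0 n)"
    by (simp add: nn_integral_map_pmf)
  also have "\<dots> \<le> (\<integral>\<^sup>+h. avoidance_weight v w c N h \<partial>history P \<sigma> v\<^sub>0 n)"
    by (intro nn_integral_mono_AE) (simp add: AE_measure_pmf_iff step)
  finally show ?case using Suc by simp
qed

text \<open>Markov's inequality for the weight of prefixes of length \<open>n\<close>. Visits are
  counted before \<open>n - 1\<close> only, so that the successor of every counted visit still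
  belongs to the prefix.\<close>

lemma emeasure_avoiding_le:
  "ennreal c ^ r * emeasure (play_measure P \<sigma> v\<^sub>0)
     {\<omega>. (\<forall>i\<ge>N. \<omega> i \<noteq> w) \<and> (\<exists>\<^sub>\<infinity>i. \<omega> i = v) \<and> r \<le> card {i\<in>{N..<n - 1}. \<omega> i = v}} \<le> 1"
proof -
  let ?E = "{h. length h = n \<and> (\<forall>i\<in>{N..<n}. h ! i \<noteq> w) \<and> r \<le> card {i\<in>{N..<n - 1}. h ! i = v}}"
  have 1: "1 \<le> ennreal c"
    by (simp add: c_def)
  have "ennreal c ^ r * emeasure (play_measure P \<sigma> v\<^sub>0)
     {\<omega>. (\<forall>i\<ge>N. \<omega> i \<noteq> w) \<and> (\<exists>\<^sub>\<infinity>i. \<omega> i = v) \<and> r \<le> card {i\<in>{N..<n - 1}. \<omega> i = v}} \<le>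
    ennreal c ^ r * emeasure (play_measure P \<sigma> v\<^sub>0) {\<omega>. map \<omega> [0..<n] \<in> ?E}"
  proof (intro mult_left_mono emeasure_mono)
    have "{i\<in>{N..<n - 1}. map \<omega> [0..<n] ! i = v} = {i\<in>{N..<n - 1}. \<omega> i = v}" for \<omega> :: "nat \<Rightarrow> 'v"
      by auto
    then show "{\<omega>. (\<forall>i\<ge>N. \<omega> i \<noteq> w) \<and> (\<exists>\<^sub>\<infinity>i. \<omega> i = v) \<and> r \<le> card {i\<in>{N..<n - 1}. \<omega> i = v}} \<subseteq>
      {\<omega>. map \<omega> [0..<n] \<in> ?E}"
      by auto
    have [measurable]: "(\<lambda>\<omega>. map \<omega> [0..<n]) \<in> measurable (play_measure P \<sigma> v\<^sub>0) (count_space UNIV)"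
      by (simp cong: measurable_cong_sets)
    have "{\<omega>\<in>space (play_measure P \<sigma> v\<^sub>0). map \<omega> [0..<n] \<in> ?E} \<in> sets (play_measure P \<sigma> v\<^sub>0)"
      by measurable
    then show "{\<omega>. map \<omega> [0..<n] \<in> ?E} \<in> sets (play_measure P \<sigma> v\<^sub>0)"
      by (simp only: space_play_measure UNIV_I simp_thms)
  qed simp
  also have "\<dots> = (\<integral>\<^sup>+h. ennreal c ^ r * indicator ?E h \<partial>history P \<sigma> v\<^sub>0 n)"
    unfolding emeasure_prefix by (subst nn_integral_cmult_indicator) simp_all
  also have "\<dots> \<le> (\<integral>\<^sup>+h. avoidance_weight v w c N h \<partial>history P \<sigma> v\<^sub>0 n)"
  proof (intro nn_integral_mono)
    fix h
    show "ennreal c ^ r * indicator ?E h \<le> avoidance_weight v w c N h"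
    proof (cases "h \<in> ?E")
      case True
      then have "avoidance_weight v w c N h = (\<Prod>i\<in>{N..<n - 1}. if h ! i = v then ennreal c else 1)"
        unfolding avoidance_weight_def by (intro prod.cong) (auto simp: less_diff_conv)
      also have "\<dots> = ennreal c ^ card {i\<in>{N..<n - 1}. h ! i = v}"
        by (subst prod.inter_filter[symmetric]) simp_all
      also have "\<dots> \<ge> ennreal c ^ r"
        using True 1 by (intro power_increasing) auto
      finally show ?thesis using True by simp
    qed simp
  qed
  also have "\<dots> \<le> 1" by (rule avoidance_weight_expectation)
  finally show ?thesis .
qed

text \<open>For fixed \<open>r\<close>, the events that \<open>r\<close> visits have been seen by
  time \<open>n\<close> increase to the whole bad event, since \<open>v\<close> recurs. Continuity
  from below gives \<open>c ^ r * prob ?B \<le> 1\<close> for every \<open>r\<close>, and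
  \<open>c > 1\<close> leaves only probability 0.\<close>

lemma AE_not_avoiding:
  assumes pos: "pmf (delta P v) w > 0"
  shows "AE \<omega> in play_measure P \<sigma> v\<^sub>0. \<not> ((\<forall>i\<ge>N. \<omega> i \<noteq> w) \<and> (\<exists>\<^sub>\<infinity>i. \<omega> i = v))"
proof -
  interpret prob_space "play_measure P \<sigma> v\<^sub>0" by (rule prob_space_play_measure)
  let ?B = "{\<omega>. (\<forall>i\<ge>N. \<omega> i \<noteq> w) \<and> (\<exists>\<^sub>\<infinity>i. \<omega> i = v)}"
  define F where "F r n = {\<omega>. (\<forall>i\<ge>N. \<omega> i \<noteq> w) \<and> (\<exists>\<^sub>\<infinity>i. \<omega> i = v) \<and>
    r \<le> card {i\<in>{N..<n - 1}. \<omega> i = v}}" for r n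
  have comp [measurable]: "(\<lambda>\<omega>. \<omega> i) \<in> measurable (play_measure P \<sigma> v\<^sub>0) (count_space UNIV)" for i
    by (rule measurable_compose[OF _ measurable_component_singleton[of i UNIV]])
      (simp_all cong: measurable_cong_sets)
  have B_meas: "?B \<in> events"
  proof -
    have "{\<omega>\<in>space (play_measure P \<sigma> v\<^sub>0). (\<forall>i. N \<le> i \<longrightarrow> \<omega> i \<noteq> w) \<and> (\<forall>m. \<exists>i. m \<le> i \<and> \<omega> i = v)} \<in> events"
      by measurable
    then show ?thesis
      by (simp add: INFM_nat_le)
  qed
  have F_meas: "F r n \<in> events" for r n
  proof -
    let ?G = "{h. r \<le> card {i\<in>{N..<n - 1}. h ! i = v}}"
    have "{\<omega>\<in>space (play_measure P \<sigma> v\<^sub>0). map \<omega> [0..<n] \<in> ?G} \<in> events"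
      by measurable
    moreover have "{i\<in>{N..<n - 1}. map \<omega> [0..<n] ! i = v} = {i\<in>{N..<n - 1}. \<omega> i = v}" for \<omega> :: "nat \<Rightarrow> 'v"
      by auto
    ultimately have "?B \<inter> {\<omega>. r \<le> card {i\<in>{N..<n - 1}. \<omega> i = v}} \<in> events"
      using B_meas by simp
    moreover have "F r n = ?B \<inter> {\<omega>. r \<le> card {i\<in>{N..<n - 1}. \<omega> i = v}}"
      by (auto simp: F_def)
    ultimately show ?thesis by simp
  qed
  have F_inc: "incseq (F r)" for r
  proof (rule incseq_SucI)
    fix n
    have "card {i\<in>{N..<n - 1}. \<omega> i = v} \<le> card {i\<in>{N..<Suc n - 1}. \<omega> i = v}" for \<omega> :: "nat \<Rightarrow> 'v"
      by (intro card_mono) auto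
    then show "F r n \<subseteq> F r (Suc n)"
      unfolding F_def by (auto intro: order_trans)
  qed
  have F_Un: "(\<Union>n. F r n) = ?B" for r
  proof safe
    fix \<omega> assume \<omega>: "\<forall>i\<ge>N. \<omega> i \<noteq> w" "\<exists>\<^sub>\<infinity>i. \<omega> i = v"
    have "infinite ({i. \<omega> i = v} - {..<N})"
      using \<omega>(2) by (simp add: INFM_iff_infinite)
    then obtain K where K: "K \<subseteq> {i. \<omega> i = v} - {..<N}" "finite K" "card K = r"
      using infinite_arbitrarily_large by meson
    obtain n where n: "\<forall>i\<in>K. i < n"
      using K(2) finite_nat_set_iff_bounded by auto
    have "K \<subseteq> {i\<in>{N..<Suc n - 1}. \<omega> i = v}" using K(1) n by auto
    then have "r \<le> card {i\<in>{N..<Suc n - 1}. \<omega> i = v}"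
      using K(3) card_mono[of "{i\<in>{N..<Suc n - 1}. \<omega> i = v}" K] by simp
    then have "\<omega> \<in> F r (Suc n)" using \<omega> by (simp add: F_def)
    then show "\<omega> \<in> (\<Union>n. F r n)" by blast
  qed (auto simp: F_def)
  have "c ^ r * prob ?B \<le> 1" for r
  proof -
    have "(\<lambda>n. c ^ r * prob (F r n)) \<longlonglongrightarrow> c ^ r * prob (\<Union>n. F r n)"
      using F_meas F_inc by (intro tendsto_mult tendsto_const finite_Lim_measure_incseq) auto
    moreover have "c ^ r * prob (F r n) \<le> 1" for n
    proof -
      have c0: "0 \<le> c" by (simp add: c_def)
      have "ennreal (c ^ r * prob (F r n)) \<le> ennreal 1"
        using emeasure_avoiding_le[of r N n] c0
        by (simp add: F_def emeasure_eq_measure ennreal_mult'' ennreal_power)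
      then show ?thesis by (subst (asm) ennreal_le_iff) simp_all
    qed
    ultimately show ?thesis
      unfolding F_Un by (intro LIMSEQ_le_const2) auto
  qed
  then have "prob ?B = 0"
  proof (rule_tac ccontr)
    assume *: "\<And>r. c ^ r * prob ?B \<le> 1" and "prob ?B \<noteq> 0"
    then have B: "prob ?B > 0" by (simp add: zero_less_measure_iff)
    obtain r where "1 / prob ?B < c ^ r"
      using real_arch_pow[of c] pos by (auto simp: c_def)
    then show False using *[of r] B by (simp add: field_simps)
  qed
  then show ?thesis
    using B_meas by (subst AE_iff_measurable[where N="?B"]) (auto simp: emeasure_eq_measure)
qed

end

text \<open>The exceptional events are indexed by \<open>v\<close>, \<open>w\<close> and a time
  \<open>N\<close> after which \<open>w\<close> no longer occurs, so only countably many null events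
  have to be discarded.\<close>

lemma AE_Inf_verts_closed:
  fixes P :: "'v::countable mdp"
  assumes P: "is_mdp P"
  shows "AE \<omega> in play_measure P \<sigma> v\<^sub>0. \<forall>v\<in>random P. v \<in> Inf_verts \<omega> \<longrightarrow> edges P `` {v} \<subseteq> Inf_verts \<omega>"
proof -
  have "AE \<omega> in play_measure P \<sigma> v\<^sub>0. \<forall>N. \<not> ((\<forall>i\<ge>N. \<omega> i \<noteq> w) \<and> (\<exists>\<^sub>\<infinity>i. \<omega> i = v))"
    if "v \<in> random P" "w \<in> edges P `` {v}" for v w
    unfolding AE_all_countable
  proof
    fix N
    have "pmf (delta P v) w > 0" "v \<notin> player1 P"
      using P that by (auto simp: is_mdp_def pmf_positive)
    then show "AE \<omega> in play_measure P \<sigma> v\<^sub>0. \<not> ((\<forall>i\<ge>N. \<omega> i \<noteq> w) \<and> (\<exists>\<^sub>\<infinity>i. \<omega> i = v))"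
      by (intro AE_not_avoiding) simp_all
  qed
  then have "AE \<omega> in play_measure P \<sigma> v\<^sub>0. v \<in> random P \<longrightarrow> w \<in> edges P `` {v} \<longrightarrow>
      (\<forall>N. \<not> ((\<forall>i\<ge>N. \<omega> i \<noteq> w) \<and> (\<exists>\<^sub>\<infinity>i. \<omega> i = v)))" for v w
    by (cases "v \<in> random P \<and> w \<in> edges P `` {v}") auto
  then have "AE \<omega> in play_measure P \<sigma> v\<^sub>0. \<forall>v w. v \<in> random P \<longrightarrow> w \<in> edges P `` {v} \<longrightarrow>
      (\<forall>N. \<not> ((\<forall>i\<ge>N. \<omega> i \<noteq> w) \<and> (\<exists>\<^sub>\<infinity>i. \<omega> i = v)))"
    by (simp add: AE_all_countable)
  then show ?thesis
    by eventually_elim (simp add: Inf_verts_def INFM_nat_le subset_iff, metis)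
qed

section \<open>Almost-sure winning sets of Rabin objectives\<close>

lemma Inf_verts_iff: "v \<in> Inf_verts \<omega> \<longleftrightarrow> (\<forall>m. \<exists>i\<ge>m. \<omega> i = v)"
  by (simp add: Inf_verts_def INFM_nat_le)

lemma Inf_verts_subset: "(\<And>i. \<omega> i \<in> V) \<Longrightarrow> Inf_verts \<omega> \<subseteq> V"
  unfolding subset_iff Inf_verts_iff by metis

lemma ex_minimal:
  fixes r :: "'a \<Rightarrow> nat"
  assumes "u \<in> I"
  shows "\<exists>v. v \<in> I \<and> (\<forall>u. u \<in> I \<longrightarrow> r v \<le> r u)"
  using ex_has_least_nat[of "\<lambda>v. v \<in> I" u r, OF assms] .

text \<open>Each vertex outside \<open>Inf_verts \<omega>\<close> is absent from some time on, and
  there are only finitely many such vertices.\<close>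

lemma eventually_in_Inf_verts:
  assumes "finite V" and "\<And>i. \<omega> i \<in> V"
  obtains N where "\<And>i. N \<le> i \<Longrightarrow> \<omega> i \<in> Inf_verts \<omega>"
proof -
  have "\<forall>v\<in>V - Inf_verts \<omega>. \<forall>\<^sub>\<infinity>i. \<omega> i \<noteq> v"
    by (simp add: Inf_verts_def)
  then have "\<forall>\<^sub>\<infinity>i. \<forall>v\<in>V - Inf_verts \<omega>. \<omega> i \<noteq> v"
    using assms(1) by (intro eventually_ball_finite) auto
  then show thesis
    using that assms(2) by (auto simp: MOST_nat_le)
qed

lemma path_in_rtrancl:
  assumes "i \<le> j" and "\<And>k. i \<le> k \<Longrightarrow> (\<omega> k, \<omega> (Suc k)) \<in> r"
  shows "(\<omega> i, \<omega> j) \<in> r\<^sup>*"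
  using assms(1) by (induction rule: dec_induct) (auto intro: rtrancl_into_rtrancl assms(2))

text \<open>From some time on the play stays inside \<open>Inf_verts \<omega>\<close>, and the
  segment from a late visit to \<open>u\<close> up to a later visit to \<open>v\<close> is a path
  inside it. This part is deterministic; the closure at random vertices is the only ingredient that
  holds merely almost surely.\<close>

lemma end_component_Inf_verts:
  assumes P: "is_mdp P" and E: "\<And>i. (\<omega> i, \<omega> (Suc i)) \<in> edges P"
    and closed: "\<forall>v\<in>random P. v \<in> Inf_verts \<omega> \<longrightarrow> edges P `` {v} \<subseteq> Inf_verts \<omega>"
  shows "end_component P (Inf_verts \<omega>)"
proof -
  let ?I = "Inf_verts \<omega>"
  have fin: "finite (verts P)" and V: "\<omega> i \<in> verts P" for i
    using P E[of i] by (auto simp: is_mdp_def)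
  obtain N where N: "\<And>i. N \<le> i \<Longrightarrow> \<omega> i \<in> ?I"
    using eventually_in_Inf_verts[OF fin] V by blast
  have step: "(\<omega> i, \<omega> (Suc i)) \<in> edges P \<inter> ?I \<times> ?I" if "N \<le> i" for i
    using N[of i] N[of "Suc i"] E[of i] that by auto
  have "(u, v) \<in> (edges P \<inter> ?I \<times> ?I)\<^sup>*" if "u \<in> ?I" "v \<in> ?I" for u v
  proof -
    obtain i where i: "N \<le> i" "\<omega> i = u" using \<open>u \<in> ?I\<close> unfolding Inf_verts_iff by blast
    obtain j where j: "i \<le> j" "\<omega> j = v" using \<open>v \<in> ?I\<close> unfolding Inf_verts_iff by blast
    show ?thesis
      using path_in_rtrancl[OF j(1), of \<omega>] step i j by auto
  qed
  moreover have "?I \<subseteq> verts P"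
    using V by (rule Inf_verts_subset)
  ultimately show ?thesis
    using step[of N] closed unfolding end_component_def by blast
qed

definition winning_ec :: "'v mdp \<Rightarrow> 'v rabin_pairs \<Rightarrow> 'v set \<Rightarrow> bool" where
  "winning_ec P RP X \<longleftrightarrow>
     end_component P X \<and> (\<exists>(L, U)\<in>set RP. L \<inter> X \<noteq> {} \<and> U \<inter> X = {})"

text \<open>The almost-sure winning set turns out to be the largest live set.\<close>

definition live :: "'v mdp \<Rightarrow> 'v rabin_pairs \<Rightarrow> 'v set \<Rightarrow> bool" where
  "live P RP S \<longleftrightarrow> S \<subseteq> verts P \<and> (\<forall>v\<in>S \<inter> random P. edges P `` {v} \<subseteq> S) \<and>
     (\<forall>v\<in>S. \<exists>X w. winning_ec P RP X \<and> w \<in> X \<and> (v, w) \<in> (edges P \<inter> S \<times> S)\<^sup>*)"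

lemma history_in_edges:
  assumes P: "is_mdp P" and \<sigma>: "is_strategy P \<sigma>" and v: "v \<in> verts P"
    and "h \<in> set_pmf (history P \<sigma> v n)"
  shows "set h \<subseteq> verts P \<and> (\<forall>i. Suc i < n \<longrightarrow> (h ! i, h ! Suc i) \<in> edges P)"
  using assms(4)
proof (induction n arbitrary: h)
  case (Suc n)
  then obtain g w where h: "h = g @ [w]" "g \<in> set_pmf (history P \<sigma> v n)"
    "w \<in> set_pmf (play_kernel P \<sigma> v n ((!) g))"
    by auto
  note IH = Suc.IH[OF h(2)]
  have len: "length g = n" by (rule length_history[OF h(2)])
  show ?case
  proof (cases n)
    case 0
    then show ?thesis using h v len by auto
  next
    case (Suc m)
    have g: "g \<noteq> []" "last g = g ! m" "map ((!) g) [0..<Suc m] = g"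
      using len Suc map_nth[of g] by (auto simp: last_conv_nth[OF length_greater_0_conv[THEN iffD1]])
    have "last g \<in> verts P" using g(1) IH by auto
    have "(last g, w) \<in> edges P"
    proof (cases "last g \<in> player1 P")
      case True
      then have "w = \<sigma> g" using h(3) g(2,3) unfolding Suc by (simp del: upt_Suc)
      then show ?thesis using \<sigma> IH g(1) True by (auto simp: is_strategy_def)
    next
      case False
      then have "last g \<in> random P" using P \<open>last g \<in> verts P\<close> by (auto simp: is_mdp_def)
      moreover have "w \<in> set_pmf (delta P (last g))" using h(3) False g(2) unfolding Suc by (simp del: upt_Suc)
      ultimately show ?thesis using P by (auto simp: is_mdp_def)
    qed
    then show ?thesis
      using IH P len Suc g(2) unfolding h(1)
      by (auto simp: nth_append is_mdp_def less_Suc_eq)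
  qed
qed simp

text \<open>The live set consists of the vertices that a winning strategy visits with positive
  probability. A history of positive probability cannot have exceptional continuations only, so it
  extends to a play that wins and whose \<open>Inf_verts\<close> form an end-component. The tail of
  this play is the required path.\<close>

lemma as_win_in_live:
  fixes P :: "'v::countable mdp"
  assumes P: "is_mdp P" and v: "v \<in> as_win P (Rabin RP)"
  obtains S where "live P RP S" "v \<in> S"
proof -
  obtain \<sigma> where vV: "v \<in> verts P" and \<sigma>: "is_strategy P \<sigma>"
    and win: "AE \<omega> in play_measure P \<sigma> v. \<omega> \<in> Rabin RP"
    using v by (auto simp: as_win_def)
  define S where "S = {u. \<exists>n h. h \<in> set_pmf (history P \<sigma> v (Suc n)) \<and> u = h ! n}"
  have "AE \<omega> in play_measure P \<sigma> v. \<forall>n. map \<omega> [0..<n] \<in> set_pmf (history P \<sigma> v n)"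
    unfolding AE_all_countable by (subst AE_prefix) simp
  with win AE_Inf_verts_closed[OF P, of \<sigma> v]
  have good: "AE \<omega> in play_measure P \<sigma> v. \<omega> \<in> Rabin RP \<and>
     (\<forall>v\<in>random P. v \<in> Inf_verts \<omega> \<longrightarrow> edges P `` {v} \<subseteq> Inf_verts \<omega>) \<and>
     (\<forall>n. map \<omega> [0..<n] \<in> set_pmf (history P \<sigma> v n))" (is "AE \<omega> in _. ?G \<omega>")
    by eventually_elim blast
  have SV: "S \<subseteq> verts P"
  proof
    fix u assume "u \<in> S"
    then obtain n h where "h \<in> set_pmf (history P \<sigma> v (Suc n))" "u = h ! n"
      unfolding S_def by blast
    then show "u \<in> verts P"
      using history_in_edges[OF P \<sigma> vV, of h "Suc n"] length_history[of h P \<sigma> v "Suc n"] by auto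
  qed
  have "edges P `` {u} \<subseteq> S" if u: "u \<in> S \<inter> random P" for u
  proof
    fix w assume w: "w \<in> edges P `` {u}"
    obtain n h where h: "h \<in> set_pmf (history P \<sigma> v (Suc n))" "u = h ! n"
      using u unfolding S_def by blast
    have "u \<notin> player1 P" "w \<in> set_pmf (delta P u)"
      using u w P by (auto simp: is_mdp_def)
    then have "w \<in> set_pmf (play_kernel P \<sigma> v (Suc n) ((!) h))"
      using h(2) by simp
    then have "h @ [w] \<in> set_pmf (history P \<sigma> v (Suc (Suc n)))"
      unfolding history.simps(2)[of P \<sigma> v "Suc n"] set_bind_pmf set_map_pmf using h(1) by blast
    moreover have "(h @ [w]) ! Suc n = w"
      using length_history[OF h(1)] by (simp add: nth_append)
    ultimately show "w \<in> S" unfolding S_def by (intro CollectI exI[of _ "Suc n"] exI[of _ "h @ [w]"]) simp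
  qed
  moreover have "\<exists>X w. winning_ec P RP X \<and> w \<in> X \<and> (u, w) \<in> (edges P \<inter> S \<times> S)\<^sup>*" if u: "u \<in> S" for u
  proof -
    obtain n h where h: "h \<in> set_pmf (history P \<sigma> v (Suc n))" "u = h ! n"
      using u unfolding S_def by blast
    have "\<not> (AE \<omega> in play_measure P \<sigma> v. map \<omega> [0..<Suc n] \<noteq> h)"
      using h(1) by (subst AE_prefix[where Q="\<lambda>g. g \<noteq> h"]) blast
    have "\<exists>\<omega>. ?G \<omega> \<and> map \<omega> [0..<Suc n] = h"
    proof (rule ccontr)
      assume no: "\<not> ?thesis"
      have "AE \<omega> in play_measure P \<sigma> v. map \<omega> [0..<Suc n] \<noteq> h"
        using good by eventually_elim (use no in blast)
      then show False using \<open>\<not> (AE \<omega> in play_measure P \<sigma> v. map \<omega> [0..<Suc n] \<noteq> h)\<close> by blast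
    qed
    then obtain \<omega> where \<omega>: "?G \<omega>" "map \<omega> [0..<Suc n] = h" by blast
    have hist: "map \<omega> [0..<n] \<in> set_pmf (history P \<sigma> v n)" for n
      using \<omega>(1) by blast
    have un: "u = \<omega> n" using \<omega>(2) h(2) by (metis add_0 diff_zero length_upt lessI nth_map nth_upt)
    have \<omega>S: "\<omega> i \<in> S" for i
    proof -
      have "\<omega> i = map \<omega> [0..<Suc i] ! i" by (simp del: upt_Suc)
      then show ?thesis using hist[of "Suc i"] unfolding S_def by blast
    qed
    have \<omega>E: "(\<omega> i, \<omega> (Suc i)) \<in> edges P" for i
      using conjunct2[OF history_in_edges[OF P \<sigma> vV hist[of "Suc (Suc i)"]], rule_format, of i]
      by (simp del: upt_Suc)
    have ec: "end_component P (Inf_verts \<omega>)"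
      by (rule end_component_Inf_verts[OF P]) (use \<omega>E \<omega>(1) in blast)+
    then have "winning_ec P RP (Inf_verts \<omega>)"
      using \<omega>(1) unfolding winning_ec_def Rabin_def by auto
    moreover obtain w where w: "w \<in> Inf_verts \<omega>"
      using ec unfolding end_component_def by blast
    moreover obtain j where "n \<le> j" "\<omega> j = w"
      using w unfolding Inf_verts_iff by blast
    moreover have "(\<omega> n, \<omega> j) \<in> (edges P \<inter> S \<times> S)\<^sup>*"
      using \<open>n \<le> j\<close> \<omega>S \<omega>E by (intro path_in_rtrancl) auto
    ultimately show ?thesis
      unfolding un by blast
  qed
  moreover have "v \<in> S"
    unfolding S_def by (intro CollectI exI[of _ 0] exI[of _ "[v]"]) simp
  ultimately show thesis
    using that[of S] SV unfolding live_def by blast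
qed

text \<open>\<open>rank\<close> is the distance to \<open>T\<close>, and \<open>f\<close> takes the
  first step of a shortest path. The rank is returned together with \<open>f\<close> because the
  descents below compare ranks among the vertices visited infinitely often.\<close>

lemma decreasing_choice:
  obtains f :: "'a \<Rightarrow> 'a" and rank :: "'a \<Rightarrow> nat"
  where "\<And>v. v \<notin> T \<Longrightarrow> \<exists>t\<in>T. (v, t) \<in> r\<^sup>* \<Longrightarrow> (v, f v) \<in> r \<and> rank (f v) < rank v"
proof -
  define rank where "rank v = (LEAST n. \<exists>t\<in>T. (v, t) \<in> r ^^ n)" for v
  have "\<exists>w. (v, w) \<in> r \<and> rank w < rank v" if v: "v \<notin> T" "\<exists>t\<in>T. (v, t) \<in> r\<^sup>*" for v
  proof -
    have "\<exists>n. \<exists>t\<in>T. (v, t) \<in> r ^^ n"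
      using v(2) by (auto simp: rtrancl_power)
    then have "\<exists>t\<in>T. (v, t) \<in> r ^^ rank v"
      unfolding rank_def by (rule LeastI_ex)
    then obtain t where t: "t \<in> T" "(v, t) \<in> r ^^ rank v" by blast
    then obtain m where m: "rank v = Suc m" using v(1) by (cases "rank v") auto
    then obtain w where "(v, w) \<in> r" "(w, t) \<in> r ^^ m"
      using t(2) by (metis relpow_Suc_E2)
    moreover have "rank w \<le> m"
      unfolding rank_def using t(1) \<open>(w, t) \<in> r ^^ m\<close> by (auto intro: Least_le)
    ultimately show ?thesis using m by auto
  qed
  then have "\<exists>f. \<forall>v. v \<notin> T \<longrightarrow> (\<exists>t\<in>T. (v, t) \<in> r\<^sup>*) \<longrightarrow> (v, f v) \<in> r \<and> rank (f v) < rank v"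
    by metis
  then show thesis using that by blast
qed

text \<open>The edge inside \<open>X\<close> is what is left when the path from \<open>v\<close> is
  empty, as for a singleton with a self-loop.\<close>

lemma end_component_succ:
  assumes "end_component P X" "v \<in> X"
  shows "\<exists>w\<in>X. (v, w) \<in> edges P"
proof -
  obtain a b where ab: "(a, b) \<in> edges P \<inter> X \<times> X"
    using assms(1) unfolding end_component_def by auto
  then have "(v, a) \<in> (edges P \<inter> X \<times> X)\<^sup>*"
    using assms unfolding end_component_def by blast
  then show ?thesis
    using ab by (cases rule: converse_rtranclE) auto
qed

lemma finite_end_components: "is_mdp P \<Longrightarrow> finite {X. end_component P X}"
  by (rule finite_subset[of _ "Pow (verts P)"]) (auto simp: end_component_def is_mdp_def)

text \<open>A memoryless strategy suffices: approach the winning end-components and, inside them, the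
  target vertex of the end-component of least index that contains the current vertex. The index
  never increases, hence it is constant in the long run.\<close>

lemma live_subset_as_win:
  fixes P :: "'v::countable mdp"
  assumes P: "is_mdp P" and S: "live P RP S"
  shows "S \<subseteq> as_win P (Rabin RP)"
proof
  fix v\<^sub>0 assume v0: "v\<^sub>0 \<in> S"
  let ?E = "edges P"
  let ?XX = "{X. winning_ec P RP X}"
  define W where "W = \<Union>?XX"
  have finXX: "finite ?XX"
    using finite_end_components[OF P] by (rule finite_subset[rotated]) (auto simp: winning_ec_def)
  \<comment> \<open>Any injective numbering will do; it only has to break ties between overlapping
    winning end-components.\<close>
  obtain idx :: "'v set \<Rightarrow> nat" where idx: "inj_on idx ?XX"
    using finite_imp_inj_to_nat_seg[OF finXX] by blast
  define X where "X v = (ARG_MIN idx X. winning_ec P RP X \<and> v \<in> X)" for v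
  have X: "winning_ec P RP (X v) \<and> v \<in> X v" if "v \<in> W" for v
    using arg_min_natI[of "\<lambda>X. winning_ec P RP X \<and> v \<in> X" _ idx] that unfolding X_def W_def by blast
  have X_le: "idx (X v) \<le> idx Y" if "winning_ec P RP Y" "v \<in> Y" for v Y
    unfolding X_def using that by (intro arg_min_nat_le) auto
  have ec: "end_component P Y" if "winning_ec P RP Y" for Y
    using that by (simp add: winning_ec_def)
  have "\<exists>t. \<exists>(L, U)\<in>set RP. t \<in> L \<inter> Y \<and> U \<inter> Y = {}" if "winning_ec P RP Y" for Y
    using that unfolding winning_ec_def by blast
  then obtain tgt where tgt: "\<And>Y. winning_ec P RP Y \<Longrightarrow> \<exists>(L, U)\<in>set RP. tgt Y \<in> L \<inter> Y \<and> U \<inter> Y = {}"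
    by metis
  then have tgtY: "tgt Y \<in> Y" if "winning_ec P RP Y" for Y
    using that by fast
  have "\<exists>f rank :: 'v \<Rightarrow> nat. \<forall>v\<in>Y - {tgt Y}. (v, f v) \<in> ?E \<inter> Y \<times> Y \<and> rank (f v) < rank v"
    if Y: "winning_ec P RP Y" for Y
  proof -
    obtain f and rank :: "'v \<Rightarrow> nat" where f: "\<And>v. v \<notin> {tgt Y} \<Longrightarrow> \<exists>t\<in>{tgt Y}. (v, t) \<in> (?E \<inter> Y \<times> Y)\<^sup>* \<Longrightarrow>
        (v, f v) \<in> ?E \<inter> Y \<times> Y \<and> rank (f v) < rank v"
      using decreasing_choice[of "{tgt Y}" "?E \<inter> Y \<times> Y"] by blast
    have "(v, tgt Y) \<in> (?E \<inter> Y \<times> Y)\<^sup>*" if "v \<in> Y" for v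
      using ec[OF Y] tgtY[OF Y] that unfolding end_component_def by blast
    then show ?thesis using f by blast
  qed
  then obtain f and rank :: "'v set \<Rightarrow> 'v \<Rightarrow> nat" where
    f: "\<And>Y v. winning_ec P RP Y \<Longrightarrow> v \<in> Y - {tgt Y} \<Longrightarrow> (v, f Y v) \<in> ?E \<inter> Y \<times> Y \<and> rank Y (f Y v) < rank Y v"
    by metis
  have "\<exists>w\<in>Y. (v, w) \<in> ?E" if "winning_ec P RP Y" "v \<in> Y" for Y v
    using end_component_succ[OF ec] that by blast
  then obtain nxt where nxt: "\<And>Y v. winning_ec P RP Y \<Longrightarrow> v \<in> Y \<Longrightarrow> nxt Y v \<in> Y \<and> (v, nxt Y v) \<in> ?E"
    by metis
  \<comment> \<open>A winning end-component reachable inside \<open>S\<close> may extend beyond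
    \<open>S\<close>, so plays are confined to the union instead.\<close>
  define S' where "S' = S \<union> W"
  have rcW: "?E `` {v} \<subseteq> X v" if "v \<in> W" "v \<in> random P" for v
    using X[OF that(1)] that(2) ec unfolding end_component_def by blast
  have XW: "X v \<subseteq> W" if "v \<in> W" for v
    using X[OF that] unfolding W_def by blast
  have rcS': "?E `` {v} \<subseteq> S'" if "v \<in> S'" "v \<in> random P" for v
    using that rcW[of v] XW[of v] S unfolding S'_def live_def by blast
  obtain g and rnk :: "'v \<Rightarrow> nat" where g: "\<And>v. v \<notin> W \<Longrightarrow> \<exists>t\<in>W. (v, t) \<in> (?E \<inter> S \<times> S)\<^sup>* \<Longrightarrow>
        (v, g v) \<in> ?E \<inter> S \<times> S \<and> rnk (g v) < rnk v"
    using decreasing_choice[of W "?E \<inter> S \<times> S"] by blast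
  have g': "(v, g v) \<in> ?E \<and> g v \<in> S' \<and> rnk (g v) < rnk v" if "v \<in> S' - W" for v
  proof -
    have "\<exists>t\<in>W. (v, t) \<in> (?E \<inter> S \<times> S)\<^sup>*"
      using that S unfolding S'_def live_def W_def by blast
    then show ?thesis using g[of v] that unfolding S'_def by blast
  qed
  \<comment> \<open>At the target any move inside the end-component serves, because a new approach
    begins afterwards. Outside \<open>S'\<close> the choice merely has to be an edge, since
    \<open>is_strategy\<close> constrains all histories.\<close>
  define pos where "pos v = (if v \<in> W then if v = tgt (X v) then nxt (X v) v else f (X v) v
    else if v \<in> S' then g v else SOME w. (v, w) \<in> ?E)" for v
  have posW: "(v, pos v) \<in> ?E \<and> pos v \<in> X v" if "v \<in> W" for v
    using nxt[of "X v" v] f[of "X v" v] X[OF that] that unfolding pos_def by auto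
  have posS': "(v, pos v) \<in> ?E \<and> pos v \<in> S'" if "v \<in> S'" for v
    using posW[of v] XW[of v] g'[of v] that unfolding pos_def[of v] S'_def by (cases "v \<in> W") auto
  have posE: "(v, pos v) \<in> ?E" if "v \<in> verts P" for v
  proof (cases "v \<in> S'")
    case False
    have "\<exists>w. (v, w) \<in> ?E" using P that unfolding is_mdp_def by blast
    then have "(v, SOME w. (v, w) \<in> ?E) \<in> ?E" by (rule someI_ex)
    then show ?thesis using False unfolding pos_def S'_def by auto
  qed (use posS' in blast)
  define \<sigma> where "\<sigma> h = pos (last h)" for h
  have \<sigma>: "is_strategy P \<sigma>"
    unfolding is_strategy_def \<sigma>_def using posE by (metis last_in_set subsetD)
  have v0V: "v\<^sub>0 \<in> verts P" using v0 S by (auto simp: live_def)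
  have "AE \<omega> in play_measure P \<sigma> v\<^sub>0. \<omega> \<in> Rabin RP"
    using AE_play_step[of P \<sigma> v\<^sub>0] AE_Inf_verts_closed[OF P, of \<sigma> v\<^sub>0]
  proof eventually_elim
    case (elim \<omega>)
    let ?I = "Inf_verts \<omega>"
    have player: "\<omega> (Suc i) = pos (\<omega> i)" if "\<omega> i \<in> player1 P" for i
      using spec[OF elim(1), of "Suc i"] that unfolding \<sigma>_def by simp
    have random: "(\<omega> i, \<omega> (Suc i)) \<in> ?E" if "\<omega> i \<in> random P" for i
    proof -
      have "\<omega> i \<notin> player1 P" "set_pmf (delta P (\<omega> i)) = ?E `` {\<omega> i}"
        using P that unfolding is_mdp_def by blast+
      then show ?thesis using spec[OF elim(1), of "Suc i"] by simp
    qed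
    have S'V: "S' \<subseteq> player1 P \<union> random P"
    proof -
      have "W \<subseteq> verts P" using ec unfolding W_def end_component_def by blast
      then show ?thesis using P S unfolding S'_def live_def is_mdp_def by auto
    qed
    have \<omega>S': "\<omega> i \<in> S'" for i
    proof (induction i)
      case 0
      then show ?case using spec[OF elim(1), of 0] v0 by (simp add: S'_def)
    next
      case (Suc i)
      then consider "\<omega> i \<in> player1 P" | "\<omega> i \<in> random P" using S'V by blast
      then show ?case
      proof cases
        case 1
        then show ?thesis using player[OF 1] posS'[OF Suc] by simp
      next
        case 2
        then show ?thesis using random[OF 2] rcS'[OF Suc] by blast
      qed
    qed
    have "finite (player1 P \<union> random P)"
      using P unfolding is_mdp_def by simp
    then have "finite S'"
      using S'V by (rule finite_subset[rotated])
    then obtain N where N: "\<And>i. N \<le> i \<Longrightarrow> \<omega> i \<in> ?I"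
      using eventually_in_Inf_verts \<omega>S' by blast
    have IS': "?I \<subseteq> S'" using \<omega>S' by (rule Inf_verts_subset)
    \<comment> \<open>The recurring vertices are closed under the moves of \<open>pos\<close> and
      under all edges of random vertices. Hence a recurring vertex of minimal rank that is not yet
      at its goal would have a recurring neighbour of smaller rank; both descents below are of this
      kind.\<close>
    have closed: "w \<in> ?I" if v: "v \<in> ?I" and w: "(v, w) \<in> ?E" "v \<in> player1 P \<Longrightarrow> w = pos v" for v w
    proof (cases "v \<in> player1 P")
      case True
      have "\<exists>i\<ge>m. \<omega> i = w" for m
      proof -
        obtain i where "m \<le> i" "\<omega> i = v" using v unfolding Inf_verts_iff by blast
        then have "m \<le> Suc i" "\<omega> (Suc i) = w" using player[of i] w(2) True by auto
        then show ?thesis by blast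
      qed
      then show ?thesis unfolding Inf_verts_iff by blast
    next
      case False
      then have "v \<in> random P" using v IS' S'V by blast
      then show ?thesis using elim(2) v w(1) by blast
    qed
    have "?I \<inter> W \<noteq> {}"
    proof
      assume dis: "?I \<inter> W = {}"
      obtain v where v: "v \<in> ?I" "\<And>u. u \<in> ?I \<Longrightarrow> rnk v \<le> rnk u"
        using ex_minimal[OF N[OF order_refl], of "rnk"] by blast
      then have "v \<in> S' - W" using dis IS' by blast
      then have "g v \<in> ?I" using closed[OF v(1), of "g v"] g'[of v] unfolding pos_def by auto
      then show False using v(2)[of "g v"] g'[OF \<open>v \<in> S' - W\<close>] by simp
    qed
    then obtain u where u: "u \<in> ?I \<inter> W" by blast
    \<comment> \<open>Take the least index that recurs. After a visit to \<open>w\<close> the index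
      never exceeds it, and no recurring vertex lies below it, so by injectivity of
      \<open>idx\<close> all recurring vertices share one end-component.\<close>
    obtain w where w: "w \<in> ?I \<inter> W" "\<And>u. u \<in> ?I \<inter> W \<Longrightarrow> idx (X w) \<le> idx (X u)"
      using ex_minimal[OF u, of "\<lambda>v. idx (X v)"] by blast
    obtain i where i: "\<omega> i = w" using w(1) unfolding Int_iff Inf_verts_iff by blast
    have mono: "\<omega> j \<in> W \<and> idx (X (\<omega> j)) \<le> idx (X w)" if "i \<le> j" for j
      using that
    proof (induction rule: dec_induct)
      case base
      then show ?case using w(1) i by simp
    next
      case (step j)
      then have "\<omega> (Suc j) \<in> X (\<omega> j)"
        using rcW[of "\<omega> j"] posW[of "\<omega> j"] player[of j] random[of j] S'V \<omega>S'[of j]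
        by (cases "\<omega> j \<in> player1 P") auto
      then show ?case
        using step X[of "\<omega> j"] X_le[of "X (\<omega> j)" "\<omega> (Suc j)"] XW[of "\<omega> j"] by auto
    qed
    define Y where "Y = X w"
    have Y: "winning_ec P RP Y" unfolding Y_def using X w(1) by blast
    have IY: "X u = Y \<and> u \<in> W \<and> u \<in> Y" if u: "u \<in> ?I" for u
    proof -
      obtain j where "i \<le> j" "\<omega> j = u" using u unfolding Inf_verts_iff by blast
      with mono have 1: "u \<in> W" "idx (X u) \<le> idx (X w)" by auto
      then have "idx (X u) = idx (X w)" using w(2)[of u] u by auto
      then have "X u = X w"
        using inj_onD[OF idx, of "X u" "X w"] X[of u] X[of w] 1(1) w(1) by blast
      then show ?thesis using 1 X[of u] unfolding Y_def by auto
    qed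
    have "tgt Y \<in> ?I"
    proof (rule ccontr)
      assume no: "tgt Y \<notin> ?I"
      obtain v where v: "v \<in> ?I" "\<And>u. u \<in> ?I \<Longrightarrow> rank Y v \<le> rank Y u"
        using ex_minimal[OF N[OF order_refl], of "rank Y"] by blast
      then have vY: "v \<in> Y - {tgt Y}" using IY no by auto
      then have "f Y v \<in> ?I"
        using closed[OF v(1), of "f Y v"] f[OF Y vY] IY[OF v(1)] unfolding pos_def by auto
      then show False using v(2)[of "f Y v"] f[OF Y vY] by simp
    qed
    moreover obtain L U where "(L, U) \<in> set RP" "tgt Y \<in> L" "U \<inter> Y = {}"
      using tgt[OF Y] by blast
    ultimately show "\<omega> \<in> Rabin RP"
      unfolding Rabin_def using IY by blast
  qed
  then show "v\<^sub>0 \<in> as_win P (Rabin RP)"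
    unfolding as_win_def using v0V \<sigma> by blast
qed

theorem as_win_Rabin_eq:
  fixes P :: "'v::countable mdp"
  assumes "is_mdp P"
  shows "as_win P (Rabin RP) = \<Union>{S. live P RP S}"
proof
  show "as_win P (Rabin RP) \<subseteq> \<Union>{S. live P RP S}"
    by (rule subsetI, erule as_win_in_live[OF assms]) blast
qed (use live_subset_as_win[OF assms] in blast)

section \<open>End-components and attractors\<close>

lemma winning_ec_subset_as_win:
  fixes P :: "'v::countable mdp"
  assumes P: "is_mdp P" and X: "winning_ec P RP X"
  shows "X \<subseteq> as_win P (Rabin RP)"
proof -
  have "live P RP X"
    using X unfolding live_def winning_ec_def end_component_def by (auto intro!: exI[of _ X])
  then show ?thesis using live_subset_as_win[OF P] by blast
qed

lemma end_component_in_mec: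
  assumes P: "is_mdp P" and X: "end_component P X"
  obtains Y where "Y \<in> mecs P" "X \<subseteq> Y"
proof -
  let ?F = "{Y. end_component P Y \<and> X \<subseteq> Y}"
  have "finite ?F"
    using finite_end_components[OF P] by (rule finite_subset[rotated]) auto
  moreover have "X \<in> ?F" using X by simp
  ultimately obtain Y where "Y \<in> ?F" "\<forall>Z\<in>?F. Y \<subseteq> Z \<longrightarrow> Y = Z"
    using finite_has_maximal[of ?F] by blast
  then show thesis
    using that[of Y] unfolding mecs_def by blast
qed

section \<open>Reachability in finite graphs and bottom components\<close>

lemma rtrancl_exit:
  assumes "(v, w) \<in> r\<^sup>*" "g v = x" "g w \<noteq> x"
  shows "\<exists>a b. (a, b) \<in> r \<and> g a = x \<and> g b \<noteq> x"
  using assms by (induction rule: rtrancl_induct) blast+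

lemma rtrancl_within:
  assumes "(a, b) \<in> r\<^sup>*" "r `` C \<subseteq> C" "a \<in> C"
  shows "b \<in> C \<and> (a, b) \<in> (r \<inter> C \<times> C)\<^sup>*"
  using assms(1)
proof (induction rule: rtrancl_induct)
  case (step y z)
  then have "(y, z) \<in> r \<inter> C \<times> C" using assms(2) by auto
  then show ?case using step by (auto intro: rtrancl_into_rtrancl)
qed (simp add: assms(3))

text \<open>Among the vertices reachable from \<open>v\<close>, take one with the fewest reachable
  vertices. Whatever it reaches has a reachable set that is contained in its own and no smaller,
  hence equal, and therefore reaches back.\<close>

lemma bottom_component:
  assumes "finite S" "r \<subseteq> S \<times> S" "v \<in> S"
  obtains u where "(v, u) \<in> r\<^sup>*" "\<And>w. (u, w) \<in> r\<^sup>* \<Longrightarrow> (w, u) \<in> r\<^sup>*"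
proof -
  have sub: "r\<^sup>* `` {u} \<subseteq> S" if "u \<in> S" for u
    using rtrancl_within[of u _ r S] that assms(2) by auto
  obtain u where u: "u \<in> r\<^sup>* `` {v}" "\<And>w. w \<in> r\<^sup>* `` {v} \<Longrightarrow> card (r\<^sup>* `` {u}) \<le> card (r\<^sup>* `` {w})"
    using ex_minimal[of v "r\<^sup>* `` {v}" "\<lambda>u. card (r\<^sup>* `` {u})"] by auto
  have "(w, u) \<in> r\<^sup>*" if w: "(u, w) \<in> r\<^sup>*" for w
  proof -
    have "r\<^sup>* `` {w} \<subseteq> r\<^sup>* `` {u}" using w by auto
    moreover have "card (r\<^sup>* `` {u}) \<le> card (r\<^sup>* `` {w})"
      using u w by (auto intro: rtrancl_trans)
    moreover have "finite (r\<^sup>* `` {u})"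
      using sub[of u] sub[OF assms(3)] u(1) assms(1) finite_subset by blast
    ultimately have "r\<^sup>* `` {w} = r\<^sup>* `` {u}" by (meson card_seteq)
    then show ?thesis by auto
  qed
  then show thesis using that u(1) by blast
qed

text \<open>A bottom strongly connected component of the graph induced on \<open>S\<close> works: as
  random vertices do not leave \<open>S\<close>, closure inside \<open>S\<close> becomes closure in
  the MDP, and the successor condition supplies an edge even for a singleton. That \<open>C\<close>
  has no exit inside \<open>S\<close> is returned as well, because it later excludes unmarked
  MECs.\<close>

lemma reaches_end_component:
  assumes P: "is_mdp P" and S: "S \<subseteq> verts P"
    and closed: "\<forall>v\<in>S \<inter> random P. edges P `` {v} \<subseteq> S"
    and succ: "\<forall>v\<in>S. \<exists>w\<in>S. (v, w) \<in> edges P"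
    and v: "v \<in> S"
  obtains C u where "end_component P C" "C \<subseteq> S" "u \<in> C" "(v, u) \<in> (edges P \<inter> S \<times> S)\<^sup>*"
    "(edges P \<inter> S \<times> S) `` C \<subseteq> C"
proof -
  let ?r = "edges P \<inter> S \<times> S"
  have "finite S" using P S finite_subset unfolding is_mdp_def by blast
  then obtain u where u: "(v, u) \<in> ?r\<^sup>*" "\<And>w. (u, w) \<in> ?r\<^sup>* \<Longrightarrow> (w, u) \<in> ?r\<^sup>*"
    using bottom_component[of S ?r v] v by blast
  define C where "C = ?r\<^sup>* `` {u}"
  have uS: "u \<in> S" using rtrancl_within[OF u(1), of S] v by auto
  have CS: "C \<subseteq> S" unfolding C_def using rtrancl_within[of u _ ?r S] uS by auto
  have rC: "?r `` C \<subseteq> C" unfolding C_def by (auto intro: rtrancl_into_rtrancl)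
  have uC: "u \<in> C" unfolding C_def by auto
  have "(a, b) \<in> (edges P \<inter> C \<times> C)\<^sup>*" if ab: "a \<in> C" "b \<in> C" for a b
  proof -
    have "(a, b) \<in> ?r\<^sup>*"
      using ab u(2) unfolding C_def by (auto intro: rtrancl_trans)
    then have "(a, b) \<in> (?r \<inter> C \<times> C)\<^sup>*"
      using rtrancl_within[OF _ rC ab(1)] by blast
    then show ?thesis
      by (rule rtrancl_mono[THEN subsetD, rotated]) auto
  qed
  moreover have "edges P \<inter> C \<times> C \<noteq> {}"
    using succ uS uC rC by blast
  moreover have "\<forall>v\<in>C \<inter> random P. edges P `` {v} \<subseteq> C"
    using closed rC CS by blast
  ultimately have "end_component P C"
    unfolding end_component_def using CS S by blast
  then show thesis using that CS uC u(1) rC by blast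
qed

text \<open>\<open>Z\<close> is the least set of nodes that contains every node \<open>x\<close> with at least \<open>c x\<close> edges into
  \<open>Z\<close>. The edges are \<open>(src e, dst e)\<close> for \<open>e < m\<close>.\<close>

definition threshold_attractor ::
  "nat \<Rightarrow> nat \<Rightarrow> (nat \<Rightarrow> nat) \<Rightarrow> (nat \<Rightarrow> nat) \<Rightarrow> (nat \<Rightarrow> nat) \<Rightarrow> nat set \<Rightarrow> bool" where
  "threshold_attractor N m src dst c Z \<longleftrightarrow>
     (\<forall>x<N. c x \<le> card {e. e < m \<and> src e = x \<and> dst e \<in> Z} \<longrightarrow> x \<in> Z) \<and>
     (\<forall>Q. (\<forall>x<N. c x \<le> card {e. e < m \<and> src e = x \<and> Q (dst e)} \<longrightarrow> Q x) \<longrightarrow> (\<forall>x<N. x \<in> Z \<longrightarrow> Q x))"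

lemma threshold_attractorD:
  assumes "threshold_attractor N m src dst c Z" "x < N" "x \<notin> Z"
  shows "card {e. e < m \<and> src e = x \<and> dst e \<in> Z} < c x"
proof (rule ccontr)
  assume "\<not> ?thesis"
  then have "x \<in> Z"
    using assms(2) conjunct1[OF assms(1)[unfolded threshold_attractor_def], rule_format, of x] by simp
  then show False using assms(3) by simp
qed

lemma threshold_attractor_induct:
  assumes "threshold_attractor N m src dst c Z" "x < N" "x \<in> Z"
    and "\<And>x. x < N \<Longrightarrow> c x \<le> card {e. e < m \<and> src e = x \<and> Q (dst e)} \<Longrightarrow> Q x"
  shows "Q x"
  using conjunct2[OF assms(1)[unfolded threshold_attractor_def], rule_format, of Q x] assms(2-4) by simp

section \<open>Counting edges by their numbers\<close>

lemma card_edges_pos: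
  fixes e m :: nat
  assumes "e < m" "R e"
  shows "1 \<le> card {e. e < m \<and> R e}"
proof -
  have "{e} \<subseteq> {e. e < m \<and> R e}" using assms by simp
  from card_mono[OF _ this] show ?thesis by simp
qed

lemma card_edges_less:
  fixes m :: nat
  assumes "card {e. e < m \<and> R e} < card {e. e < m \<and> R' e}"
  obtains e where "e < m" "R' e" "\<not> R e"
proof -
  have "\<not> {e. e < m \<and> R' e} \<subseteq> {e. e < m \<and> R e}"
    using assms card_mono[of "{e. e < m \<and> R e}" "{e. e < m \<and> R' e}"] by auto
  then show thesis using that by blast
qed

lemma card_edges_le_eq:
  fixes m :: nat
  assumes "card {e. e < m \<and> R' e} \<le> card {e. e < m \<and> R e}"
    and "\<And>e. e < m \<Longrightarrow> R e \<Longrightarrow> R' e" and "e < m" "R' e"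
  shows "R e"
proof -
  have "{e. e < m \<and> R e} = {e. e < m \<and> R' e}"
    using assms(1,2) by (intro card_seteq) auto
  then show ?thesis using assms(3,4) by blast
qed

text \<open>Edges carry numbers because the attractors count edges: after contraction, distinct
  edges may have the same end nodes and must still be counted separately.\<close>

locale enumerated_mdp =
  fixes P :: "nat mdp" and n m :: nat and src dst :: "nat \<Rightarrow> nat"
  assumes mdp: "is_mdp P"
    and verts: "verts P = {..<n}"
    and enum: "bij_betw (\<lambda>e. (src e, dst e)) {..<m} (edges P)"
begin

lemma edge_cases:
  assumes "(u, w) \<in> edges P"
  obtains e where "e < m" "src e = u" "dst e = w"
proof -
  have "(u, w) \<in> (\<lambda>e. (src e, dst e)) ` {..<m}"
    using assms enum by (simp add: bij_betw_def)
  then show thesis using that by auto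
qed

lemma edgeI: "e < m \<Longrightarrow> (src e, dst e) \<in> edges P"
  using enum unfolding bij_betw_def by blast

lemma edge_less: "(u, w) \<in> edges P \<Longrightarrow> u < n \<and> w < n"
  using mdp verts unfolding is_mdp_def by auto

lemma player_or_random: "v < n \<Longrightarrow> v \<in> player1 P \<or> v \<in> random P"
  using mdp verts unfolding is_mdp_def by auto

lemma not_player_and_random: "\<not> (v \<in> player1 P \<and> v \<in> random P)"
  using mdp unfolding is_mdp_def by auto

lemma ex_succ: "v < n \<Longrightarrow> \<exists>w. (v, w) \<in> edges P"
  using mdp verts unfolding is_mdp_def by auto

text \<open>Outside \<open>Z\<close>, player 1 can surely avoid \<open>U\<close>.\<close>

context
  fixes U :: "nat set" and c :: "nat \<Rightarrow> nat" and Z :: "nat set"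
  assumes attr: "threshold_attractor n m src dst c Z"
    and c_U: "\<And>v. v < n \<Longrightarrow> v \<in> U \<Longrightarrow> c v = 0"
    and c_random: "\<And>v. v < n \<Longrightarrow> v \<notin> U \<Longrightarrow> v \<in> random P \<Longrightarrow> c v = 1"
    and c_player: "\<And>v. v < n \<Longrightarrow> v \<notin> U \<Longrightarrow> v \<in> player1 P \<Longrightarrow> c v = card {e. e < m \<and> src e = v}"
begin

text \<open>Induction on the attractor: no vertex of \<open>X\<close> can enter it. Edges of random
  vertices stay in \<open>X\<close>, and a player-1 vertex keeps an edge into \<open>X\<close>, so
  its threshold, the full out-degree, is not reached.\<close>

lemma end_component_safe:
  assumes X: "end_component P X" "X \<inter> U = {}"
  shows "X \<subseteq> {v. v < n \<and> v \<notin> Z}"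
proof
  fix v assume v: "v \<in> X"
  have Xn: "X \<subseteq> {..<n}" using X(1) verts by (simp add: end_component_def)
  have "v \<notin> Z"
  proof
    assume "v \<in> Z"
    from attr _ this have "v \<notin> X"
    proof (rule threshold_attractor_induct)
      show "v < n" using v Xn by auto
      fix x assume x: "x < n" and le: "c x \<le> card {e. e < m \<and> src e = x \<and> dst e \<notin> X}"
      show "x \<notin> X"
      proof
        assume xX: "x \<in> X"
        then have xU: "x \<notin> U" using X(2) by blast
        consider "x \<in> random P" | "x \<in> player1 P" using player_or_random[OF x] by blast
        then show False
        proof cases
          case 1
          then have "0 < card {e. e < m \<and> src e = x \<and> dst e \<notin> X}"
            using le c_random[OF x xU] by simp
          then obtain e where "e < m" "src e = x" "dst e \<notin> X"
            by (auto simp: card_gt_0_iff)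
          then show False
            using X(1) xX 1 edgeI[of e] unfolding end_component_def by blast
        next
          case 2
          obtain w where w: "w \<in> X" "(x, w) \<in> edges P"
            using end_component_succ[OF X(1) xX] by blast
          obtain e where e: "e < m" "src e = x" "dst e = w" using edge_cases[OF w(2)] .
          have "src e = x \<and> dst e \<notin> X"
            using le c_player[OF x xU 2] e
            by (intro card_edges_le_eq[where R'="\<lambda>e. src e = x" and R="\<lambda>e. src e = x \<and> dst e \<notin> X" and m=m]) auto
          then show False using e w by simp
        qed
      qed
    qed
    then show False using v by simp
  qed
  then show "v \<in> {v. v < n \<and> v \<notin> Z}" using v Xn by auto
qed

text \<open>The complement of \<open>Z\<close> is closed at random vertices and has no dead ends, so
  each of its vertices reaches an end-component that avoids \<open>U\<close> and meets the set of
  all vertices. \<open>RP\<close> stays general so that the result covers both the pair on its own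
  and the whole list.\<close>

lemma safe_subset_as_win:
  assumes "(verts P, U) \<in> set RP"
  shows "{v. v < n \<and> v \<notin> Z} \<subseteq> as_win P (Rabin RP)"
proof -
  let ?S = "{v. v < n \<and> v \<notin> Z}"
  have SV: "?S \<subseteq> verts P" using verts by auto
  have SU: "v \<notin> U" if "v \<in> ?S" for v
    using threshold_attractorD[OF attr, of v] c_U[of v] that by auto
  have closed: "\<forall>v\<in>?S \<inter> random P. edges P `` {v} \<subseteq> ?S"
  proof (intro ballI subsetI)
    fix v w assume v: "v \<in> ?S \<inter> random P" and "w \<in> edges P `` {v}"
    then have vw: "(v, w) \<in> edges P" by simp
    obtain e where e: "e < m" "src e = v" "dst e = w" using edge_cases[OF vw] .
    have "w \<notin> Z"
    proof
      assume "w \<in> Z"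
      then have "1 \<le> card {e. e < m \<and> (src e = v \<and> dst e \<in> Z)}"
        using e by (intro card_edges_pos) auto
      moreover have "card {e. e < m \<and> (src e = v \<and> dst e \<in> Z)} < 1"
        using threshold_attractorD[OF attr, of v] c_random[of v] SU[of v] v by simp
      ultimately show False by linarith
    qed
    then show "w \<in> ?S" using edge_less[OF vw] by simp
  qed
  have succ: "\<forall>v\<in>?S. \<exists>w\<in>?S. (v, w) \<in> edges P"
  proof
    fix v assume v: "v \<in> ?S"
    then consider "v \<in> random P" | "v \<in> player1 P" using player_or_random by blast
    then show "\<exists>w\<in>?S. (v, w) \<in> edges P"
    proof cases
      case 1
      then show ?thesis using closed ex_succ[of v] v by blast
    next
      case 2
      have "card {e. e < m \<and> (src e = v \<and> dst e \<in> Z)} < card {e. e < m \<and> src e = v}"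
        using threshold_attractorD[OF attr, of v] c_player[of v] SU[OF v] v 2 by auto
      then obtain e where "e < m" "src e = v" "dst e \<notin> Z"
        by (rule card_edges_less) auto
      then show ?thesis using edgeI[of e] edge_less[of v "dst e"] by auto
    qed
  qed
  have "live P RP ?S"
    unfolding live_def
  proof (intro conjI SV closed ballI)
    fix v assume "v \<in> ?S"
    then obtain C u where C: "end_component P C" "C \<subseteq> ?S" "u \<in> C" "(v, u) \<in> (edges P \<inter> ?S \<times> ?S)\<^sup>*"
      "(edges P \<inter> ?S \<times> ?S) `` C \<subseteq> C"
      by (rule reaches_end_component[OF mdp SV closed succ])
    have "verts P \<inter> C \<noteq> {}" "U \<inter> C = {}"
      using C SU SV by blast+
    then have "winning_ec P RP C"
      using C(1) assms unfolding winning_ec_def by blast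
    then show "\<exists>X w. winning_ec P RP X \<and> w \<in> X \<and> (v, w) \<in> (edges P \<inter> ?S \<times> ?S)\<^sup>*"
      using C by blast
  qed
  then show ?thesis by (rule live_subset_as_win[OF mdp])
qed

end

text \<open>MECs are contracted to single nodes with their label as number; a vertex \<open>v\<close> outside all
  MECs becomes the node \<open>n + 1 + v\<close>.\<close>

definition group :: "(nat \<Rightarrow> nat) \<Rightarrow> nat \<Rightarrow> nat" where
  "group lab v = (if lab v = 0 then n + 1 + v else lab v)"

definition is_mec_labelling :: "(nat \<Rightarrow> nat) \<Rightarrow> bool" where
  "is_mec_labelling lab \<longleftrightarrow> (\<forall>v<n. lab v \<le> n) \<and>
     {{v. v < n \<and> lab v = l} |l. l \<in> lab ` {..<n} \<and> l \<noteq> 0} = mecs P"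

lemma label_class_mec:
  assumes "is_mec_labelling lab" "v < n" "lab v \<noteq> 0"
  shows "{u. u < n \<and> lab u = lab v} \<in> mecs P"
  using assms unfolding is_mec_labelling_def by blast

lemma label_class_end_component:
  assumes "is_mec_labelling lab" "v < n" "lab v \<noteq> 0"
  shows "end_component P {u. u < n \<and> lab u = lab v}"
  using label_class_mec[OF assms] by (simp add: mecs_def)

lemma end_component_label:
  assumes "is_mec_labelling lab" "end_component P X" "u \<in> X" "v \<in> X"
  shows "lab u = lab v \<and> lab v \<noteq> 0"
proof -
  obtain Y where "Y \<in> mecs P" "X \<subseteq> Y" using end_component_in_mec[OF mdp assms(2)] .
  moreover then obtain l where "Y = {v. v < n \<and> lab v = l}" "l \<noteq> 0"
    using assms(1) unfolding is_mec_labelling_def by blast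
  ultimately show ?thesis using assms(3,4) by auto
qed

text \<open>Thresholds on the contracted graph. A threshold above \<open>m\<close> cannot be reached
  and protects a marked MEC. An unmarked MEC acts like a single player-1 vertex, since all its
  vertices can be reached from each other; its internal edges are left out of the threshold, so that
  they cannot keep the node alive. Marks outside the MECs have no effect.\<close>

context
  fixes lab c :: "nat \<Rightarrow> nat" and marked Z :: "nat set" and RP :: "nat rabin_pairs"
  assumes lab: "is_mec_labelling lab"
    and attr: "threshold_attractor (2 * n + 1) m (\<lambda>e. group lab (src e)) (\<lambda>e. group lab (dst e)) c Z"
    and c_random: "\<And>v. v < n \<Longrightarrow> lab v = 0 \<Longrightarrow> v \<in> random P \<Longrightarrow> c (group lab v) = 1"
    and c_marked: "\<And>v. v < n \<Longrightarrow> lab v \<noteq> 0 \<Longrightarrow> v \<in> marked \<Longrightarrow> m < c (group lab v)"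
    and c_other: "\<And>v. v < n \<Longrightarrow> (lab v = 0 \<longrightarrow> v \<in> player1 P) \<Longrightarrow>
      (lab v \<noteq> 0 \<longrightarrow> (\<forall>u<n. lab u = lab v \<longrightarrow> u \<notin> marked)) \<Longrightarrow>
      c (group lab v) = card {e. e < m \<and> group lab (src e) = group lab v \<and> group lab (dst e) \<noteq> group lab v}"
    and marked_win: "\<And>v. v < n \<Longrightarrow> v \<in> marked \<Longrightarrow> lab v \<noteq> 0 \<Longrightarrow> v \<in> as_win P (Rabin RP)"
    and win_marked: "\<And>X u. winning_ec P RP X \<Longrightarrow> u \<in> X \<Longrightarrow> \<exists>v<n. v \<in> marked \<and> lab v = lab u"
begin

lemma group_less: "v < n \<Longrightarrow> group lab v < 2 * n + 1"
  using lab unfolding is_mec_labelling_def group_def by auto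

lemma group_eq_iff:
  assumes "u < n" "v < n"
  shows "group lab u = group lab v \<longleftrightarrow> lab u = lab v \<and> (lab v = 0 \<longrightarrow> u = v)"
proof -
  have "lab u \<le> n" "lab v \<le> n" using lab assms unfolding is_mec_labelling_def by auto
  then show ?thesis unfolding group_def by auto
qed

text \<open>A winning vertex lies in a live set \<open>S\<close>, all of whose vertices win. At a
  random vertex the lost edge would lead into \<open>S\<close>. At an unmarked node, the path in
  \<open>S\<close> to a winning end-component must leave the node, for that end-component lies in a
  marked MEC; so some leaving edge ends in a winning vertex, although the threshold says that all of
  them are lost.\<close>

lemma attractor_not_winning:
  assumes v: "v < n" "group lab v \<in> Z"
  shows "v \<notin> as_win P (Rabin RP)"
proof -
  \<comment> \<open>The claim ranges over all vertices contracted to \<open>x\<close>; it is vacuous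
    for numbers such as 0 to which no vertex is contracted.\<close>
  let ?Q = "\<lambda>x. \<forall>v<n. group lab v = x \<longrightarrow> v \<notin> as_win P (Rabin RP)"
  from attr group_less[OF v(1)] v(2) have "?Q (group lab v)"
  proof (rule threshold_attractor_induct)
    fix x assume le: "c x \<le> card {e. e < m \<and> group lab (src e) = x \<and> ?Q (group lab (dst e))}"
    show "?Q x"
    proof (intro allI impI notI)
      fix v assume v: "v < n" "group lab v = x" "v \<in> as_win P (Rabin RP)"
      then obtain S where S: "live P RP S" "v \<in> S"
        using as_win_Rabin_eq[OF mdp] by blast
      have Swin: "S \<subseteq> as_win P (Rabin RP)" by (rule live_subset_as_win[OF mdp S(1)])
      consider (random) "lab v = 0" "v \<in> random P"
        | (marked) u where "lab v \<noteq> 0" "u < n" "lab u = lab v" "u \<in> marked"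
        | (other) "lab v = 0 \<longrightarrow> v \<in> player1 P" "lab v \<noteq> 0 \<longrightarrow> (\<forall>u<n. lab u = lab v \<longrightarrow> u \<notin> marked)"
        using player_or_random[OF v(1)] by metis
      then show False
      proof cases
        case random
        then have "0 < card {e. e < m \<and> group lab (src e) = x \<and> ?Q (group lab (dst e))}"
          using le c_random[OF v(1)] v(2) by simp
        then obtain e where e: "e < m" "group lab (src e) = x" "?Q (group lab (dst e))"
          by (auto simp: card_gt_0_iff)
        have less: "src e < n" "dst e < n" using edge_less[OF edgeI[OF e(1)]] by auto
        then have "src e = v" using e(2) v group_eq_iff[of "src e" v] random(1) by auto
        then have "dst e \<in> S"
          using S random(2) edgeI[OF e(1)] unfolding live_def by blast
        then show False using e(3) less Swin by blast
      next
        case marked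
        have "group lab u = x" using marked v by (auto simp: group_def)
        then have "m < c x" using c_marked[of u] marked by auto
        also have "c x \<le> card {..<m}"
          using le by (rule order_trans) (intro card_mono, auto)
        finally show False by simp
      next
        case other
        have c: "c x = card {e. e < m \<and> (group lab (src e) = x \<and> group lab (dst e) \<noteq> x)}"
          using c_other[OF v(1) other] v(2) by simp
        obtain X w where X: "winning_ec P RP X" "w \<in> X" "(v, w) \<in> (edges P \<inter> S \<times> S)\<^sup>*"
          using S unfolding live_def by blast
        have ecX: "end_component P X" using X(1) by (simp add: winning_ec_def)
        have wn: "w < n" using X(2) ecX verts unfolding end_component_def by auto
        have "group lab w \<noteq> x"
        proof
          assume "group lab w = x"
          then have "lab w = lab v" using group_eq_iff[OF wn v(1)] v(2) by simp
          then show False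
            using end_component_label[OF lab ecX X(2) X(2)] win_marked[OF X(1,2)] other(2) by auto
        qed
        then obtain a b where ab: "(a, b) \<in> edges P \<inter> S \<times> S" "group lab a = x" "group lab b \<noteq> x"
          using rtrancl_exit[OF X(3), of "group lab" x] v(2) by blast
        obtain e where e: "e < m" "src e = a" "dst e = b" using edge_cases[of a b] ab(1) by blast
        have "group lab (src e) = x \<and> ?Q (group lab (dst e))"
        proof (rule card_edges_le_eq[where R'="\<lambda>e. group lab (src e) = x \<and> group lab (dst e) \<noteq> x"
              and R="\<lambda>e. group lab (src e) = x \<and> ?Q (group lab (dst e))" and m=m])
          show "card {e. e < m \<and> (group lab (src e) = x \<and> group lab (dst e) \<noteq> x)} \<le>
            card {e. e < m \<and> (group lab (src e) = x \<and> ?Q (group lab (dst e)))}"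
            using le unfolding c .
          show "group lab (src e) = x \<and> group lab (dst e) \<noteq> x"
            if "group lab (src e) = x \<and> ?Q (group lab (dst e))" for e
            using that v by blast
        qed (use e ab in auto)
        then show False using e ab(1) Swin edge_less[of a b] by blast
      qed
    qed
  qed
  then show ?thesis using v(1) by blast
qed

text \<open>To see that the complement is live, follow a vertex to a bottom end-component
  \<open>C\<close>. Its MEC lies in the complement, as nodes are lost as a whole. If the MEC were
  unmarked, an edge would lead from it to another node that is not lost; its end would be reachable
  from \<open>C\<close>, hence in \<open>C\<close>, hence in the same MEC. So the MEC has a marked
  vertex, which wins, and from there a live set leads on to a winning end-component.\<close>

lemma as_win_eq_attractor_compl: "as_win P (Rabin RP) = {v. v < n \<and> group lab v \<notin> Z}"
proof
  show "as_win P (Rabin RP) \<subseteq> {v. v < n \<and> group lab v \<notin> Z}"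
    using attractor_not_winning verts unfolding as_win_def by auto
next
  let ?S = "{v. v < n \<and> group lab v \<notin> Z}"
  have SV: "?S \<subseteq> verts P" using verts by auto
  have same: "w \<in> ?S" if "v \<in> ?S" "w < n" "lab w = lab v" "lab v \<noteq> 0" for v w
    using that by (simp add: group_def)
  have cls: "end_component P {u. u < n \<and> lab u = lab v}" "{u. u < n \<and> lab u = lab v} \<subseteq> ?S"
    if "v \<in> ?S" "lab v \<noteq> 0" for v
    using label_class_end_component[OF lab _ that(2)] that same[OF that(1) _ _ that(2)] by auto
  have closed: "\<forall>v\<in>?S \<inter> random P. edges P `` {v} \<subseteq> ?S"
  proof (intro ballI subsetI)
    fix v w assume v: "v \<in> ?S \<inter> random P" and "w \<in> edges P `` {v}"
    then have vw: "(v, w) \<in> edges P" by simp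
    show "w \<in> ?S"
    proof (cases "lab v = 0")
      case True
      obtain e where e: "e < m" "src e = v" "dst e = w" using edge_cases[OF vw] .
      have "group lab w \<notin> Z"
      proof
        assume "group lab w \<in> Z"
        then have "1 \<le> card {e. e < m \<and> (group lab (src e) = group lab v \<and> group lab (dst e) \<in> Z)}"
          using e by (intro card_edges_pos) auto
        moreover have "card {e. e < m \<and> (group lab (src e) = group lab v \<and> group lab (dst e) \<in> Z)} < 1"
          using threshold_attractorD[OF attr group_less, of v] c_random[of v] v True by simp
        ultimately show False by linarith
      qed
      then show ?thesis using edge_less[OF vw] by simp
    next
      case False
      then have "w \<in> {u. u < n \<and> lab u = lab v}"
        using cls(1)[of v] v vw unfolding end_component_def by blast
      then show ?thesis using same[of v w] v False by blast
    qed
  qed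
  have exit: "\<exists>a b. (a, b) \<in> edges P \<and> a < n \<and> b \<in> ?S \<and> group lab a = group lab v \<and> group lab b \<noteq> group lab v"
    if v: "v \<in> ?S" "lab v = 0 \<longrightarrow> v \<in> player1 P" "lab v \<noteq> 0 \<longrightarrow> (\<forall>u<n. lab u = lab v \<longrightarrow> u \<notin> marked)" for v
  proof -
    have "card {e. e < m \<and> (group lab (src e) = group lab v \<and> group lab (dst e) \<in> Z)} <
      card {e. e < m \<and> (group lab (src e) = group lab v \<and> group lab (dst e) \<noteq> group lab v)}"
      using threshold_attractorD[OF attr group_less, of v] c_other[OF _ v(2,3)] v(1) by auto
    then obtain e where e: "e < m" "group lab (src e) = group lab v" "group lab (dst e) \<noteq> group lab v"
        "group lab (dst e) \<notin> Z"
      by (rule card_edges_less) auto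
    then show ?thesis
      using edgeI[OF e(1)] edge_less[OF edgeI[OF e(1)]] by auto
  qed
  have succ: "\<forall>v\<in>?S. \<exists>w\<in>?S. (v, w) \<in> edges P"
  proof
    fix v assume v: "v \<in> ?S"
    consider "v \<in> random P" | "lab v \<noteq> 0" | "lab v = 0" "v \<in> player1 P"
      using player_or_random[of v] v by blast
    then show "\<exists>w\<in>?S. (v, w) \<in> edges P"
    proof cases
      case 1
      then show ?thesis using closed ex_succ[of v] v by blast
    next
      case 2
      then show ?thesis using end_component_succ[OF cls(1)[OF v 2], of v] cls(2)[OF v 2] v by blast
    next
      case 3
      then obtain a b where "(a, b) \<in> edges P" "a < n" "b \<in> ?S" "group lab a = group lab v"
        using exit[OF v] by auto
      then show ?thesis using group_eq_iff[of a v] v 3(1) by auto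
    qed
  qed
  have "live P RP ?S"
    unfolding live_def
  proof (intro conjI SV closed ballI)
    let ?r = "edges P \<inter> ?S \<times> ?S"
    fix v assume "v \<in> ?S"
    then obtain C u where C: "end_component P C" "C \<subseteq> ?S" "u \<in> C" "(v, u) \<in> ?r\<^sup>*" "?r `` C \<subseteq> C"
      by (rule reaches_end_component[OF mdp SV closed succ])
    have labC: "lab w = lab u" "lab u \<noteq> 0" if "w \<in> C" for w
      using end_component_label[OF lab C(1) that C(3)] by auto
    have uS: "u \<in> ?S" using C by blast
    note uX = cls[OF uS labC(2)[OF C(3)]]
    have reach: "(u, w) \<in> ?r\<^sup>*" if "w < n" "lab w = lab u" for w
    proof -
      let ?X = "{w. w < n \<and> lab w = lab u}"
      have "(u, w) \<in> (edges P \<inter> ?X \<times> ?X)\<^sup>*"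
        using uX(1) uS that unfolding end_component_def by blast
      then show ?thesis
        by (rule rtrancl_mono[THEN subsetD, rotated]) (use uX(2) in blast)
    qed
    have "\<exists>w<n. lab w = lab u \<and> w \<in> marked"
    proof (rule ccontr)
      assume "\<not> ?thesis"
      then obtain a b where ab: "(a, b) \<in> edges P" "a < n" "b \<in> ?S" "group lab a = group lab u"
          "group lab b \<noteq> group lab u"
        using exit[OF uS] labC(2)[OF C(3)] by blast
      then have la: "lab a = lab u" using group_eq_iff[of a u] uS by auto
      then have "(u, a) \<in> ?r\<^sup>*" "a \<in> ?S" using reach ab(2) uX(2) by auto
      then have "(u, b) \<in> ?r\<^sup>*" using ab(1,3) by (auto intro: rtrancl_into_rtrancl)
      then have "b \<in> C" using rtrancl_within[OF _ C(5,3)] by blast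
      then have "lab b = lab u" using labC by blast
      then show False using ab(5) labC(2)[OF C(3)] by (simp add: group_def)
    qed
    then obtain w where w: "w < n" "lab w = lab u" "w \<in> marked" by blast
    then have "w \<in> as_win P (Rabin RP)" using marked_win labC(2)[OF C(3)] by simp
    then obtain S1 where S1: "live P RP S1" "w \<in> S1"
      using as_win_Rabin_eq[OF mdp] by blast
    \<comment> \<open>The rest of the path uses winning vertices only, and these are never lost by
      the first inclusion.\<close>
    have "S1 \<subseteq> ?S"
      using live_subset_as_win[OF mdp S1(1)] attractor_not_winning S1(1) verts unfolding live_def by blast
    obtain X x where X: "winning_ec P RP X" "x \<in> X" "(w, x) \<in> (edges P \<inter> S1 \<times> S1)\<^sup>*"
      using S1 unfolding live_def by blast
    have "(w, x) \<in> ?r\<^sup>*"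
      using X(3) by (rule rtrancl_mono[THEN subsetD, rotated]) (use \<open>S1 \<subseteq> ?S\<close> in blast)
    then have "(v, x) \<in> ?r\<^sup>*"
      using C(4) reach[OF w(1,2)] by (meson rtrancl_trans)
    then show "\<exists>X w. winning_ec P RP X \<and> w \<in> X \<and> (v, w) \<in> ?r\<^sup>*"
      using X by blast
  qed
  then show "?S \<subseteq> as_win P (Rabin RP)" by (rule live_subset_as_win[OF mdp])
qed

end

end

text \<open>Replacing the edges of the vertices in \<open>U\<close> by self-loops leaves exactly the end-components
  that avoid \<open>U\<close>, and trivial ones, without increasing the number of edges.\<close>

definition absorb :: "'v mdp \<Rightarrow> 'v set \<Rightarrow> 'v mdp" where
  "absorb P U = P\<lparr>edges := {(v, w) \<in> edges P. v \<notin> U} \<union> {(v, v) |v. v \<in> U \<inter> verts P},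
     delta := \<lambda>v. if v \<in> U then return_pmf v else delta P v\<rparr>"

lemma absorb_simps [simp]:
  "verts (absorb P U) = verts P" "player1 (absorb P U) = player1 P" "random (absorb P U) = random P"
  by (simp_all add: absorb_def)

lemma edges_absorb: "edges (absorb P U) = {(v, w) \<in> edges P. v \<notin> U} \<union> {(v, v) |v. v \<in> U \<inter> verts P}"
  by (simp add: absorb_def)

lemma is_mdp_absorb:
  assumes "is_mdp P"
  shows "is_mdp (absorb P U)"
proof -
  have "set_pmf (delta (absorb P U) v) = edges (absorb P U) `` {v}" if "v \<in> random P" for v
  proof -
    have "v \<in> verts P" "set_pmf (delta P v) = edges P `` {v}" using assms that unfolding is_mdp_def by auto
    then show ?thesis by (auto simp: absorb_def)
  qed
  moreover have "edges (absorb P U) `` {v} \<noteq> {}" if "v \<in> verts P" for v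
    using assms that unfolding is_mdp_def edges_absorb by (cases "v \<in> U") auto
  moreover have "edges (absorb P U) \<subseteq> verts P \<times> verts P"
    using assms unfolding is_mdp_def edges_absorb by auto
  ultimately show ?thesis
    using assms unfolding is_mdp_def by (simp add: is_mdp_def)
qed

lemma end_component_absorb:
  assumes "X \<inter> U = {}"
  shows "end_component (absorb P U) X \<longleftrightarrow> end_component P X"
proof -
  have "edges (absorb P U) \<inter> X \<times> X = edges P \<inter> X \<times> X"
    using assms unfolding edges_absorb by auto
  moreover have "edges (absorb P U) `` {v} = edges P `` {v}" if "v \<in> X" for v
    using assms that unfolding edges_absorb by auto
  ultimately show ?thesis
    unfolding end_component_def by simp
qed

text \<open>An absorbed vertex reaches only itself, so a strongly connected set that contains one
  contains nothing else.\<close>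

lemma end_component_absorb_disjoint:
  assumes X: "end_component (absorb P U) X" and v: "v \<in> X" "v \<notin> U"
  shows "X \<inter> U = {}"
proof (rule ccontr)
  assume "X \<inter> U \<noteq> {}"
  then obtain u where u: "u \<in> X" "u \<in> U" by blast
  have "(u, v) \<in> (edges (absorb P U) \<inter> X \<times> X)\<^sup>*"
    using X u v unfolding end_component_def by blast
  moreover have "(edges (absorb P U) \<inter> X \<times> X) `` {u} \<subseteq> {u}"
    using u unfolding edges_absorb by auto
  ultimately have "v = u"
    using rtrancl_within[of u v _ "{u}"] by blast
  then show False using u v by simp
qed

section \<open>Reasoning about programs\<close>

fun wregs :: "com \<Rightarrow> nat set" where
  "wregs Skip = {}"
| "wregs (Assign x e) = {x}"
| "wregs (Write a e f) = {}"
| "wregs (Seq c d) = wregs c \<union> wregs d"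
| "wregs (Cond b c d) = wregs c \<union> wregs d"
| "wregs (While b c) = wregs c"

fun warrs :: "com \<Rightarrow> nat set" where
  "warrs Skip = {}"
| "warrs (Assign x e) = {}"
| "warrs (Write a e f) = {a}"
| "warrs (Seq c d) = warrs c \<union> warrs d"
| "warrs (Cond b c d) = warrs c \<union> warrs d"
| "warrs (While b c) = warrs c"

lemma finite_wregs_warrs: "finite (wregs c \<union> warrs c)"
  by (induction c) auto

definition agree :: "nat set \<Rightarrow> nat set \<Rightarrow> state \<Rightarrow> state \<Rightarrow> bool" where
  "agree R A s s' \<longleftrightarrow> (\<forall>x. x \<notin> R \<longrightarrow> reg s' x = reg s x) \<and> (\<forall>a. a \<notin> A \<longrightarrow> arr s' a = arr s a)"

lemma agree_reg: "agree R A s s' \<Longrightarrow> x \<notin> R \<Longrightarrow> reg s' x = reg s x"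
  and agree_arr: "agree R A s s' \<Longrightarrow> a \<notin> A \<Longrightarrow> arr s' a = arr s a"
  by (simp_all add: agree_def)

lemma agree_refl: "agree R A s s"
  by (simp add: agree_def)

lemma agree_trans: "agree R A s s' \<Longrightarrow> agree R A s' s'' \<Longrightarrow> agree R A s s''"
  by (simp add: agree_def)

lemma agree_mono: "agree R A s s' \<Longrightarrow> R \<subseteq> R' \<Longrightarrow> A \<subseteq> A' \<Longrightarrow> agree R' A' s s'"
  by (auto simp: agree_def)

lemma exec_agree: "exec c s t s' \<Longrightarrow> agree (wregs c) (warrs c) s s'"
  by (induction rule: exec.induct) (auto simp: agree_def)

definition terminates :: "com \<Rightarrow> state \<Rightarrow> nat \<Rightarrow> (state \<Rightarrow> bool) \<Rightarrow> bool" where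
  "terminates c s t Q \<longleftrightarrow> (\<exists>t' s'. exec c s t' s' \<and> t' \<le> t \<and> Q s')"

text \<open>The syntactic frame comes for free with every execution. Specifications therefore state
  only what a program changes; what it preserves is recovered here and in the rule for
  sequences.\<close>

lemma terminates_conseq:
  assumes "terminates c s t Q" "t \<le> t'"
    and "\<And>s'. Q s' \<Longrightarrow> agree (wregs c) (warrs c) s s' \<Longrightarrow> Q' s'"
  shows "terminates c s t' Q'"
  using assms exec_agree unfolding terminates_def by (meson order_trans)

lemma terminates_Seq:
  assumes "terminates c s t Q"
    and "\<And>s'. Q s' \<Longrightarrow> agree (wregs c) (warrs c) s s' \<Longrightarrow> terminates d s' t' Q'"
    and "1 + t + t' \<le> t''"
  shows "terminates (Seq c d) s t'' Q'"
proof -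
  obtain t1 s1 where 1: "exec c s t1 s1" "t1 \<le> t" "Q s1"
    using assms(1) unfolding terminates_def by blast
  obtain t2 s2 where 2: "exec d s1 t2 s2" "t2 \<le> t'" "Q' s2"
    using assms(2)[OF 1(3) exec_agree[OF 1(1)]] unfolding terminates_def by blast
  have "exec (Seq c d) s (1 + t1 + t2) s2" using exec.Seq[OF 1(1) 2(1)] .
  then show ?thesis
    using 1(2) 2(2,3) assms(3) unfolding terminates_def
    by (intro exI[of _ "1 + t1 + t2"] exI[of _ s2] conjI) auto
qed

section \<open>Symbolic execution of loop-free programs\<close>

fun loop_free :: "com \<Rightarrow> bool" where
  "loop_free (Seq c d) \<longleftrightarrow> loop_free c \<and> loop_free d"
| "loop_free (Cond b c d) \<longleftrightarrow> loop_free c \<and> loop_free d"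
| "loop_free (While b c) \<longleftrightarrow> False"
| "loop_free _ \<longleftrightarrow> True"

text \<open>A deterministic evaluator that the simplifier can unfold. On loops it returns a dummy
  value; it is used for loop-free programs only.\<close>

fun run :: "com \<Rightarrow> state \<Rightarrow> state" where
  "run (Assign x e) s = s\<lparr>reg := (reg s)(x := aval e s)\<rparr>"
| "run (Write a e f) s = s\<lparr>arr := (arr s)(a := (arr s a)(aval e s := aval f s))\<rparr>"
| "run (Seq c d) s = run d (run c s)"
| "run (Cond b c d) s = (if bval b s then run c s else run d s)"
| "run _ s = s"

text \<open>A conditional is charged for both branches: this is an upper bound without a maximum, so
  costs simplify to numerals, and only constant factors are lost.\<close>

fun cost :: "com \<Rightarrow> nat" where
  "cost Skip = 1"
| "cost (Assign x e) = 1 + acost e"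
| "cost (Write a e f) = 1 + acost e + acost f"
| "cost (Seq c d) = 1 + cost c + cost d"
| "cost (Cond b c d) = 1 + bcost b + (cost c + cost d)"
| "cost (While b c) = 0"

lemma exec_run: "loop_free c \<Longrightarrow> \<exists>t\<le>cost c. exec c s t (run c s)"
proof (induction c arbitrary: s)
  case Skip
  then show ?case using exec.Skip by (intro exI[of _ 1]) auto
next
  case (Assign x e)
  then show ?case using exec.Assign by (intro exI[of _ "1 + acost e"]) auto
next
  case (Write a e f)
  then show ?case using exec.Write by (intro exI[of _ "1 + acost e + acost f"]) auto
next
  case (Seq c d)
  obtain t1 where 1: "t1 \<le> cost c" "exec c s t1 (run c s)" using Seq by fastforce
  obtain t2 where 2: "t2 \<le> cost d" "exec d (run c s) t2 (run d (run c s))" using Seq by fastforce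
  show ?case using 1(1) 2(1) exec.Seq[OF 1(2) 2(2)] by (intro exI[of _ "1 + t1 + t2"]) auto
next
  case (Cond b c d)
  show ?case
  proof (cases "bval b s")
    case True
    obtain t1 where 1: "t1 \<le> cost c" "exec c s t1 (run c s)" using Cond by fastforce
    then show ?thesis using exec.CondTrue[OF True 1(2)] True by (intro exI[of _ "1 + bcost b + t1"]) auto
  next
    case False
    obtain t1 where 1: "t1 \<le> cost d" "exec d s t1 (run d s)" using Cond by fastforce
    then show ?thesis using exec.CondFalse[OF False 1(2)] False by (intro exI[of _ "1 + bcost b + t1"]) auto
  qed
qed simp

lemma terminates_run: "loop_free c \<Longrightarrow> cost c \<le> t \<Longrightarrow> Q (run c s) \<Longrightarrow> terminates c s t Q"
  unfolding terminates_def using exec_run[of c s] by (meson order_trans)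

lemma terminates_Seq_run:
  assumes "loop_free c" "terminates d (run c s) t Q" "1 + cost c + t \<le> t'"
  shows "terminates (Seq c d) s t' Q"
  by (rule terminates_Seq[OF terminates_run[OF assms(1) order_refl, where Q="\<lambda>s'. s' = run c s"]])
    (use assms in auto)

lemma terminates_While_aux:
  assumes "I k s"
    and "\<And>k s. I k s \<Longrightarrow> bval b s \<Longrightarrow> \<exists>k'<k. terminates c s t (I k')"
  shows "terminates (While b c) s (k * (1 + bcost b + t) + 1 + bcost b) (\<lambda>s'. \<not> bval b s' \<and> (\<exists>k. I k s'))"
  using assms(1)
proof (induction k arbitrary: s rule: less_induct)
  case (less k)
  show ?case
  proof (cases "bval b s")
    case False
    then show ?thesis
      using exec.WhileFalse[OF False, of c] less.prems unfolding terminates_def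
      by (intro exI[of _ "1 + bcost b"] exI[of _ s]) auto
  next
    case True
    obtain k' where k': "k' < k" "terminates c s t (I k')"
      using assms(2)[OF less.prems True] by blast
    obtain t1 s1 where 1: "exec c s t1 s1" "t1 \<le> t" "I k' s1"
      using k'(2) unfolding terminates_def by blast
    obtain t2 s2 where 2: "exec (While b c) s1 t2 s2" "t2 \<le> k' * (1 + bcost b + t) + 1 + bcost b"
      "\<not> bval b s2 \<and> (\<exists>k. I k s2)"
      using less.IH[OF k'(1) 1(3)] unfolding terminates_def by blast
    have "Suc k' * (1 + bcost b + t) \<le> k * (1 + bcost b + t)"
      using k'(1) by (intro mult_right_mono) auto
    then have "1 + bcost b + t1 + t2 \<le> k * (1 + bcost b + t) + 1 + bcost b"
      using 1(2) 2(2) by simp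
    then show ?thesis
      using exec.WhileTrue[OF True 1(1) 2(1)] 2(3) unfolding terminates_def by blast
  qed
qed

text \<open>The frame relative to the state before the loop becomes part of the invariant.\<close>

lemma terminates_While:
  assumes "I k s"
    and "\<And>k s'. I k s' \<Longrightarrow> agree (wregs c) (warrs c) s s' \<Longrightarrow> bval b s' \<Longrightarrow> \<exists>k'<k. terminates c s' t (I k')"
  shows "terminates (While b c) s (k * (1 + bcost b + t) + 1 + bcost b) (\<lambda>s'. \<not> bval b s' \<and> (\<exists>k. I k s'))"
proof (rule terminates_conseq[OF terminates_While_aux[where
      I="\<lambda>k s'. I k s' \<and> agree (wregs c) (warrs c) s s'" and k=k]])
  fix k s' assume I: "I k s' \<and> agree (wregs c) (warrs c) s s'" and b: "bval b s'"
  then obtain k' where k': "k' < k" "terminates c s' t (I k')" using assms(2) by blast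
  show "\<exists>k'<k. terminates c s' t (\<lambda>s'. I k' s' \<and> agree (wregs c) (warrs c) s s')"
    by (intro exI[of _ k'] conjI k'(1) terminates_conseq[OF k'(2)]) (use I agree_trans in auto)
qed (use assms(1) agree_refl in auto)

section \<open>Counting loops\<close>

definition For :: "nat \<Rightarrow> aexp \<Rightarrow> nat \<Rightarrow> com \<Rightarrow> com" where
  "For x lo y c = Seq (Assign x lo)
     (While (Less (Reg x) (Reg y)) (Seq c (Assign x (Plus (Reg x) (Const 1)))))"

lemma wregs_For [simp]: "wregs (For x lo y c) = insert x (wregs c)"
  and warrs_For [simp]: "warrs (For x lo y c) = warrs c"
  by (auto simp: For_def)

text \<open>Of the 9 units per iteration, 4 pay for the test, 4 for the increment and 1 for the
  sequencing. The 6 consists of the failing last test (4), the initial assignment and the outer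
  sequencing. The body establishes \<open>I (Suc i)\<close> for the state in which the counter has
  already advanced, because \<open>I\<close> describes states at the loop head.\<close>

lemma terminates_For:
  assumes lo: "aval lo s = a" and "a \<le> b" and hi: "reg s y = b"
    and y: "y \<notin> wregs c" "y \<noteq> x"
    and base: "I a (s\<lparr>reg := (reg s)(x := a)\<rparr>)"
    and step: "\<And>i s'. I i s' \<Longrightarrow> agree (insert x (wregs c)) (warrs c) s s' \<Longrightarrow> reg s' x = i \<Longrightarrow>
      a \<le> i \<Longrightarrow> i < b \<Longrightarrow>
      terminates c s' t (\<lambda>s''. reg s'' x = i \<and> I (Suc i) (s''\<lparr>reg := (reg s'')(x := Suc i)\<rparr>))"
    and bound: "acost lo + 6 + (b - a) * (t + 9) \<le> t'"
  shows "terminates (For x lo y c) s t' (I b)"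
proof -
  let ?R = "insert x (wregs c)" and ?A = "warrs c"
  let ?c = "Seq c (Assign x (Plus (Reg x) (Const 1)))"
  let ?s = "s\<lparr>reg := (reg s)(x := a)\<rparr>"
  let ?J = "\<lambda>k s'. a \<le> reg s' x \<and> reg s' x \<le> b \<and> k = b - reg s' x \<and> I (reg s' x) s'"
  have "terminates (While (Less (Reg x) (Reg y)) ?c) ?s
      ((b - a) * (1 + bcost (Less (Reg x) (Reg y)) + (t + 5)) + 1 + bcost (Less (Reg x) (Reg y)))
      (\<lambda>s'. \<not> bval (Less (Reg x) (Reg y)) s' \<and> (\<exists>k. ?J k s'))"
  proof (rule terminates_While)
    show "?J (b - a) ?s" using \<open>a \<le> b\<close> base by simp
    fix k s' assume J: "?J k s'" and ag: "agree (wregs ?c) (warrs ?c) ?s s'"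
      and bv: "bval (Less (Reg x) (Reg y)) s'"
    have ag': "agree ?R ?A s s'"
      using ag by (auto simp: agree_def)
    have "reg s' y = b" using hi y agree_reg[OF ag'] by simp
    then have less: "reg s' x < b" using bv by simp
    have "terminates ?c s' (t + 5) (?J (k - 1))"
    proof (rule terminates_Seq)
      show "terminates c s' t (\<lambda>s''. reg s'' x = reg s' x \<and> I (Suc (reg s' x)) (s''\<lparr>reg := (reg s'')(x := Suc (reg s' x))\<rparr>))"
        using J less by (intro step ag') auto
      fix s'' assume "reg s'' x = reg s' x \<and> I (Suc (reg s' x)) (s''\<lparr>reg := (reg s'')(x := Suc (reg s' x))\<rparr>)"
      then show "terminates (Assign x (Plus (Reg x) (Const 1))) s'' 4 (?J (k - 1))"
        using J less by (intro terminates_run) auto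
    qed simp
    moreover have "k - 1 < k" using J less by auto
    ultimately show "\<exists>k'<k. terminates ?c s' (t + 5) (?J k')" by blast
  qed
  then have w: "terminates (While (Less (Reg x) (Reg y)) ?c) ?s (4 + (b - a) * (t + 9)) (I b)"
  proof (rule terminates_conseq)
    fix s' assume fin: "\<not> bval (Less (Reg x) (Reg y)) s' \<and> (\<exists>k. ?J k s')" and ag: "agree (wregs (While (Less (Reg x) (Reg y)) ?c)) (warrs (While (Less (Reg x) (Reg y)) ?c)) ?s s'"
    have "reg s' y = b" using hi y agree_reg[OF ag, of y] by simp
    then show "I b s'" using fin by auto
  qed (simp add: algebra_simps)
  show ?thesis
    unfolding For_def
    by (rule terminates_Seq_run[OF _ _ ]) (use w lo bound in auto)
qed

lemma terminates_For_run:
  assumes "aval lo s = a" and "a \<le> b" and "reg s y = b"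
    and "y \<notin> wregs c" "y \<noteq> x" and c: "loop_free c" "x \<notin> wregs c"
    and "I a (s\<lparr>reg := (reg s)(x := a)\<rparr>)"
    and step: "\<And>i s'. I i s' \<Longrightarrow> agree (insert x (wregs c)) (warrs c) s s' \<Longrightarrow> reg s' x = i \<Longrightarrow>
      a \<le> i \<Longrightarrow> i < b \<Longrightarrow> I (Suc i) ((run c s')\<lparr>reg := (reg (run c s'))(x := Suc i)\<rparr>)"
    and "acost lo + 6 + (b - a) * (cost c + 9) \<le> t'"
  shows "terminates (For x lo y c) s t' (I b)"
proof (rule terminates_For[where t="cost c"])
  fix i s' assume *: "I i s'" "agree (insert x (wregs c)) (warrs c) s s'" "reg s' x = i" "a \<le> i" "i < b"
  have "terminates c s' (cost c) (\<lambda>s''. s'' = run c s')"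
    using c by (intro terminates_run) auto
  then show "terminates c s' (cost c) (\<lambda>s''. reg s'' x = i \<and> I (Suc i) (s''\<lparr>reg := (reg s'')(x := Suc i)\<rparr>))"
    by (rule terminates_conseq) (use c(2) * step[OF *] in \<open>auto simp: agree_reg\<close>)
qed (use assms in auto)

section \<open>Computing threshold attractors\<close>

text \<open>Linked lists of edges: the address of edge \<open>e\<close> is \<open>e + 1\<close>, and 0 is the null pointer.\<close>

fun linked :: "(nat \<Rightarrow> nat) \<Rightarrow> nat \<Rightarrow> nat list \<Rightarrow> bool" where
  "linked nx p [] \<longleftrightarrow> p = 0"
| "linked nx p (e # es) \<longleftrightarrow> p = Suc e \<and> linked nx (nx e) es"

lemma linked_upd: "i \<notin> set es \<Longrightarrow> linked (nx(i := v)) p es = linked nx p es"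
  by (induction es arbitrary: p) auto

definition stores_edge_set :: "(nat \<Rightarrow> nat) \<Rightarrow> nat \<Rightarrow> nat set \<Rightarrow> bool" where
  "stores_edge_set nx p X \<longleftrightarrow> (\<exists>es. linked nx p es \<and> distinct es \<and> set es = X)"

text \<open>The worklist algorithm: \<open>X\<close> is the set of nodes taken from the stack \<open>T\<close> so far, \<open>es\<close> the
  list of edges into \<open>X\<close> still to be processed, starting at address \<open>p\<close>, and \<open>k\<close> bounds the
  number of remaining steps.\<close>

definition worklist_inv ::
  "nat \<Rightarrow> nat \<Rightarrow> (nat \<Rightarrow> nat) \<Rightarrow> (nat \<Rightarrow> nat) \<Rightarrow> (nat \<Rightarrow> nat) \<Rightarrow> (nat \<Rightarrow> nat) \<Rightarrow>
   nat \<Rightarrow> nat list \<Rightarrow> (nat \<Rightarrow> nat) \<Rightarrow> nat \<Rightarrow> bool" where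
  "worklist_inv N m src dst c nx k T cnt p \<longleftrightarrow>
     (\<exists>X es. distinct T \<and> set T \<inter> X = {} \<and> set T \<union> X = {x. x < N \<and> cnt x = 0} \<and>
        linked nx p es \<and> distinct es \<and> set es \<subseteq> {e. e < m \<and> dst e \<in> X} \<and>
        (\<forall>x<N. cnt x = c x - card {e. e < m \<and> src e = x \<and> dst e \<in> X \<and> e \<notin> set es}) \<and>
        (\<forall>Q. (\<forall>x<N. c x \<le> card {e. e < m \<and> src e = x \<and> Q (dst e)} \<longrightarrow> Q x) \<longrightarrow>
          (\<forall>x<N. cnt x = 0 \<longrightarrow> Q x)) \<and>
        k = card ({..<N} - X) + card {e. e < m \<and> dst e \<notin> X} + length es)"

text \<open>The initial measure \<open>N + m\<close> allows for one step per node and one per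
  edge.\<close>

lemma worklist_init:
  assumes "distinct T" "set T = {x. x < N \<and> c x = 0}"
  shows "worklist_inv N m src dst c nx (N + m) T c 0"
  unfolding worklist_inv_def using assms by (intro exI[of _ "{}"] exI[of _ "[]"]) auto

text \<open>Moving \<open>x\<close> into \<open>X\<close> lowers the first summand of the measure by
  one. The edges into \<open>x\<close> only migrate from the second summand to the list, so the
  counters need no adjustment.\<close>

lemma worklist_pop:
  assumes inv: "worklist_inv N m src dst c nx k (T @ [x]) cnt 0"
    and lst: "\<forall>x<N. stores_edge_set nx (head x) {e. e < m \<and> dst e = x}"
  shows "\<exists>k'<k. worklist_inv N m src dst c nx k' T cnt (head x)"
proof -
  obtain X es where T: "distinct (T @ [x])" "set (T @ [x]) \<inter> X = {}"
      "set (T @ [x]) \<union> X = {x. x < N \<and> cnt x = 0}"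
    and es: "linked nx 0 es"
    and cnt: "\<forall>x<N. cnt x = c x - card {e. e < m \<and> src e = x \<and> dst e \<in> X \<and> e \<notin> set es}"
    and Q: "\<forall>Q. (\<forall>x<N. c x \<le> card {e. e < m \<and> src e = x \<and> Q (dst e)} \<longrightarrow> Q x) \<longrightarrow>
          (\<forall>x<N. cnt x = 0 \<longrightarrow> Q x)"
    and k: "k = card ({..<N} - X) + card {e. e < m \<and> dst e \<notin> X} + length es"
    using inv unfolding worklist_inv_def by blast
  have es0: "es = []" using es by (cases es) auto
  have x: "x < N" "x \<notin> X" using T(2,3) by auto
  obtain fs where fs: "linked nx (head x) fs" "distinct fs" "set fs = {e. e < m \<and> dst e = x}"
    using lst x(1) unfolding stores_edge_set_def by blast
  have "{e. e < m \<and> dst e \<notin> X} = {e. e < m \<and> dst e \<notin> insert x X} \<union> set fs"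
    using x(2) fs(3) by auto
  moreover have "{e. e < m \<and> dst e \<notin> insert x X} \<inter> set fs = {}"
    using fs(3) by auto
  ultimately have c1: "card {e. e < m \<and> dst e \<notin> X} = card {e. e < m \<and> dst e \<notin> insert x X} + length fs"
    using fs(2) by (simp add: card_Un_disjoint distinct_card)
  have "{..<N} - X = insert x ({..<N} - insert x X)" using x by auto
  then have c2: "card ({..<N} - X) = Suc (card ({..<N} - insert x X))"
    by (metis (no_types, lifting) DiffE card_insert_disjoint finite_Diff finite_lessThan insertI1)
  have c3: "{e. e < m \<and> src e = y \<and> dst e \<in> insert x X \<and> e \<notin> set fs} =
      {e. e < m \<and> src e = y \<and> dst e \<in> X \<and> e \<notin> set es}" for y
    using x(2) fs(3) es0 by auto
  have "worklist_inv N m src dst c nx (k - 1) T cnt (head x)"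
    unfolding worklist_inv_def
  proof (intro exI[of _ "insert x X"] exI[of _ fs] conjI)
    show "\<forall>y<N. cnt y = c y - card {e. e < m \<and> src e = y \<and> dst e \<in> insert x X \<and> e \<notin> set fs}"
      unfolding c3 by (rule cnt)
    show "k - 1 = card ({..<N} - insert x X) + card {e. e < m \<and> dst e \<notin> insert x X} + length fs"
      using k c1 c2 es0 by simp
  qed (use T x fs Q in auto)
  moreover have "k - 1 < k" using k c2 by simp
  ultimately show ?thesis by blast
qed

text \<open>Only the counter of the source \<open>y\<close> is affected. Truncated subtraction keeps
  a counter at 0, and the test for 1 before the decrement pushes \<open>y\<close> exactly when its
  counter becomes 0, hence at most once.\<close>

lemma worklist_edge:
  assumes inv: "worklist_inv N m src dst c nx k T cnt p" and p: "p > 0"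
    and src: "\<forall>e<m. src e < N"
  defines "y \<equiv> src (p - 1)"
  shows "\<exists>k'<k. worklist_inv N m src dst c nx k' (if cnt y = 1 then T @ [y] else T)
    (cnt(y := cnt y - 1)) (nx (p - 1))"
proof -
  obtain X es where T: "distinct T" "set T \<inter> X = {}" "set T \<union> X = {x. x < N \<and> cnt x = 0}"
    and es: "linked nx p es" "distinct es" "set es \<subseteq> {e. e < m \<and> dst e \<in> X}"
    and cnt: "\<forall>x<N. cnt x = c x - card {e. e < m \<and> src e = x \<and> dst e \<in> X \<and> e \<notin> set es}"
    and Q: "\<forall>Q. (\<forall>x<N. c x \<le> card {e. e < m \<and> src e = x \<and> Q (dst e)} \<longrightarrow> Q x) \<longrightarrow>
          (\<forall>x<N. cnt x = 0 \<longrightarrow> Q x)"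
    and k: "k = card ({..<N} - X) + card {e. e < m \<and> dst e \<notin> X} + length es"
    using inv unfolding worklist_inv_def by blast
  obtain e fs where es_eq: "es = e # fs" and e: "p = Suc e" "linked nx (nx e) fs"
    using es(1) p by (cases es) auto
  have y: "y = src e" using e(1) by (simp add: y_def)
  have em: "e < m" "dst e \<in> X" "e \<notin> set fs" and yN: "y < N"
    using es(2,3) es_eq src y by auto
  let ?cnt = "cnt(y := cnt y - 1)"
  let ?F = "\<lambda>x es. {e. e < m \<and> src e = x \<and> dst e \<in> X \<and> e \<notin> set es}"
  have Fy: "card (?F y fs) = Suc (card (?F y es))"
  proof -
    have "?F y fs = insert e (?F y es)" using em y es_eq by auto
    then show ?thesis by (simp add: es_eq)
  qed
  have Fx: "?F x fs = ?F x es" if "x \<noteq> y" for x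
    using that y es_eq by auto
  have cnt': "\<forall>x<N. ?cnt x = c x - card (?F x fs)"
  proof (intro allI impI)
    fix x assume "x < N"
    then show "?cnt x = c x - card (?F x fs)"
      using cnt Fy Fx[of x] by (cases "x = y") auto
  qed
  have Xsub: "X \<subseteq> {x. x < N \<and> cnt x = 0}" using T(3) by blast
  have Q'': "\<forall>x<N. ?cnt x = 0 \<longrightarrow> Q' x"
    if cl: "\<forall>x<N. c x \<le> card {e. e < m \<and> src e = x \<and> Q' (dst e)} \<longrightarrow> Q' x" for Q'
  proof (intro allI impI)
    fix x assume x: "x < N" "?cnt x = 0"
    have Q': "\<forall>x<N. cnt x = 0 \<longrightarrow> Q' x" using Q cl by blast
    \<comment> \<open>A zero counter means that the threshold is met by processed edges into
      \<open>X\<close>, and the members of \<open>X\<close> already have the property.\<close>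
    have "c x \<le> card (?F x fs)" using cnt'[rule_format, OF x(1)] x(2) by simp
    also have "\<dots> \<le> card {e. e < m \<and> src e = x \<and> Q' (dst e)}"
      using Xsub Q' by (intro card_mono) auto
    finally show "Q' x" using cl x(1) by blast
  qed
  have T': "distinct (if cnt y = 1 then T @ [y] else T)"
    "set (if cnt y = 1 then T @ [y] else T) \<inter> X = {}"
    "set (if cnt y = 1 then T @ [y] else T) \<union> X = {x. x < N \<and> ?cnt x = 0}"
  proof -
    have "y \<notin> set T \<union> X" if "cnt y = 1" using T(3) that by auto
    then show "distinct (if cnt y = 1 then T @ [y] else T)"
      "set (if cnt y = 1 then T @ [y] else T) \<inter> X = {}" using T(1,2) by simp_all
    have "{x. x < N \<and> ?cnt x = 0} = {x. x < N \<and> cnt x = 0} \<union> (if cnt y = 1 then {y} else {})"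
    proof (rule set_eqI)
      fix x
      have "?cnt x = 0 \<longleftrightarrow> cnt x = 0 \<or> x = y \<and> cnt y = 1"
        unfolding fun_upd_apply by arith
      then show "x \<in> {x. x < N \<and> ?cnt x = 0} \<longleftrightarrow>
          x \<in> {x. x < N \<and> cnt x = 0} \<union> (if cnt y = 1 then {y} else {})"
        using yN by (simp del: fun_upd_apply) blast
    qed
    then show "set (if cnt y = 1 then T @ [y] else T) \<union> X = {x. x < N \<and> ?cnt x = 0}"
      unfolding T(3)[symmetric] by (simp add: Un_ac del: fun_upd_apply)
  qed
  have "worklist_inv N m src dst c nx (k - 1) (if cnt y = 1 then T @ [y] else T) ?cnt (nx e)"
    unfolding worklist_inv_def
  proof (intro exI[of _ X] exI[of _ fs] conjI)
    show "\<forall>Q. (\<forall>x<N. c x \<le> card {e. e < m \<and> src e = x \<and> Q (dst e)} \<longrightarrow> Q x) \<longrightarrow>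
        (\<forall>x<N. ?cnt x = 0 \<longrightarrow> Q x)"
    proof (rule allI, rule impI)
      fix Q assume "\<forall>x<N. c x \<le> card {e. e < m \<and> src e = x \<and> Q (dst e)} \<longrightarrow> Q x"
      then show "\<forall>x<N. ?cnt x = 0 \<longrightarrow> Q x" by (rule Q'')
    qed
    show "k - 1 = card ({..<N} - X) + card {e. e < m \<and> dst e \<notin> X} + length fs"
      using k es_eq by simp
  qed (use T' cnt' e(2) es(2,3) es_eq in \<open>simp_all del: fun_upd_apply\<close>)
  moreover have "k - 1 < k" using k es_eq by simp
  moreover have "nx (p - 1) = nx e" using e(1) by simp
  ultimately show ?thesis by metis
qed

lemma worklist_final:
  assumes "worklist_inv N m src dst c nx k [] cnt 0"
  shows "threshold_attractor N m src dst c {x. x < N \<and> cnt x = 0}"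
proof -
  obtain X es where X: "X = {x. x < N \<and> cnt x = 0}"
    and es: "linked nx 0 es"
    and cnt: "\<forall>x<N. cnt x = c x - card {e. e < m \<and> src e = x \<and> dst e \<in> X \<and> e \<notin> set es}"
    and Q: "\<forall>Q. (\<forall>x<N. c x \<le> card {e. e < m \<and> src e = x \<and> Q (dst e)} \<longrightarrow> Q x) \<longrightarrow>
          (\<forall>x<N. cnt x = 0 \<longrightarrow> Q x)"
    using assms unfolding worklist_inv_def by auto
  have "es = []" using es by (cases es) auto
  then have "x \<in> X" if "x < N" "c x \<le> card {e. e < m \<and> src e = x \<and> dst e \<in> X}" for x
    using cnt that X by auto
  then show ?thesis
    unfolding threshold_attractor_def X[symmetric] using Q X by blast
qed

text \<open>Input and output use indices below 8, and \<open>D\<close> will bound the indices written by the MEC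
  program, so indices from \<open>D + 8\<close> on are safe. The registers \<open>rn\<close>, \<open>rk\<close>, \<open>rm\<close> hold the numbers of
  vertices, pairs and edges, \<open>ri\<close> the current pair, and \<open>rN\<close> the number of nodes of the graph whose
  attractor is computed. The arrays \<open>aST\<close>, \<open>aDT\<close>, \<open>aOW\<close> are copies of the arrays 0, 1, 2, and
  \<open>aLS\<close>, \<open>aLD\<close>, \<open>aUS\<close>, \<open>aUD\<close> of 3 to 6; \<open>aSR\<close> holds the sources of the edges, \<open>aLAB\<close> the MEC
  labels, \<open>aMK\<close> the marked vertices, \<open>aRES\<close> the result, \<open>aGRP\<close> the nodes to which the vertices are
  contracted, \<open>aGS\<close> and \<open>aGD\<close> the end nodes of the contracted edges, \<open>aCNT\<close> the remaining thresholds,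
  \<open>aHD\<close> and \<open>aNX\<close> the linked lists of edges, \<open>aSTK\<close> the stack, and \<open>aUM\<close> the characteristic function
  of the current \<open>U\<close>.\<close>

locale workspace =
  fixes D :: nat
begin

abbreviation (input) "rn \<equiv> D + 8"
abbreviation (input) "rk \<equiv> D + 9"
abbreviation (input) "rm \<equiv> D + 10"
abbreviation (input) "ri \<equiv> D + 11"
abbreviation (input) "rj \<equiv> D + 12"
abbreviation (input) "rx \<equiv> D + 13"
abbreviation (input) "ry \<equiv> D + 14"
abbreviation (input) "re \<equiv> D + 15"
abbreviation (input) "rsp \<equiv> D + 16"
abbreviation (input) "rN \<equiv> D + 17"

abbreviation (input) "aST \<equiv> D + 8"
abbreviation (input) "aDT \<equiv> D + 9"
abbreviation (input) "aOW \<equiv> D + 10"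
abbreviation (input) "aSR \<equiv> D + 11"
abbreviation (input) "aLS \<equiv> D + 12"
abbreviation (input) "aLD \<equiv> D + 13"
abbreviation (input) "aUS \<equiv> D + 14"
abbreviation (input) "aUD \<equiv> D + 15"
abbreviation (input) "aLAB \<equiv> D + 16"
abbreviation (input) "aMK \<equiv> D + 17"
abbreviation (input) "aRES \<equiv> D + 18"
abbreviation (input) "aGRP \<equiv> D + 19"
abbreviation (input) "aGS \<equiv> D + 20"
abbreviation (input) "aGD \<equiv> D + 21"
abbreviation (input) "aCNT \<equiv> D + 22"
abbreviation (input) "aHD \<equiv> D + 23"
abbreviation (input) "aNX \<equiv> D + 24"
abbreviation (input) "aSTK \<equiv> D + 25"
abbreviation (input) "aUM \<equiv> D + 26"

section \<open>Clearing and copying arrays\<close>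

definition fill :: "nat \<Rightarrow> nat \<Rightarrow> com" where
  "fill a y = For rj (Const 0) y (Write a (Reg rj) (Const 0))"

lemma fill_frame [simp]: "wregs (fill a y) = {rj}" "warrs (fill a y) = {a}"
  by (auto simp: fill_def)

lemma terminates_fill:
  assumes "y \<noteq> rj"
  shows "terminates (fill a y) s (7 + 12 * reg s y) (\<lambda>s'. \<forall>j<reg s y. arr s' a j = 0)"
  unfolding fill_def
  by (rule terminates_For_run[where a=0 and b="reg s y" and I="\<lambda>i s'. \<forall>j<i. arr s' a j = 0"])
    (simp_all add: assms less_Suc_eq)

definition copy :: "nat \<Rightarrow> nat \<Rightarrow> nat \<Rightarrow> com" where
  "copy a b y = For rj (Const 0) y (Write b (Reg rj) (Read a (Reg rj)))"

lemma copy_frame [simp]: "wregs (copy a b y) = {rj}" "warrs (copy a b y) = {b}"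
  by (auto simp: copy_def)

lemma terminates_copy:
  assumes "y \<noteq> rj" "a \<noteq> b"
  shows "terminates (copy a b y) s (7 + 13 * reg s y) (\<lambda>s'. \<forall>j<reg s y. arr s' b j = arr s a j)"
  unfolding copy_def
  by (rule terminates_For_run[where a=0 and b="reg s y" and I="\<lambda>i s'. \<forall>j<i. arr s' b j = arr s a j"])
    (simp_all add: assms less_Suc_eq agree_arr)

text \<open>The lists collect the edges by their end node, since attractors propagate backwards
  along edges. Only the heads need clearing: the cell of an edge in \<open>aNX\<close> is written
  when the edge is inserted.\<close>

definition link_edges :: com where
  "link_edges = Seq (fill aHD rN) (For rj (Const 0) rm
     (Seq (Write aNX (Reg rj) (Read aHD (Read aGD (Reg rj))))
       (Write aHD (Read aGD (Reg rj)) (Plus (Reg rj) (Const 1)))))"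

lemma link_edges_frame [simp]: "wregs link_edges = {rj}" "warrs link_edges = {aHD, aNX}"
  by (auto simp: link_edges_def)

lemma terminates_link_edges:
  assumes "\<forall>e<reg s rm. arr s aGD e < reg s rN"
  shows "terminates link_edges s (15 + 12 * reg s rN + 22 * reg s rm) (\<lambda>s'. \<forall>x<reg s rN.
    stores_edge_set (arr s' aNX) (arr s' aHD x) {e. e < reg s rm \<and> arr s aGD e = x})"
  unfolding link_edges_def
proof (rule terminates_Seq[OF terminates_fill])
  fix s1 assume hd0: "\<forall>j<reg s rN. arr s1 aHD j = 0"
    and "agree (wregs (fill aHD rN)) (warrs (fill aHD rN)) s s1"
  then have ag: "agree {rj} {aHD} s s1" by simp
  let ?I = "\<lambda>i s'. \<forall>x<reg s rN.
    stores_edge_set (arr s' aNX) (arr s' aHD x) {e. e < i \<and> arr s aGD e = x}"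
  show "terminates (For rj (Const 0) rm
     (Seq (Write aNX (Reg rj) (Read aHD (Read aGD (Reg rj))))
       (Write aHD (Read aGD (Reg rj)) (Plus (Reg rj) (Const 1))))) s1 (7 + 22 * reg s rm) (?I (reg s rm))"
  proof (rule terminates_For_run[where a=0 and b="reg s rm" and I="?I"])
    show "?I 0 (s1\<lparr>reg := (reg s1)(rj := 0)\<rparr>)"
      using hd0 by (auto simp: stores_edge_set_def intro!: exI[of _ "[]"])
    show "reg s1 rm = reg s rm" using ag by (simp add: agree_reg)
  next
    fix i s2
    let ?c = "Seq (Write aNX (Reg rj) (Read aHD (Read aGD (Reg rj))))
       (Write aHD (Read aGD (Reg rj)) (Plus (Reg rj) (Const 1)))"
    assume I: "?I i s2" and ag2: "agree (insert rj (wregs ?c)) (warrs ?c) s1 s2"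
      and i: "reg s2 rj = i" "i < reg s rm"
    have GD: "arr s2 aGD = arr s aGD" using ag ag2 by (simp add: agree_arr)
    show "?I (Suc i) ((run ?c s2)\<lparr>reg := (reg (run ?c s2))(rj := Suc i)\<rparr>)"
    proof (intro allI impI)
      fix x assume x: "x < reg s rN"
      then obtain es where es: "linked (arr s2 aNX) (arr s2 aHD x) es" "distinct es"
          "set es = {e. e < i \<and> arr s aGD e = x}"
        using I unfolding stores_edge_set_def by blast
      have ni: "i \<notin> set es" using es(3) by simp
      have "{e. e < Suc i \<and> arr s aGD e = x} = (if arr s aGD i = x then insert i (set es) else set es)"
        using es(3) by (auto simp: less_Suc_eq)
      then show "stores_edge_set (arr ((run ?c s2)\<lparr>reg := (reg (run ?c s2))(rj := Suc i)\<rparr>) aNX)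
          (arr ((run ?c s2)\<lparr>reg := (reg (run ?c s2))(rj := Suc i)\<rparr>) aHD x) {e. e < Suc i \<and> arr s aGD e = x}"
        unfolding stores_edge_set_def using es ni i(1)
        by (intro exI[of _ "if arr s aGD i = x then i # es else es"]) (auto simp: GD linked_upd)
    qed
  qed auto
qed auto

text \<open>The usual nested loops over nodes and their edges are merged into one, so that a single
  measure bounds the number of iterations by \<open>N + m\<close>. The register \<open>re\<close> is
  the address of the current edge, with 0 when a node has to be popped; the sum in the test is
  positive iff work of either kind is left.\<close>

definition worklist_loop :: com where
  "worklist_loop = While (Less (Const 0) (Plus (Reg re) (Reg rsp)))
     (Cond (Eq (Reg re) (Const 0))
       (Seq (Assign rsp (Minus (Reg rsp) (Const 1))) (Assign re (Read aHD (Read aSTK (Reg rsp)))))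
       (Seq (Assign ry (Read aGS (Minus (Reg re) (Const 1))))
       (Seq (Assign re (Read aNX (Minus (Reg re) (Const 1))))
       (Seq (Cond (Eq (Read aCNT (Reg ry)) (Const 1))
              (Seq (Write aSTK (Reg rsp) (Reg ry)) (Assign rsp (Plus (Reg rsp) (Const 1)))) Skip)
            (Write aCNT (Reg ry) (Minus (Read aCNT (Reg ry)) (Const 1)))))))"

lemma worklist_loop_frame [simp]: "wregs worklist_loop = {re, ry, rsp}" "warrs worklist_loop = {aCNT, aSTK}"
  by (auto simp: worklist_loop_def)

lemma terminates_worklist_loop:
  assumes init: "worklist_inv N m (arr s aGS) (arr s aGD) c (arr s aNX) (N + m)
      (map (arr s aSTK) [0..<reg s rsp]) (arr s aCNT) (reg s re)"
    and src: "\<forall>e<m. arr s aGS e < N"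
    and lst: "\<forall>x<N. stores_edge_set (arr s aNX) (arr s aHD x) {e. e < m \<and> arr s aGD e = x}"
  shows "terminates worklist_loop s (6 + 60 * (N + m))
    (\<lambda>s'. threshold_attractor N m (arr s aGS) (arr s aGD) c {x. x < N \<and> arr s' aCNT x = 0})"
proof -
  let ?b = "Less (Const 0) (Plus (Reg re) (Reg rsp))"
  obtain body where body: "worklist_loop = While ?b body" "loop_free body" "cost body \<le> 50"
    "body = (Cond (Eq (Reg re) (Const 0))
       (Seq (Assign rsp (Minus (Reg rsp) (Const 1))) (Assign re (Read aHD (Read aSTK (Reg rsp)))))
       (Seq (Assign ry (Read aGS (Minus (Reg re) (Const 1))))
       (Seq (Assign re (Read aNX (Minus (Reg re) (Const 1))))
       (Seq (Cond (Eq (Read aCNT (Reg ry)) (Const 1))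
              (Seq (Write aSTK (Reg rsp) (Reg ry)) (Assign rsp (Plus (Reg rsp) (Const 1)))) Skip)
            (Write aCNT (Reg ry) (Minus (Read aCNT (Reg ry)) (Const 1)))))))"
    unfolding worklist_loop_def by simp
  let ?I = "\<lambda>k s'. worklist_inv N m (arr s aGS) (arr s aGD) c (arr s aNX) k
      (map (arr s' aSTK) [0..<reg s' rsp]) (arr s' aCNT) (reg s' re)"
  have "terminates (While ?b body) s ((N + m) * (1 + bcost ?b + 50) + 1 + bcost ?b)
    (\<lambda>s'. \<not> bval ?b s' \<and> (\<exists>k. ?I k s'))"
  proof (rule terminates_While)
    show "?I (N + m) s" by (rule init)
    fix k s' assume I: "?I k s'" and ag: "agree (wregs body) (warrs body) s s'" and b: "bval ?b s'"
    have same: "arr s' aHD = arr s aHD" "arr s' aGS = arr s aGS" "arr s' aNX = arr s aNX"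
      using ag by (auto simp: body(4) agree_arr)
    have "\<exists>k'<k. ?I k' (run body s')"
    proof (cases "reg s' re = 0")
      case True
      then obtain q where q: "reg s' rsp = Suc q" using b by (cases "reg s' rsp") auto
      have "worklist_inv N m (arr s aGS) (arr s aGD) c (arr s aNX) k
          (map (arr s' aSTK) [0..<q] @ [arr s' aSTK q]) (arr s' aCNT) 0"
        using I True q by simp
      from worklist_pop[OF this lst]
      show ?thesis
        using True q by (simp add: body(4) same)
    next
      case False
      let ?y = "arr s aGS (reg s' re - 1)"
      obtain k' where "k' < k" and k': "worklist_inv N m (arr s aGS) (arr s aGD) c (arr s aNX) k'
        (if arr s' aCNT ?y = 1 then map (arr s' aSTK) [0..<reg s' rsp] @ [?y] else map (arr s' aSTK) [0..<reg s' rsp])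
        ((arr s' aCNT)(?y := arr s' aCNT ?y - 1)) (arr s aNX (reg s' re - 1))"
        using worklist_edge[OF I _ src] False by auto
      moreover have "?I k' (run body s')"
      proof (cases "arr s' aCNT ?y = 1")
        case True
        then show ?thesis
          using k' False by (simp add: body(4) same)
      next
        case False2: False
        then show ?thesis
          using k' False by (simp add: body(4) same)
      qed
      ultimately show ?thesis by blast
    qed
    then obtain k' where "k' < k" "?I k' (run body s')" by blast
    then show "\<exists>k'<k. terminates body s' 50 (?I k')"
      by (intro exI[of _ k'] conjI terminates_run[OF body(2,3)])
  qed
  then show ?thesis
    unfolding body(1)
  proof (rule terminates_conseq)
    show "(N + m) * (1 + bcost ?b + 50) + 1 + bcost ?b \<le> 6 + 60 * (N + m)" by simp
    fix s' assume fin: "\<not> bval ?b s' \<and> (\<exists>k. ?I k s')"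
    then have "reg s' re = 0" "reg s' rsp = 0" by simp_all
    moreover obtain k where "?I k s'" using fin by blast
    ultimately have "worklist_inv N m (arr s aGS) (arr s aGD) c (arr s aNX) k [] (arr s' aCNT) 0"
      by simp
    then show "threshold_attractor N m (arr s aGS) (arr s aGD) c {x. x < N \<and> arr s' aCNT x = 0}"
      by (rule worklist_final)
  qed
qed

definition attractor :: com where
  "attractor = Seq link_edges (Seq (Assign rsp (Const 0))
     (Seq (For rj (Const 0) rN (Cond (Eq (Read aCNT (Reg rj)) (Const 0))
        (Seq (Write aSTK (Reg rsp) (Reg rj)) (Assign rsp (Plus (Reg rsp) (Const 1)))) Skip))
     (Seq (Assign re (Const 0)) worklist_loop)))"

lemma attractor_frame [simp]:
  "wregs attractor = {rj, rsp, re, ry}" "warrs attractor = {aHD, aNX, aSTK, aCNT}"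
  by (auto simp: attractor_def)

lemma terminates_attractor:
  assumes N: "reg s rN = N" and m: "reg s rm = m"
    and less: "\<forall>e<m. arr s aGS e < N \<and> arr s aGD e < N"
  shows "terminates attractor s (50 + 120 * (N + m))
    (\<lambda>s'. threshold_attractor N m (arr s aGS) (arr s aGD) (arr s aCNT) {x. x < N \<and> arr s' aCNT x = 0})"
  unfolding attractor_def
proof (rule terminates_Seq[OF terminates_link_edges])
  show "\<forall>e<reg s rm. arr s aGD e < reg s rN" using assms by simp
next
  fix s1 assume l1: "\<forall>x<reg s rN. stores_edge_set (arr s1 aNX) (arr s1 aHD x) {e. e < reg s rm \<and> arr s aGD e = x}"
    and "agree (wregs link_edges) (warrs link_edges) s s1"
  then have ag1: "agree {rj} {aHD, aNX} s s1" by simp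
  let ?push = "Cond (Eq (Read aCNT (Reg rj)) (Const 0))
        (Seq (Write aSTK (Reg rsp) (Reg rj)) (Assign rsp (Plus (Reg rsp) (Const 1)))) Skip"
  let ?s2 = "run (Assign rsp (Const 0)) s1"
  let ?I = "\<lambda>i s'. distinct (map (arr s' aSTK) [0..<reg s' rsp]) \<and>
    set (map (arr s' aSTK) [0..<reg s' rsp]) = {x. x < i \<and> arr s aCNT x = 0}"
  show "terminates (Seq (Assign rsp (Const 0)) (Seq (For rj (Const 0) rN ?push)
     (Seq (Assign re (Const 0)) worklist_loop))) s1 (33 + 90 * (N + m))
    (\<lambda>s'. threshold_attractor N m (arr s aGS) (arr s aGD) (arr s aCNT) {x. x < N \<and> arr s' aCNT x = 0})"
  proof (rule terminates_Seq_run)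
    have "terminates (For rj (Const 0) rN ?push) ?s2 (7 + 24 * N) (?I N)"
    proof (rule terminates_For_run[where a=0 and b=N and I="?I"])
      fix i s' assume I: "?I i s'" and ag: "agree (insert rj (wregs ?push)) (warrs ?push) ?s2 s'"
        and i: "reg s' rj = i" "i < N"
      have cnt: "arr s' aCNT = arr s aCNT" using ag ag1 by (simp add: agree_arr)
      have eq: "{x. x < Suc i \<and> arr s aCNT x = 0} =
          (if arr s aCNT i = 0 then insert i {x. x < i \<and> arr s aCNT x = 0} else {x. x < i \<and> arr s aCNT x = 0})"
        by (auto simp: less_Suc_eq)
      show "?I (Suc i) ((run ?push s')\<lparr>reg := (reg (run ?push s'))(rj := Suc i)\<rparr>)"
      proof (cases "arr s aCNT i = 0")
        case True
        have "i \<notin> set (map (arr s' aSTK) [0..<reg s' rsp])" using I by auto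
        then show ?thesis
          using True I unfolding eq by (simp add: i cnt)
      next
        case False
        then show ?thesis
          using I unfolding eq by (simp add: i cnt)
      qed
    qed (use N ag1 in \<open>auto simp: agree_reg\<close>)
    then show "terminates (Seq (For rj (Const 0) rN ?push) (Seq (Assign re (Const 0)) worklist_loop)) ?s2 (30 + 90 * (N + m))
      (\<lambda>s'. threshold_attractor N m (arr s aGS) (arr s aGD) (arr s aCNT) {x. x < N \<and> arr s' aCNT x = 0})"
    proof (rule terminates_Seq)
      fix s3 assume I: "?I N s3" and "agree (wregs (For rj (Const 0) rN ?push)) (warrs (For rj (Const 0) rN ?push)) ?s2 s3"
      then have ag3: "agree {rj, rsp} {aSTK} ?s2 s3" by (auto elim!: agree_mono)
      have same: "arr s3 aGS = arr s aGS" "arr s3 aGD = arr s aGD" "arr s3 aCNT = arr s aCNT"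
          "arr s3 aNX = arr s1 aNX" "arr s3 aHD = arr s1 aHD"
        using ag1 ag3 by (simp_all add: agree_arr)
      let ?s4 = "run (Assign re (Const 0)) s3"
      have "terminates worklist_loop ?s4 (6 + 60 * (N + m))
        (\<lambda>s'. threshold_attractor N m (arr ?s4 aGS) (arr ?s4 aGD) (arr s aCNT) {x. x < N \<and> arr s' aCNT x = 0})"
        using I l1 less N m
        by (intro terminates_worklist_loop) (auto simp: same intro!: worklist_init)
      then show "terminates (Seq (Assign re (Const 0)) worklist_loop) s3 (10 + 60 * (N + m))
        (\<lambda>s'. threshold_attractor N m (arr s aGS) (arr s aGD) (arr s aCNT) {x. x < N \<and> arr s' aCNT x = 0})"
        by (intro terminates_Seq_run) (auto simp: same)
    qed simp
  qed simp_all
qed (use N m in simp)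

end

section \<open>Programs for almost-sure reachability and safety\<close>

lemma threshold_attractor_cong:
  assumes "\<And>e. e < m \<Longrightarrow> src e = src' e" "\<And>e. e < m \<Longrightarrow> dst e = dst' e" "\<And>x. x < N \<Longrightarrow> c x = c' x"
  shows "threshold_attractor N m src dst c Z \<longleftrightarrow> threshold_attractor N m src' dst' c' Z"
proof -
  have "{e. e < m \<and> src e = x \<and> Q (dst e)} = {e. e < m \<and> src' e = x \<and> Q (dst' e)}" for x Q
    using assms by auto
  from this this[of _ "\<lambda>x. x \<in> Z"] show ?thesis
    unfolding threshold_attractor_def using assms(3) by simp
qed

lemma card_less_Suc:
  "card {e. e < Suc i \<and> R e} = card {e. e < i \<and> R e} + (if R i then 1 else 0)"
proof -
  have "{e. e < Suc i \<and> R e} = (if R i then insert i {e. e < i \<and> R e} else {e. e < i \<and> R e})"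
    by (auto simp: less_Suc_eq)
  then show ?thesis by simp
qed

lemma (in enumerated_mdp) n_pos: "0 < n"
  using mdp verts unfolding is_mdp_def by auto

text \<open>Every vertex is the source of an edge. Hence all time bounds can be stated in terms of
  \<open>m\<close> alone.\<close>

lemma (in enumerated_mdp) n_le_m: "n \<le> m"
proof -
  have "{..<n} \<subseteq> src ` {..<m}"
  proof
    fix v assume "v \<in> {..<n}"
    then obtain w where "(v, w) \<in> edges P" using ex_succ by blast
    then show "v \<in> src ` {..<m}" by (auto elim!: edge_cases)
  qed
  then have "card {..<n} \<le> card (src ` {..<m})" by (intro card_mono) auto
  also have "\<dots> \<le> m" using card_image_le[of "{..<m}" src] by simp
  finally show ?thesis by simp
qed

lemma (in enumerated_mdp) card_edges: "card (edges P) = m"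
  using bij_betw_same_card[OF enum] by simp

lemma stores_sets_nth:
  assumes "stores_sets st dt Xs" "i < length Xs"
  shows "dt ` {st i..<st (Suc i)} = Xs ! i" "st (Suc i) - st i = card (Xs ! i)" "st i \<le> st (Suc i)"
    "inj_on dt {st i..<st (Suc i)}"
proof -
  have d: "distinct (map dt [st i..<st (Suc i)])" and X: "set (map dt [st i..<st (Suc i)]) = Xs ! i"
    using assms unfolding stores_sets_def by blast+
  show "dt ` {st i..<st (Suc i)} = Xs ! i" using X by simp
  show "st (Suc i) - st i = card (Xs ! i)" using distinct_card[OF d] X by simp
  show "st i \<le> st (Suc i)" using assms unfolding stores_sets_def by blast
  show "inj_on dt {st i..<st (Suc i)}" using d by (simp add: distinct_map)
qed

text \<open>Combines the write for the current vertex with those for earlier ones; the assumption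
  excludes that the second kind of write hits a cell that already holds the first.\<close>

lemma if_merge:
  assumes "b \<Longrightarrow> \<not> a'"
  shows "(if a then p else if b then q else if a' then p else if b' then q else r) =
    (if a \<or> a' then p else if b \<or> b' then q else r)"
  using assms by auto

context workspace
begin

text \<open>To the copied input this adds the sources of the edges, which the input gives only
  implicitly, so that a single loop over edge numbers can visit all edges with both end
  points.\<close>

definition holds_mdp :: "state \<Rightarrow> nat mdp \<Rightarrow> bool" where
  "holds_mdp s P \<longleftrightarrow>
     stores_sets (arr s aST) (arr s aDT) (map (\<lambda>v. edges P `` {v}) [0..<reg s rn]) \<and>
     reg s rm = arr s aST (reg s rn) \<and>
     (\<forall>v<reg s rn. arr s aOW v = (if v \<in> random P then 1 else 0)) \<and>
     (\<forall>e<reg s rm. arr s aSR e < reg s rn \<and> arr s aST (arr s aSR e) \<le> e \<and> e < arr s aST (Suc (arr s aSR e))) \<and>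
     enumerated_mdp P (reg s rn) (reg s rm) (arr s aSR) (arr s aDT)"

lemma holds_mdp_agree:
  assumes "holds_mdp s P" "agree R A s s'" "{rn, rm} \<inter> R = {}" "{aST, aDT, aOW, aSR} \<inter> A = {}"
  shows "holds_mdp s' P"
proof -
  have eqs: "reg s' rn = reg s rn" "reg s' rm = reg s rm" "arr s' aST = arr s aST" "arr s' aDT = arr s aDT"
    "arr s' aOW = arr s aOW" "arr s' aSR = arr s aSR"
    using assms(2-4) by (auto simp: agree_def)
  show ?thesis using assms(1) unfolding holds_mdp_def eqs .
qed

lemma holds_mdp_enum: "holds_mdp s P \<Longrightarrow> enumerated_mdp P (reg s rn) (reg s rm) (arr s aSR) (arr s aDT)"
  unfolding holds_mdp_def by blast

lemma holds_mdp_owner: "holds_mdp s P \<Longrightarrow> v < reg s rn \<Longrightarrow> arr s aOW v = (if v \<in> random P then 1 else 0)"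
  by (simp add: holds_mdp_def)

definition scatter :: "nat \<Rightarrow> nat \<Rightarrow> nat \<Rightarrow> nat \<Rightarrow> com" where
  "scatter st a b v = Seq (Assign rx (Read st (Plus (Reg ri) (Const 1))))
     (For rj (Read st (Reg ri)) rx (Write b (Read a (Reg rj)) (Const v)))"

lemma scatter_frame [simp]: "wregs (scatter st a b v) = {rx, rj}" "warrs (scatter st a b v) = {b}"
  by (auto simp: scatter_def)

lemma terminates_scatter:
  assumes "a \<noteq> b" "st \<noteq> b" and sets: "stores_sets (arr s st) (arr s a) Xs" "reg s ri < length Xs"
  shows "terminates (scatter st a b v) s (20 + 13 * card (Xs ! reg s ri))
    (\<lambda>s'. \<forall>x. arr s' b x = (if x \<in> Xs ! reg s ri then v else arr s b x))"
proof -
  let ?lo = "arr s st (reg s ri)" and ?hi = "arr s st (Suc (reg s ri))"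
  note X = stores_sets_nth[OF sets]
  let ?s = "run (Assign rx (Read st (Plus (Reg ri) (Const 1)))) s"
  let ?I = "\<lambda>i s'. \<forall>x. arr s' b x = (if x \<in> arr s a ` {?lo..<i} then v else arr s b x)"
  have "terminates (For rj (Read st (Reg ri)) rx (Write b (Read a (Reg rj)) (Const v))) ?s (10 + 13 * (?hi - ?lo)) (?I ?hi)"
  proof (rule terminates_For_run[where a="?lo" and b="?hi" and I="?I"])
    fix i s' assume I: "?I i s'" and ag: "agree (insert rj (wregs (Write b (Read a (Reg rj)) (Const v))))
        (warrs (Write b (Read a (Reg rj)) (Const v))) ?s s'" and i: "reg s' rj = i" "?lo \<le> i"
    have "arr s' a = arr s a" using ag assms(1) by (simp add: agree_arr)
    moreover have "{?lo..<Suc i} = insert i {?lo..<i}" using i(2) by auto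
    ultimately show "?I (Suc i) ((run (Write b (Read a (Reg rj)) (Const v)) s')
        \<lparr>reg := (reg (run (Write b (Read a (Reg rj)) (Const v)) s'))(rj := Suc i)\<rparr>)"
      using I i(1) by simp
  qed (use X(3) in simp_all)
  then have "terminates (For rj (Read st (Reg ri)) rx (Write b (Read a (Reg rj)) (Const v))) ?s
      (10 + 13 * card (Xs ! reg s ri)) (\<lambda>s'. \<forall>x. arr s' b x = (if x \<in> Xs ! reg s ri then v else arr s b x))"
    unfolding X(1) X(2) .
  then show ?thesis
    unfolding scatter_def by (rule terminates_Seq_run[rotated]) simp_all
qed

text \<open>The nodes are 0 to \<open>2 * n\<close>: labels reach up to \<open>n\<close>, and a
  vertex \<open>v\<close> outside the MECs becomes \<open>n + 1 + v\<close>. The counters first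
  collect the leaving edges of every node; the last loop then overwrites them for random vertices
  outside the MECs and for marked MECs.\<close>

definition reach_init :: com where
  "reach_init =
     Seq (For rj (Const 0) rn (Cond (Eq (Read aLAB (Reg rj)) (Const 0))
       (Write aGRP (Reg rj) (Plus (Plus (Reg rn) (Const 1)) (Reg rj)))
       (Write aGRP (Reg rj) (Read aLAB (Reg rj)))))
     (Seq (Assign rN (Plus (Plus (Reg rn) (Reg rn)) (Const 1)))
     (Seq (fill aCNT rN)
     (Seq (For rj (Const 0) rm
       (Seq (Write aGS (Reg rj) (Read aGRP (Read aSR (Reg rj))))
       (Seq (Write aGD (Reg rj) (Read aGRP (Read aDT (Reg rj))))
         (Cond (Eq (Read aGS (Reg rj)) (Read aGD (Reg rj))) Skip
           (Write aCNT (Read aGS (Reg rj)) (Plus (Read aCNT (Read aGS (Reg rj))) (Const 1)))))))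
     (For rj (Const 0) rn
       (Cond (Eq (Read aLAB (Reg rj)) (Const 0))
         (Cond (Eq (Read aOW (Reg rj)) (Const 1)) (Write aCNT (Read aGRP (Reg rj)) (Const 1)) Skip)
         (Cond (Eq (Read aMK (Reg rj)) (Const 0)) Skip
           (Write aCNT (Read aGRP (Reg rj)) (Plus (Reg rm) (Const 1)))))))))"

lemma reach_init_frame [simp]:
  "wregs reach_init = {rj, rN}" "warrs reach_init = {aGRP, aGS, aGD, aCNT}"
  by (auto simp: reach_init_def)

lemma terminates_reach_init:
  assumes n: "reg s rn = n" and m: "reg s rm = m"
    and lab: "lab = arr s aLAB" "\<forall>v<n. lab v \<le> n"
    and edges: "\<forall>e<m. arr s aSR e < n \<and> arr s aDT e < n"
    and g: "g = (\<lambda>v. if lab v = 0 then n + 1 + v else lab v)"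
  shows "terminates reach_init s (60 + 130 * (n + m)) (\<lambda>s'.
    reg s' rN = 2 * n + 1 \<and> (\<forall>v<n. arr s' aGRP v = g v) \<and>
    (\<forall>e<m. arr s' aGS e = g (arr s aSR e) \<and> arr s' aGD e = g (arr s aDT e)) \<and>
    (\<forall>x<2 * n + 1. arr s' aCNT x =
      (if \<exists>v<n. g v = x \<and> lab v = 0 \<and> arr s aOW v = 1 then 1
       else if \<exists>v<n. g v = x \<and> lab v \<noteq> 0 \<and> arr s aMK v \<noteq> 0 then m + 1
       else card {e. e < m \<and> g (arr s aSR e) = x \<and> g (arr s aDT e) \<noteq> x})))"
  unfolding reach_init_def
proof (rule terminates_Seq)
  let ?c = "Cond (Eq (Read aLAB (Reg rj)) (Const 0))
       (Write aGRP (Reg rj) (Plus (Plus (Reg rn) (Const 1)) (Reg rj)))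
       (Write aGRP (Reg rj) (Read aLAB (Reg rj)))"
  show "terminates (For rj (Const 0) rn ?c) s (7 + 27 * n) (\<lambda>s'. \<forall>v<n. arr s' aGRP v = g v)"
    by (rule terminates_For_run[where a=0 and b=n and I="\<lambda>i s'. \<forall>v<i. arr s' aGRP v = g v"])
      (simp_all add: n less_Suc_eq agree_arr agree_reg g lab(1))
  fix s1 assume g1: "\<forall>v<n. arr s1 aGRP v = g v"
    and "agree (wregs (For rj (Const 0) rn ?c)) (warrs (For rj (Const 0) rn ?c)) s s1"
  then have ag1: "agree {rj} {aGRP} s s1" by simp
  have gN: "g v < 2 * n + 1" if "v < n" for v
    using that lab(2) by (auto simp: g)
  let ?s2 = "run (Assign rN (Plus (Plus (Reg rn) (Reg rn)) (Const 1))) s1"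
  let ?d = "Seq (Write aGS (Reg rj) (Read aGRP (Read aSR (Reg rj))))
       (Seq (Write aGD (Reg rj) (Read aGRP (Read aDT (Reg rj))))
         (Cond (Eq (Read aGS (Reg rj)) (Read aGD (Reg rj))) Skip
           (Write aCNT (Read aGS (Reg rj)) (Plus (Read aCNT (Read aGS (Reg rj))) (Const 1)))))"
  let ?e = "Cond (Eq (Read aLAB (Reg rj)) (Const 0))
         (Cond (Eq (Read aOW (Reg rj)) (Const 1)) (Write aCNT (Read aGRP (Reg rj)) (Const 1)) Skip)
         (Cond (Eq (Read aMK (Reg rj)) (Const 0)) Skip
           (Write aCNT (Read aGRP (Reg rj)) (Plus (Reg rm) (Const 1))))"
  let ?cnt = "\<lambda>i x. card {e. e < i \<and> (g (arr s aSR e) = x \<and> g (arr s aDT e) \<noteq> x)}"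
  let ?post = "\<lambda>s'.
    reg s' rN = 2 * n + 1 \<and> (\<forall>v<n. arr s' aGRP v = g v) \<and>
    (\<forall>e<m. arr s' aGS e = g (arr s aSR e) \<and> arr s' aGD e = g (arr s aDT e)) \<and>
    (\<forall>x<2 * n + 1. arr s' aCNT x =
      (if \<exists>v<n. g v = x \<and> lab v = 0 \<and> arr s aOW v = 1 then 1
       else if \<exists>v<n. g v = x \<and> lab v \<noteq> 0 \<and> arr s aMK v \<noteq> 0 then m + 1
       else ?cnt m x))"
  have N2: "reg ?s2 rN = 2 * n + 1" using ag1 n by (simp add: agree_reg)
  have "terminates (Seq (fill aCNT rN) (Seq (For rj (Const 0) rm ?d) (For rj (Const 0) rn ?e))) ?s2
    (40 + 100 * (n + m)) ?post"
  proof (rule terminates_Seq)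
    show "terminates (fill aCNT rN) ?s2 (19 + 24 * n) (\<lambda>s'. \<forall>j<2 * n + 1. arr s' aCNT j = 0)"
      using terminates_fill[of rN aCNT ?s2] unfolding N2 by simp
    fix s3 assume c3: "\<forall>j<2 * n + 1. arr s3 aCNT j = 0"
      and "agree (wregs (fill aCNT rN)) (warrs (fill aCNT rN)) ?s2 s3"
    then have "agree {rj} {aCNT} ?s2 s3" by simp
    then have ag3: "agree {rj, rN} {aGRP, aCNT} s s3" and g3: "arr s3 aGRP = arr s1 aGRP"
      and N3: "reg s3 rN = 2 * n + 1"
      using ag1 N2 by (auto simp: agree_def)
    let ?I = "\<lambda>i s'. (\<forall>e<i. arr s' aGS e = g (arr s aSR e) \<and> arr s' aGD e = g (arr s aDT e)) \<and>
      (\<forall>x<2 * n + 1. arr s' aCNT x = ?cnt i x)"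
    show "terminates (Seq (For rj (Const 0) rm ?d) (For rj (Const 0) rn ?e)) s3 (20 + 70 * (n + m)) ?post"
    proof (rule terminates_Seq)
      show "terminates (For rj (Const 0) rm ?d) s3 (7 + 42 * m) (?I m)"
      proof (rule terminates_For_run[where a=0 and b=m and I="?I"])
        fix i s' assume I: "?I i s'" and ag: "agree (insert rj (wregs ?d)) (warrs ?d) s3 s'"
          and i: "reg s' rj = i" "i < m"
        have ag': "agree {rj} {aGS, aGD, aCNT} s3 s'" using ag by (simp add: insert_commute)
        have same: "arr s' aSR = arr s aSR" "arr s' aDT = arr s aDT" "arr s' aGRP = arr s1 aGRP"
          using ag' ag3 g3 by (simp_all add: agree_arr)
        have gi: "arr s1 aGRP (arr s aSR i) = g (arr s aSR i)" "arr s1 aGRP (arr s aDT i) = g (arr s aDT i)"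
          using g1 edges i(2) by auto
        have "g (arr s aSR i) < 2 * n + 1" using gN edges i(2) by blast
        then show "?I (Suc i) ((run ?d s')\<lparr>reg := (reg (run ?d s'))(rj := Suc i)\<rparr>)"
          using I i(1) unfolding card_less_Suc by (auto simp: same gi less_Suc_eq)
      qed (use c3 ag3 m in \<open>simp_all add: agree_reg\<close>)
      fix s4 assume I4: "?I m s4" and "agree (wregs (For rj (Const 0) rm ?d)) (warrs (For rj (Const 0) rm ?d)) s3 s4"
      then have ag34: "agree {rj} {aGS, aGD, aCNT} s3 s4" by (simp add: insert_commute)
      have g4: "arr s4 aGRP = arr s1 aGRP" and N4: "reg s4 rN = 2 * n + 1"
        using ag34 g3 N3 by (simp_all add: agree_arr agree_reg)
      have ag4: "agree {rj, rN} {aGRP, aCNT, aGS, aGD} s s4"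
        using ag34 ag3 by (auto simp: agree_def)
      let ?J = "\<lambda>i s'. (\<forall>x<2 * n + 1. arr s' aCNT x =
        (if \<exists>v<i. g v = x \<and> lab v = 0 \<and> arr s aOW v = 1 then 1
         else if \<exists>v<i. g v = x \<and> lab v \<noteq> 0 \<and> arr s aMK v \<noteq> 0 then m + 1
         else ?cnt m x))"
      have "terminates (For rj (Const 0) rn ?e) s4 (7 + 50 * n) (?J n)"
      proof (rule terminates_For_run[where a=0 and b=n and I="?J"])
        fix i s' assume J: "?J i s'" and ag: "agree (insert rj (wregs ?e)) (warrs ?e) s4 s'"
          and i: "reg s' rj = i" "i < n"
        have ag': "agree {rj} {aCNT} s4 s'" using ag by simp
        have same: "arr s' aLAB = lab" "arr s' aOW = arr s aOW" "arr s' aMK = arr s aMK"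
          "arr s' aGRP = arr s1 aGRP" "reg s' rm = m"
          using ag' ag4 g4 m lab(1) by (simp_all add: agree_arr agree_reg)
        have gi: "arr s1 aGRP i = g i" using g1 i(2) by blast
        \<comment> \<open>The label of a MEC is at most \<open>n\<close>, whereas the node of a
          vertex outside the MECs is greater than \<open>n\<close>.\<close>
        have excl: "\<not> (g v = g i \<and> lab v = 0 \<and> lab i \<noteq> 0)" if "v < i" for v
          using that i(2) lab(2) by (auto simp: g dest!: spec[of _ i])
        show "?J (Suc i) ((run ?e s')\<lparr>reg := (reg (run ?e s'))(rj := Suc i)\<rparr>)"
        proof (intro allI impI)
          fix x assume x: "x < 2 * n + 1"
          let ?s' = "(run ?e s')\<lparr>reg := (reg (run ?e s'))(rj := Suc i)\<rparr>"
          have old: "arr s' aCNT x = (if \<exists>v<i. g v = x \<and> lab v = 0 \<and> arr s aOW v = 1 then 1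
             else if \<exists>v<i. g v = x \<and> lab v \<noteq> 0 \<and> arr s aMK v \<noteq> 0 then m + 1
             else ?cnt m x)"
            using J x by blast
          have new: "arr ?s' aCNT x = (if g i = x \<and> lab i = 0 \<and> arr s aOW i = 1 then 1
            else if g i = x \<and> lab i \<noteq> 0 \<and> arr s aMK i \<noteq> 0 then m + 1 else arr s' aCNT x)"
            by (simp add: same i gi)
          have ex: "(\<exists>v<Suc i. R v) \<longleftrightarrow> R i \<or> (\<exists>v<i. R v)" for R :: "nat \<Rightarrow> bool"
            by (auto simp: less_Suc_eq)
          show "arr ?s' aCNT x = (if \<exists>v<Suc i. g v = x \<and> lab v = 0 \<and> arr s aOW v = 1 then 1
             else if \<exists>v<Suc i. g v = x \<and> lab v \<noteq> 0 \<and> arr s aMK v \<noteq> 0 then m + 1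
             else ?cnt m x)"
            unfolding new old ex
          proof (rule if_merge)
            assume "g i = x \<and> lab i \<noteq> 0 \<and> arr s aMK i \<noteq> 0"
            then show "\<not> (\<exists>v<i. g v = x \<and> lab v = 0 \<and> arr s aOW v = 1)" using excl by fastforce
          qed
        qed
      qed (use I4 ag4 n in \<open>simp_all add: agree_reg\<close>)
      then show "terminates (For rj (Const 0) rn ?e) s4 (8 + 50 * n) ?post"
      proof (rule terminates_conseq)
        fix s5 assume J: "?J n s5" and "agree (wregs (For rj (Const 0) rn ?e)) (warrs (For rj (Const 0) rn ?e)) s4 s5"
        then have ag5: "agree {rj} {aCNT} s4 s5" by simp
        have "arr s5 aGRP = arr s1 aGRP" "reg s5 rN = 2 * n + 1" "arr s5 aGS = arr s4 aGS" "arr s5 aGD = arr s4 aGD"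
          using ag5 g4 N4 by (simp_all add: agree_arr agree_reg)
        then show "?post s5" using J g1 I4 by simp
      qed simp
    qed simp
  qed simp
  then show "terminates (Seq (Assign rN (Plus (Plus (Reg rn) (Reg rn)) (Const 1)))
     (Seq (fill aCNT rN) (Seq (For rj (Const 0) rm ?d) (For rj (Const 0) rn ?e)))) s1
    (50 + 100 * (n + m)) ?post"
    by (rule terminates_Seq_run[rotated]) simp_all
qed simp

text \<open>Only ones are written: the cells of other vertices keep their content, so that runs for
  several pairs accumulate the union of the winning sets.\<close>

definition reach :: com where
  "reach = Seq reach_init (Seq attractor
     (For rj (Const 0) rn (Cond (Eq (Read aCNT (Read aGRP (Reg rj))) (Const 0)) Skip
       (Write aRES (Reg rj) (Const 1)))))"

lemma reach_frame [simp]: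
  "wregs reach = {rj, rN, rsp, re, ry}"
  "warrs reach = {aGRP, aGS, aGD, aCNT, aHD, aNX, aSTK, aRES}"
  by (auto simp: reach_def)

lemma terminates_reach:
  assumes P: "holds_mdp s P"
    and lab: "enumerated_mdp.is_mec_labelling P (reg s rn) (arr s aLAB)"
    and marked_win: "\<And>v. v < reg s rn \<Longrightarrow> arr s aMK v \<noteq> 0 \<Longrightarrow> arr s aLAB v \<noteq> 0 \<Longrightarrow> v \<in> as_win P (Rabin RP)"
    and win_marked: "\<And>X u. winning_ec P RP X \<Longrightarrow> u \<in> X \<Longrightarrow>
      \<exists>v<reg s rn. arr s aMK v \<noteq> 0 \<and> arr s aLAB v = arr s aLAB u"
  shows "terminates reach s (1500 * reg s rm) (\<lambda>s'. \<forall>v<reg s rn.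
    arr s' aRES v = (if v \<in> as_win P (Rabin RP) then 1 else arr s aRES v))"
proof -
  define n m l g where "n = reg s rn" and "m = reg s rm" and "l = arr s aLAB"
    and "g = (\<lambda>v. if l v = 0 then n + 1 + v else l v)"
  interpret E: enumerated_mdp P n m "arr s aSR" "arr s aDT"
    unfolding n_def m_def by (rule holds_mdp_enum[OF P])
  have mecs: "E.is_mec_labelling l" using lab by (simp add: n_def l_def)
  then have l_le: "\<forall>v<n. l v \<le> n" by (simp add: E.is_mec_labelling_def)
  have grp: "E.group l = g" by (simp add: fun_eq_iff E.group_def g_def)
  have less: "\<forall>e<m. arr s aSR e < n \<and> arr s aDT e < n"
    using E.edge_less[OF E.edgeI] by blast
  have nm: "n \<le> m" "1 \<le> m" using E.n_le_m E.n_pos by auto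
  have gN: "g v < 2 * n + 1" if "v < n" for v
    using that l_le by (auto simp: g_def)
  have geq: "l u = l v \<and> (l u = 0 \<longrightarrow> u = v)" if "u < n" "v < n" "g u = g v" for u v
  proof -
    have "l u \<le> n" "l v \<le> n" using l_le that by auto
    then show ?thesis using that(3) unfolding g_def by (auto split: if_splits)
  qed
  let ?f = "Cond (Eq (Read aCNT (Read aGRP (Reg rj))) (Const 0)) Skip (Write aRES (Reg rj) (Const 1))"
  have "terminates reach s (60 + 130 * (n + m) + (52 + 120 * (2 * n + 1 + m)) + (10 + 30 * n))
    (\<lambda>s'. \<forall>v<n. arr s' aRES v = (if v \<in> as_win P (Rabin RP) then 1 else arr s aRES v))"
    unfolding reach_def
  proof (rule terminates_Seq[OF terminates_reach_init[OF n_def[symmetric] m_def[symmetric] l_def l_le less g_def]])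
    let ?c = "\<lambda>x. if \<exists>v<n. g v = x \<and> l v = 0 \<and> arr s aOW v = 1 then 1
       else if \<exists>v<n. g v = x \<and> l v \<noteq> 0 \<and> arr s aMK v \<noteq> 0 then m + 1
       else card {e. e < m \<and> g (arr s aSR e) = x \<and> g (arr s aDT e) \<noteq> x}"
    fix s1 assume s1: "reg s1 rN = 2 * n + 1 \<and> (\<forall>v<n. arr s1 aGRP v = g v) \<and>
      (\<forall>e<m. arr s1 aGS e = g (arr s aSR e) \<and> arr s1 aGD e = g (arr s aDT e)) \<and>
      (\<forall>x<2 * n + 1. arr s1 aCNT x = ?c x)"
      and "agree (wregs reach_init) (warrs reach_init) s s1"
    then have ag1: "agree {rj, rN} {aGRP, aGS, aGD, aCNT} s s1" by simp
    have "terminates attractor s1 (50 + 120 * (2 * n + 1 + m))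
      (\<lambda>s'. threshold_attractor (2 * n + 1) m (arr s1 aGS) (arr s1 aGD) (arr s1 aCNT)
        {x. x < 2 * n + 1 \<and> arr s' aCNT x = 0})"
      using s1 ag1 less gN by (intro terminates_attractor) (simp_all add: agree_reg m_def)
    then show "terminates (Seq attractor (For rj (Const 0) rn ?f)) s1 (51 + 120 * (2 * n + 1 + m) + (10 + 30 * n))
      (\<lambda>s'. \<forall>v<n. arr s' aRES v = (if v \<in> as_win P (Rabin RP) then 1 else arr s aRES v))"
    proof (rule terminates_Seq)
      fix s2 :: state
      let ?Z = "{x. x < 2 * n + 1 \<and> arr s2 aCNT x = 0}"
      assume attr: "threshold_attractor (2 * n + 1) m (arr s1 aGS) (arr s1 aGD) (arr s1 aCNT) ?Z"
        and "agree (wregs attractor) (warrs attractor) s1 s2"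
      then have ag12: "agree {rj, rsp, re, ry} {aHD, aNX, aSTK, aCNT} s1 s2" by simp
      have attr': "threshold_attractor (2 * n + 1) m (\<lambda>e. E.group l (arr s aSR e)) (\<lambda>e. E.group l (arr s aDT e)) ?c ?Z"
        using attr s1 unfolding grp by (subst threshold_attractor_cong[symmetric]) auto
      have win: "as_win P (Rabin RP) = {v. v < n \<and> E.group l v \<notin> ?Z}"
      proof (rule E.as_win_eq_attractor_compl[OF mecs attr', where marked="{v. arr s aMK v \<noteq> 0}"])
        fix v assume v: "v < n" "l v = 0" "v \<in> random P"
        then have "arr s aOW v = 1" using holds_mdp_owner[OF P] by (simp add: n_def)
        then have "\<exists>u<n. g u = g v \<and> l u = 0 \<and> arr s aOW u = 1" using v by blast
        then show "?c (E.group l v) = 1" unfolding grp by (rule if_P)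
      next
        fix v assume v: "v < n" "l v \<noteq> 0" "v \<in> {v. arr s aMK v \<noteq> 0}"
        have 1: "\<not> (\<exists>u<n. g u = g v \<and> l u = 0 \<and> arr s aOW u = 1)"
          using v(1,2) geq by metis
        have 2: "\<exists>u<n. g u = g v \<and> l u \<noteq> 0 \<and> arr s aMK u \<noteq> 0" using v by blast
        show "m < ?c (E.group l v)" unfolding grp if_not_P[OF 1] if_P[OF 2] by simp
      next
        fix v assume v: "v < n" "l v = 0 \<longrightarrow> v \<in> player1 P"
          "l v \<noteq> 0 \<longrightarrow> (\<forall>u<n. l u = l v \<longrightarrow> u \<notin> {v. arr s aMK v \<noteq> 0})"
        have 1: "\<not> (\<exists>u<n. g u = g v \<and> l u = 0 \<and> arr s aOW u = 1)"
        proof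
          assume "\<exists>u<n. g u = g v \<and> l u = 0 \<and> arr s aOW u = 1"
          then obtain u where u: "u < n" "g u = g v" "l u = 0" "arr s aOW u = 1" by blast
          then have "u = v" using geq[of u v] v(1) by simp
          moreover have "u \<in> random P"
          proof (rule ccontr)
            assume "u \<notin> random P"
            then have "arr s aOW u = 0" using holds_mdp_owner[OF P, of u] u(1) unfolding n_def by simp
            then show False using u(4) by simp
          qed
          ultimately show False using v(2) u(3) E.not_player_and_random by blast
        qed
        have 2: "\<not> (\<exists>u<n. g u = g v \<and> l u \<noteq> 0 \<and> arr s aMK u \<noteq> 0)"
        proof
          assume "\<exists>u<n. g u = g v \<and> l u \<noteq> 0 \<and> arr s aMK u \<noteq> 0"
          then obtain u where u: "u < n" "g u = g v" "l u \<noteq> 0" "arr s aMK u \<noteq> 0" by blast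
          then have "l u = l v" using geq[of u v] v(1) by simp
          then show False using v(3) u by simp
        qed
        show "?c (E.group l v) =
          card {e. e < m \<and> E.group l (arr s aSR e) = E.group l v \<and> E.group l (arr s aDT e) \<noteq> E.group l v}"
          unfolding grp if_not_P[OF 1] if_not_P[OF 2] ..
      next
        show "v \<in> as_win P (Rabin RP)" if "v < n" "v \<in> {v. arr s aMK v \<noteq> 0}" "l v \<noteq> 0" for v
          using marked_win that by (simp add: n_def l_def)
        show "\<exists>v<n. v \<in> {v. arr s aMK v \<noteq> 0} \<and> l v = l u" if "winning_ec P RP X" "u \<in> X" for X u
          using win_marked[OF that] by (simp add: n_def l_def)
      qed
      then have win': "v \<in> as_win P (Rabin RP) \<longleftrightarrow> arr s2 aCNT (g v) \<noteq> 0" if "v < n" for v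
        using that gN[OF that] unfolding grp by auto
      have ag2: "agree {rj, rN, rsp, re, ry} {aGRP, aGS, aGD, aCNT, aHD, aNX, aSTK} s s2"
        using ag1 ag12 by (auto simp: agree_def)
      have g2: "arr s2 aGRP = arr s1 aGRP" using ag12 by (simp add: agree_arr)
      let ?I = "\<lambda>i s'. \<forall>v. arr s' aRES v = (if v < i \<and> v \<in> as_win P (Rabin RP) then 1 else arr s aRES v)"
      have "terminates (For rj (Const 0) rn ?f) s2 (10 + 30 * n) (?I n)"
      proof (rule terminates_For_run[where a=0 and b=n and I="?I"])
        fix i s' assume I: "?I i s'" and ag: "agree (insert rj (wregs ?f)) (warrs ?f) s2 s'"
          and i: "reg s' rj = i" "i < n"
        have "arr s' aCNT = arr s2 aCNT" "arr s' aGRP = arr s1 aGRP"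
          using ag g2 by (simp_all add: agree_arr)
        then show "?I (Suc i) ((run ?f s')\<lparr>reg := (reg (run ?f s'))(rj := Suc i)\<rparr>)"
          using I i s1 win'[OF i(2)] by (auto simp: less_Suc_eq)
      qed (use ag2 in \<open>simp_all add: agree_reg agree_arr n_def\<close>)
      then show "terminates (For rj (Const 0) rn ?f) s2 (10 + 30 * n)
        (\<lambda>s'. \<forall>v<n. arr s' aRES v = (if v \<in> as_win P (Rabin RP) then 1 else arr s aRES v))"
        by (rule terminates_conseq) simp_all
    qed simp
  qed simp
  then show ?thesis
    by (rule terminates_conseq) (use nm in \<open>simp_all add: n_def m_def\<close>)
qed

end

section \<open>Contiguously stored sets and the enumeration of edges\<close>

lemma stores_sets_mono:
  assumes "stores_sets st dt Xs" "i \<le> j" "j \<le> length Xs"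
  shows "st i \<le> st j"
  using assms(2,3)
proof (induction rule: dec_induct)
  case (step k)
  then have "st k \<le> st (Suc k)" using stores_sets_nth(3)[OF assms(1), of k] by simp
  then show ?case using step by simp
qed simp

lemma stores_sets_cong:
  assumes "stores_sets st dt Xs" "\<And>i. i \<le> length Xs \<Longrightarrow> st' i = st i"
    "\<And>j. j < st (length Xs) \<Longrightarrow> dt' j = dt j"
  shows "stores_sets st' dt' Xs"
proof -
  have eq: "map dt' [st' i..<st' (Suc i)] = map dt [st i..<st (Suc i)]" if "i < length Xs" for i
  proof -
    have "st (Suc i) \<le> st (length Xs)" using stores_sets_mono[OF assms(1), of "Suc i"] that by simp
    then show ?thesis using assms(2)[of i] assms(2)[of "Suc i"] assms(3) that by simp
  qed
  show ?thesis
    unfolding stores_sets_def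
  proof (intro conjI allI impI)
    fix i assume i: "i < length Xs"
    show "distinct (map dt' [st' i..<st' (Suc i)])" "set (map dt' [st' i..<st' (Suc i)]) = Xs ! i"
      unfolding eq[OF i] using assms(1) i unfolding stores_sets_def by blast+
    show "st' i \<le> st' (Suc i)"
      using stores_sets_nth(3)[OF assms(1) i] assms(2)[of i] assms(2)[of "Suc i"] i by simp
  qed (use assms(1) assms(2)[of 0] in \<open>simp add: stores_sets_def\<close>)
qed

lemma stores_sets_total:
  assumes "stores_sets st dt Xs" "\<And>X. X \<in> set Xs \<Longrightarrow> card X \<le> n"
  shows "i \<le> length Xs \<Longrightarrow> st i \<le> i * n"
proof (induction i)
  case 0
  then show ?case using assms(1) by (simp add: stores_sets_def)
next
  case (Suc i)
  then have "st (Suc i) - st i \<le> n"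
    using stores_sets_nth(2)[OF assms(1), of i] assms(2)[of "Xs ! i"] by simp
  then show ?case using Suc by simp
qed

lemma block_unique:
  fixes st :: "nat \<Rightarrow> nat"
  assumes mono: "\<And>i j. i \<le> j \<Longrightarrow> j \<le> n \<Longrightarrow> st i \<le> st j"
    and "a < n" "b < n" "st a \<le> e" "e < st (Suc a)" "st b \<le> e" "e < st (Suc b)"
  shows "a = b"
proof (rule ccontr)
  assume "a \<noteq> b"
  then consider "Suc a \<le> b" | "Suc b \<le> a" by linarith
  then show False
  proof cases
    case 1
    then have "st (Suc a) \<le> st b" using mono assms(3) by simp
    then show False using assms by linarith
  next
    case 2
    then have "st (Suc b) \<le> st a" using mono assms(2) by simp
    then show False using assms by linarith
  qed
qed

text \<open>The number of an edge is its position in the adjacency data. The blocks of different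
  sources are disjoint and contain no repetitions, so the position is determined by the
  edge.\<close>

lemma stores_sets_enum:
  assumes sets: "stores_sets st dt (map (\<lambda>v. E `` {v}) [0..<n])" and E: "E \<subseteq> {..<n} \<times> UNIV"
    and src: "\<forall>e<st n. src e < n \<and> st (src e) \<le> e \<and> e < st (Suc (src e))"
  shows "bij_betw (\<lambda>e. (src e, dt e)) {..<st n} E"
  unfolding bij_betw_def
proof
  have mono: "st i \<le> st j" if "i \<le> j" "j \<le> n" for i j
    using stores_sets_mono[OF sets that(1)] that(2) by simp
  have X: "dt ` {st v..<st (Suc v)} = E `` {v}" "inj_on dt {st v..<st (Suc v)}" if "v < n" for v
    using stores_sets_nth(1,4)[OF sets, of v] that by simp_all
  show "inj_on (\<lambda>e. (src e, dt e)) {..<st n}"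
  proof (rule inj_onI)
    fix e e' assume e: "e \<in> {..<st n}" "e' \<in> {..<st n}" and eq: "(src e, dt e) = (src e', dt e')"
    have "e \<in> {st (src e)..<st (Suc (src e))}" "e' \<in> {st (src e)..<st (Suc (src e))}" "src e < n"
      using src e eq by auto
    then show "e = e'" using inj_onD[OF X(2)] eq by blast
  qed
  show "(\<lambda>e. (src e, dt e)) ` {..<st n} = E"
  proof (intro equalityI subsetI)
    fix p assume "p \<in> (\<lambda>e. (src e, dt e)) ` {..<st n}"
    then obtain e where e: "e < st n" "p = (src e, dt e)" by auto
    then have "dt e \<in> E `` {src e}" using X(1)[of "src e"] src by auto
    then show "p \<in> E" using e by simp
  next
    fix p assume p: "p \<in> E"
    then obtain v w where vw: "p = (v, w)" "v < n" using E by auto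
    then have "w \<in> dt ` {st v..<st (Suc v)}" using X(1) p by auto
    then obtain e where e: "st v \<le> e" "e < st (Suc v)" "dt e = w" by auto
    have "e < st n" using mono[of "Suc v" n] e(2) vw(2) by simp
    moreover have "src e = v"
      using block_unique[where a="src e" and b=v and e=e and n=n and st=st, OF mono] src \<open>e < st n\<close> e vw(2)
      by simp
    ultimately show "p \<in> (\<lambda>e. (src e, dt e)) ` {..<st n}"
      using vw(1) e(3) by (intro image_eqI[of _ _ e]) simp_all
  qed
qed

section \<open>Marking the vertices from which a set can surely be avoided\<close>

context workspace
begin

text \<open>Thresholds are overwritten in order of increasing priority: out-degrees, then 1 at
  random vertices, and finally 0 on \<open>U\<close>, whoever owns the vertex.\<close>

definition safe_init :: com where
  "safe_init = Seq (Assign rN (Reg rn)) (Seq (fill aCNT rN)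
     (Seq (For rj (Const 0) rm
       (Seq (Write aGS (Reg rj) (Read aSR (Reg rj)))
       (Seq (Write aGD (Reg rj) (Read aDT (Reg rj)))
         (Write aCNT (Read aSR (Reg rj)) (Plus (Read aCNT (Read aSR (Reg rj))) (Const 1))))))
     (Seq (For rj (Const 0) rn
         (Cond (Eq (Read aOW (Reg rj)) (Const 1)) (Write aCNT (Reg rj) (Const 1)) Skip))
       (scatter aUS aUD aCNT 0))))"

lemma safe_init_frame [simp]:
  "wregs safe_init = {rj, rx, rN}" "warrs safe_init = {aGS, aGD, aCNT}"
  by (auto simp: safe_init_def)

lemma terminates_safe_init:
  assumes n: "reg s rn = n" and m: "reg s rm = m"
    and edges: "\<forall>e<m. arr s aSR e < n \<and> arr s aDT e < n"
    and Us: "stores_sets (arr s aUS) (arr s aUD) Us" "reg s ri < length Us"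
    and U: "U = Us ! reg s ri" "card U \<le> n"
  shows "terminates safe_init s (100 + 100 * (n + m)) (\<lambda>s'.
    reg s' rN = n \<and>
    (\<forall>e<m. arr s' aGS e = arr s aSR e \<and> arr s' aGD e = arr s aDT e) \<and>
    (\<forall>v<n. arr s' aCNT v = (if v \<in> U then 0 else if arr s aOW v = 1 then 1
       else card {e. e < m \<and> arr s aSR e = v})))"
proof -
  let ?d = "Seq (Write aGS (Reg rj) (Read aSR (Reg rj)))
       (Seq (Write aGD (Reg rj) (Read aDT (Reg rj)))
         (Write aCNT (Read aSR (Reg rj)) (Plus (Read aCNT (Read aSR (Reg rj))) (Const 1))))"
  let ?e = "Cond (Eq (Read aOW (Reg rj)) (Const 1)) (Write aCNT (Reg rj) (Const 1)) Skip"
  let ?post = "\<lambda>s'. reg s' rN = n \<and>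
    (\<forall>e<m. arr s' aGS e = arr s aSR e \<and> arr s' aGD e = arr s aDT e) \<and>
    (\<forall>v<n. arr s' aCNT v = (if v \<in> U then 0 else if arr s aOW v = 1 then 1
       else card {e. e < m \<and> arr s aSR e = v}))"
  let ?s1 = "run (Assign rN (Reg rn)) s"
  have N1: "reg ?s1 rN = n" using n by simp
  have "terminates (Seq (fill aCNT rN) (Seq (For rj (Const 0) rm ?d)
      (Seq (For rj (Const 0) rn ?e) (scatter aUS aUD aCNT 0)))) ?s1 (80 + 100 * (n + m)) ?post"
  proof (rule terminates_Seq)
    show "terminates (fill aCNT rN) ?s1 (7 + 12 * n) (\<lambda>s'. \<forall>j<n. arr s' aCNT j = 0)"
      using terminates_fill[of rN aCNT ?s1] unfolding N1 by simp
    fix s2 assume c2: "\<forall>j<n. arr s2 aCNT j = 0" and "agree (wregs (fill aCNT rN)) (warrs (fill aCNT rN)) ?s1 s2"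
    then have "agree {rj} {aCNT} ?s1 s2" by simp
    then have ag2: "agree {rj, rN} {aCNT} s s2" and N2: "reg s2 rN = n"
      using N1 by (auto simp: agree_def)
    let ?I = "\<lambda>i s'. (\<forall>e<i. arr s' aGS e = arr s aSR e \<and> arr s' aGD e = arr s aDT e) \<and>
      (\<forall>x<n. arr s' aCNT x = card {e. e < i \<and> arr s aSR e = x})"
    show "terminates (Seq (For rj (Const 0) rm ?d)
      (Seq (For rj (Const 0) rn ?e) (scatter aUS aUD aCNT 0))) s2 (70 + 80 * (n + m)) ?post"
    proof (rule terminates_Seq)
      show "terminates (For rj (Const 0) rm ?d) s2 (7 + 40 * m) (?I m)"
      proof (rule terminates_For_run[where a=0 and b=m and I="?I"])
        fix i s' assume I: "?I i s'" and ag: "agree (insert rj (wregs ?d)) (warrs ?d) s2 s'"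
          and i: "reg s' rj = i" "i < m"
        have ag': "agree {rj} {aGS, aGD, aCNT} s2 s'" using ag by (simp add: insert_commute)
        have same: "arr s' aSR = arr s aSR" "arr s' aDT = arr s aDT"
          using ag' ag2 by (simp_all add: agree_arr)
        have "arr s aSR i < n" using edges i(2) by blast
        then show "?I (Suc i) ((run ?d s')\<lparr>reg := (reg (run ?d s'))(rj := Suc i)\<rparr>)"
          using I i(1) unfolding card_less_Suc by (simp add: same less_Suc_eq)
      qed (use c2 ag2 m in \<open>simp_all add: agree_reg\<close>)
      fix s3 assume I3: "?I m s3" and "agree (wregs (For rj (Const 0) rm ?d)) (warrs (For rj (Const 0) rm ?d)) s2 s3"
      then have ag23: "agree {rj} {aGS, aGD, aCNT} s2 s3" by (simp add: insert_commute)
      have ag3: "agree {rj, rN} {aCNT, aGS, aGD} s s3" and N3: "reg s3 rN = n"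
        using ag23 ag2 N2 by (auto simp: agree_def)
      let ?J = "\<lambda>i s'. \<forall>v<n. arr s' aCNT v = (if v < i \<and> arr s aOW v = 1 then 1 else card {e. e < m \<and> arr s aSR e = v})"
      show "terminates (Seq (For rj (Const 0) rn ?e) (scatter aUS aUD aCNT 0)) s3 (50 + 40 * (n + m)) ?post"
      proof (rule terminates_Seq)
        show "terminates (For rj (Const 0) rn ?e) s3 (7 + 20 * n) (?J n)"
        proof (rule terminates_For_run[where a=0 and b=n and I="?J"])
          fix i s' assume J: "?J i s'" and ag: "agree (insert rj (wregs ?e)) (warrs ?e) s3 s'"
            and i: "reg s' rj = i" "i < n"
          have "arr s' aOW = arr s aOW" using ag ag3 by (simp add: agree_arr)
          then show "?J (Suc i) ((run ?e s')\<lparr>reg := (reg (run ?e s'))(rj := Suc i)\<rparr>)"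
            using J i by (auto simp: less_Suc_eq)
        qed (use I3 ag3 n in \<open>simp_all add: agree_reg\<close>)
        fix s4 assume J4: "?J n s4" and "agree (wregs (For rj (Const 0) rn ?e)) (warrs (For rj (Const 0) rn ?e)) s3 s4"
        then have ag34: "agree {rj} {aCNT} s3 s4" by simp
        have ag4: "agree {rj, rN} {aCNT, aGS, aGD} s s4" and N4: "reg s4 rN = n"
          using ag34 ag3 N3 by (auto simp: agree_def)
        have same4: "reg s4 ri = reg s ri" "arr s4 aUS = arr s aUS" "arr s4 aUD = arr s aUD"
          using ag4 by (simp_all add: agree_arr agree_reg)
        have "terminates (scatter aUS aUD aCNT 0) s4 (20 + 13 * card (Us ! reg s4 ri))
          (\<lambda>s'. \<forall>x. arr s' aCNT x = (if x \<in> Us ! reg s4 ri then 0 else arr s4 aCNT x))"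
          using Us by (intro terminates_scatter) (simp_all add: same4)
        then show "terminates (scatter aUS aUD aCNT 0) s4 (20 + 13 * n) ?post"
        proof (rule terminates_conseq)
          show "20 + 13 * card (Us ! reg s4 ri) \<le> 20 + 13 * n" using U same4 by simp
          fix s5 assume s5: "\<forall>x. arr s5 aCNT x = (if x \<in> Us ! reg s4 ri then 0 else arr s4 aCNT x)"
            and "agree (wregs (scatter aUS aUD aCNT 0)) (warrs (scatter aUS aUD aCNT 0)) s4 s5"
          then have ag5: "agree {rx, rj} {aCNT} s4 s5" by simp
          have "arr s5 aGS = arr s3 aGS" "arr s5 aGD = arr s3 aGD" "reg s5 rN = n"
            using ag5 ag34 N4 by (simp_all add: agree_arr agree_reg)
          then show "?post s5" using s5 J4 I3 U(1) same4 by simp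
        qed
      qed simp
    qed simp
  qed simp
  then show ?thesis
    unfolding safe_init_def by (rule terminates_Seq_run[rotated]) simp_all
qed

text \<open>Marks are added but never removed, so that the loop over the pairs accumulates
  them.\<close>

definition safe :: com where
  "safe = Seq safe_init (Seq attractor
     (For rj (Const 0) rn (Cond (Eq (Read aCNT (Reg rj)) (Const 0)) Skip (Write aMK (Reg rj) (Const 1)))))"

lemma safe_frame [simp]:
  "wregs safe = {rj, rx, rN, rsp, re, ry}"
  "warrs safe = {aGS, aGD, aCNT, aHD, aNX, aSTK, aMK}"
  by (auto simp: safe_def)

text \<open>The marked set is described only by what the final attractor needs: it contains all
  end-components that avoid \<open>U\<close>, which gives completeness, and all its vertices win,
  which gives soundness.\<close>

lemma terminates_safe:
  assumes P: "holds_mdp s P"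
    and Us: "stores_sets (arr s aUS) (arr s aUD) Us" "reg s ri < length Us"
    and U: "U = Us ! reg s ri" "U \<subseteq> verts P"
  shows "terminates safe s (1500 * reg s rm) (\<lambda>s'. \<exists>S.
    (\<forall>X. end_component P X \<and> X \<inter> U = {} \<longrightarrow> X \<subseteq> S) \<and>
    (\<forall>RP. (verts P, U) \<in> set RP \<longrightarrow> S \<subseteq> as_win P (Rabin RP)) \<and>
    (\<forall>v<reg s rn. arr s' aMK v = (if v \<in> S then 1 else arr s aMK v)))"
proof -
  define n m where "n = reg s rn" and "m = reg s rm"
  interpret E: enumerated_mdp P n m "arr s aSR" "arr s aDT"
    unfolding n_def m_def by (rule holds_mdp_enum[OF P])
  have less: "\<forall>e<m. arr s aSR e < n \<and> arr s aDT e < n"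
    using E.edge_less[OF E.edgeI] by blast
  have nm: "n \<le> m" "1 \<le> m" using E.n_le_m E.n_pos by auto
  have Un: "card U \<le> n" using card_mono[OF _ U(2)] by (simp add: E.verts)
  let ?f = "Cond (Eq (Read aCNT (Reg rj)) (Const 0)) Skip (Write aMK (Reg rj) (Const 1))"
  let ?c = "\<lambda>v. if v \<in> U then 0 else if arr s aOW v = 1 then 1 else card {e. e < m \<and> arr s aSR e = v}"
  let ?post = "\<lambda>s'. \<exists>S. (\<forall>X. end_component P X \<and> X \<inter> U = {} \<longrightarrow> X \<subseteq> S) \<and>
    (\<forall>RP. (verts P, U) \<in> set RP \<longrightarrow> S \<subseteq> as_win P (Rabin RP)) \<and>
    (\<forall>v<n. arr s' aMK v = (if v \<in> S then 1 else arr s aMK v))"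
  have "terminates safe s (100 + 100 * (n + m) + (52 + 120 * (n + m)) + (10 + 30 * n)) ?post"
    unfolding safe_def
  proof (rule terminates_Seq[OF terminates_safe_init[OF n_def[symmetric] m_def[symmetric] less Us U(1) Un]])
    fix s1 assume s1: "reg s1 rN = n \<and>
      (\<forall>e<m. arr s1 aGS e = arr s aSR e \<and> arr s1 aGD e = arr s aDT e) \<and> (\<forall>v<n. arr s1 aCNT v = ?c v)"
      and "agree (wregs safe_init) (warrs safe_init) s s1"
    then have ag1: "agree {rj, rx, rN} {aGS, aGD, aCNT} s s1" by simp
    have "terminates attractor s1 (50 + 120 * (n + m))
      (\<lambda>s'. threshold_attractor n m (arr s1 aGS) (arr s1 aGD) (arr s1 aCNT) {x. x < n \<and> arr s' aCNT x = 0})"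
      using s1 ag1 less by (intro terminates_attractor) (simp_all add: agree_reg m_def)
    then show "terminates (Seq attractor (For rj (Const 0) rn ?f)) s1 (51 + 120 * (n + m) + (10 + 30 * n)) ?post"
    proof (rule terminates_Seq)
      fix s2 :: state
      let ?Z = "{x. x < n \<and> arr s2 aCNT x = 0}"
      let ?S = "{v. v < n \<and> v \<notin> ?Z}"
      assume attr: "threshold_attractor n m (arr s1 aGS) (arr s1 aGD) (arr s1 aCNT) ?Z"
        and "agree (wregs attractor) (warrs attractor) s1 s2"
      then have ag12: "agree {rj, rsp, re, ry} {aHD, aNX, aSTK, aCNT} s1 s2" by simp
      have attr': "threshold_attractor n m (arr s aSR) (arr s aDT) ?c ?Z"
        using attr s1 by (subst threshold_attractor_cong[symmetric]) auto
      have owner: "arr s aOW v = (if v \<in> random P then 1 else 0)" if "v < n" for v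
        using holds_mdp_owner[OF P] that by (simp add: n_def)
      have c: "?c v = 0" if "v \<in> U" for v using that by simp
      have c_random: "?c v = 1" if "v < n" "v \<notin> U" "v \<in> random P" for v
        using that owner by simp
      have c_player: "?c v = card {e. e < m \<and> arr s aSR e = v}" if "v < n" "v \<notin> U" "v \<in> player1 P" for v
        using that owner[of v] E.not_player_and_random[of v] by simp
      note ax = attr' c c_random c_player
      have S1: "\<forall>X. end_component P X \<and> X \<inter> U = {} \<longrightarrow> X \<subseteq> ?S"
        using E.end_component_safe[where c="?c" and U=U, OF ax] by blast
      have S2: "\<forall>RP. (verts P, U) \<in> set RP \<longrightarrow> ?S \<subseteq> as_win P (Rabin RP)"
        using E.safe_subset_as_win[where c="?c" and U=U, OF ax] by blast
      have ag2: "agree {rj, rx, rN, rsp, re, ry} {aGS, aGD, aCNT, aHD, aNX, aSTK} s s2"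
        using ag1 ag12 by (auto simp: agree_def)
      let ?I = "\<lambda>i s'. \<forall>v. arr s' aMK v = (if v < i \<and> v \<in> ?S then 1 else arr s aMK v)"
      have "terminates (For rj (Const 0) rn ?f) s2 (10 + 30 * n) (?I n)"
      proof (rule terminates_For_run[where a=0 and b=n and I="?I"])
        fix i s' assume I: "?I i s'" and ag: "agree (insert rj (wregs ?f)) (warrs ?f) s2 s'"
          and i: "reg s' rj = i" "i < n"
        have "arr s' aCNT = arr s2 aCNT"
          using ag by (simp add: agree_arr)
        then show "?I (Suc i) ((run ?f s')\<lparr>reg := (reg (run ?f s'))(rj := Suc i)\<rparr>)"
          using I i by (auto simp: less_Suc_eq)
      qed (use ag2 in \<open>simp_all add: agree_reg agree_arr n_def\<close>)
      then show "terminates (For rj (Const 0) rn ?f) s2 (10 + 30 * n) ?post"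
      proof (rule terminates_conseq)
        fix s3 assume "?I n s3"
        then have "\<forall>v<n. arr s3 aMK v = (if v \<in> ?S then 1 else arr s aMK v)" by simp
        then show "?post s3" using S1 S2 by blast
      qed simp
    qed simp
  qed simp
  then show ?thesis
    by (rule terminates_conseq) (use nm in \<open>simp_all add: n_def m_def\<close>)
qed

end

section \<open>Saving the input and restricting it to end-components that avoid a set\<close>

text \<open>Send the self-loop of an absorbed vertex to one of its former edges. This is injective,
  because an absorbed vertex has only one edge left.\<close>

lemma card_edges_absorb:
  assumes P: "is_mdp P"
  shows "card (edges (absorb P U)) \<le> card (edges P)"
proof -
  have "\<exists>w. (v, w) \<in> edges P" if "v \<in> verts P" for v
    using P that unfolding is_mdp_def by blast
  then obtain f where f: "\<And>v. v \<in> verts P \<Longrightarrow> (v, f v) \<in> edges P" by metis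
  let ?h = "\<lambda>(v, w). if v \<in> U then (v, f v) else (v, w)"
  show ?thesis
  proof (rule card_inj_on_le)
    show "inj_on ?h (edges (absorb P U))"
      unfolding edges_absorb by (rule inj_onI) (auto split: if_splits)
    show "?h ` edges (absorb P U) \<subseteq> edges P"
      unfolding edges_absorb using f by auto
    have "finite (verts P \<times> verts P)" "edges P \<subseteq> verts P \<times> verts P"
      using P unfolding is_mdp_def by auto
    then show "finite (edges P)" by (rule finite_subset[rotated])
  qed
qed

context workspace
begin

text \<open>Every vertex has a successor, so no block is empty and the source advances by at most
  one from one edge to the next; a conditional is enough where empty blocks would require a
  loop.\<close>

definition find_sources :: com where
  "find_sources = Seq (Assign ry (Const 0)) (For rj (Const 0) rm
     (Seq (Cond (Eq (Reg rj) (Read aST (Plus (Reg ry) (Const 1)))) (Assign ry (Plus (Reg ry) (Const 1))) Skip)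
       (Write aSR (Reg rj) (Reg ry))))"

lemma find_sources_frame [simp]: "wregs find_sources = {rj, ry}" "warrs find_sources = {aSR}"
  by (auto simp: find_sources_def)

lemma terminates_find_sources:
  assumes st: "st = arr s aST" "st 0 = 0" "\<And>v. v < n \<Longrightarrow> st v < st (Suc v)"
    and n: "0 < n" and m: "reg s rm = st n"
  shows "terminates find_sources s (20 + 40 * st n)
    (\<lambda>s'. \<forall>e<st n. arr s' aSR e < n \<and> st (arr s' aSR e) \<le> e \<and> e < st (Suc (arr s' aSR e)))"
proof -
  let ?c = "Seq (Cond (Eq (Reg rj) (Read aST (Plus (Reg ry) (Const 1)))) (Assign ry (Plus (Reg ry) (Const 1))) Skip)
       (Write aSR (Reg rj) (Reg ry))"
  let ?s = "run (Assign ry (Const 0)) s"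
  let ?I = "\<lambda>i s'. reg s' ry < n \<and> st (reg s' ry) \<le> i \<and> i \<le> st (Suc (reg s' ry)) \<and>
    (\<forall>e<i. arr s' aSR e < n \<and> st (arr s' aSR e) \<le> e \<and> e < st (Suc (arr s' aSR e)))"
  have "terminates (For rj (Const 0) rm ?c) ?s (7 + 40 * st n) (?I (st n))"
  proof (rule terminates_For_run[where a=0 and b="st n" and I="?I"])
    fix i s' assume I: "?I i s'" and ag: "agree (insert rj (wregs ?c)) (warrs ?c) ?s s'"
      and i: "reg s' rj = i" "i < st n"
    have st': "arr s' aST = st" using ag st(1) by (simp add: agree_arr)
    let ?v = "reg s' ry"
    show "?I (Suc i) ((run ?c s')\<lparr>reg := (reg (run ?c s'))(rj := Suc i)\<rparr>)"
    proof (cases "i = st (Suc ?v)")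
      case True
      have "Suc ?v \<noteq> n" using True i(2) by auto
      then have "Suc ?v < n" using I by simp
      moreover from this have "i < st (Suc (Suc ?v))" using st(3)[of "Suc ?v"] True by simp
      ultimately show ?thesis using I True i(1) by (simp add: st' less_Suc_eq)
    next
      case False
      then show ?thesis using I i(1) by (simp add: st' less_Suc_eq)
    qed
  qed (use st n m in simp_all)
  then have "terminates (For rj (Const 0) rm ?c) ?s (7 + 40 * st n)
    (\<lambda>s'. \<forall>e<st n. arr s' aSR e < n \<and> st (arr s' aSR e) \<le> e \<and> e < st (Suc (arr s' aSR e)))"
    by (rule terminates_conseq) simp_all
  then show ?thesis
    unfolding find_sources_def by (rule terminates_Seq_run[rotated]) simp_all
qed

text \<open>The start array has \<open>n + 1\<close> cells, and its last one is the number of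
  edges.\<close>

definition save_mdp :: com where
  "save_mdp = Seq (Seq (Assign rn (Reg 0)) (Seq (Assign rm (Read 0 (Reg 0))) (Assign rx (Plus (Reg 0) (Const 1)))))
     (Seq (copy 0 aST rx) (Seq (copy 1 aDT rm) (Seq (copy 2 aOW rn) find_sources)))"

lemma save_mdp_frame [simp]: "wregs save_mdp = {rn, rm, rx, rj, ry}" "warrs save_mdp = {aST, aDT, aOW, aSR}"
  by (auto simp: save_mdp_def)

lemma terminates_save_mdp:
  assumes P: "is_mdp P" and s: "stores_mdp s P"
  shows "terminates save_mdp s (300 * card (edges P)) (\<lambda>s'. holds_mdp s' P \<and> reg s' rn = reg s 0)"
proof -
  define n st where "n = reg s 0" and "st = arr s 0"
  have verts: "verts P = {..<n}" and sets: "stores_sets st (arr s 1) (map (\<lambda>v. edges P `` {v}) [0..<n])"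
    and owner: "\<And>v. v < n \<Longrightarrow> arr s 2 v = (if v \<in> random P then 1 else 0)"
    using s by (simp_all add: stores_mdp_def n_def st_def)
  have E: "edges P \<subseteq> {..<n} \<times> UNIV"
    using P verts unfolding is_mdp_def by auto
  have n: "0 < n" using P verts unfolding is_mdp_def by auto
  have st0: "st 0 = 0" using sets by (simp add: stores_sets_def)
  have st_less: "st v < st (Suc v)" if "v < n" for v
  proof -
    have "v \<in> verts P" using verts that by simp
    then have "edges P `` {v} \<noteq> {}" using P unfolding is_mdp_def by simp
    then have "{st v..<st (Suc v)} \<noteq> {}"
      using stores_sets_nth(1)[OF sets, of v] that by auto
    then show ?thesis by simp
  qed
  let ?m = "st n"
  let ?s1 = "run (Seq (Assign rn (Reg 0)) (Seq (Assign rm (Read 0 (Reg 0))) (Assign rx (Plus (Reg 0) (Const 1))))) s"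
  let ?post = "\<lambda>s'. holds_mdp s' P \<and> reg s' rn = reg s 0 \<and> enumerated_mdp P n ?m (arr s' aSR) (arr s' aDT)"
  have r1: "reg ?s1 rn = n" "reg ?s1 rm = ?m" "reg ?s1 rx = Suc n" "arr ?s1 = arr s"
    by (simp_all add: n_def st_def)
  have "terminates (Seq (copy 0 aST rx) (Seq (copy 1 aDT rm) (Seq (copy 2 aOW rn) find_sources))) ?s1
    (60 + 30 * n + 60 * ?m) ?post"
  proof (rule terminates_Seq)
    show "terminates (copy 0 aST rx) ?s1 (20 + 13 * n) (\<lambda>s'. \<forall>j<Suc n. arr s' aST j = st j)"
      using terminates_copy[of rx 0 aST ?s1] unfolding r1 by (simp add: st_def)
    fix s2 assume c2: "\<forall>j<Suc n. arr s2 aST j = st j" and "agree (wregs (copy 0 aST rx)) (warrs (copy 0 aST rx)) ?s1 s2"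
    then have ag2: "agree {rj} {aST} ?s1 s2" by simp
    have r2: "reg s2 rn = n" "reg s2 rm = ?m" "arr s2 1 = arr s 1" "arr s2 2 = arr s 2"
      using agree_reg[OF ag2, of rn] agree_reg[OF ag2, of rm] agree_arr[OF ag2] r1 by simp_all
    show "terminates (Seq (copy 1 aDT rm) (Seq (copy 2 aOW rn) find_sources)) s2 (39 + 17 * n + 60 * ?m) ?post"
    proof (rule terminates_Seq)
      show "terminates (copy 1 aDT rm) s2 (7 + 13 * ?m) (\<lambda>s'. \<forall>j<?m. arr s' aDT j = arr s 1 j)"
        using terminates_copy[of rm 1 aDT s2] unfolding r2 by simp
      fix s3 assume c3: "\<forall>j<?m. arr s3 aDT j = arr s 1 j" and "agree (wregs (copy 1 aDT rm)) (warrs (copy 1 aDT rm)) s2 s3"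
      then have ag3: "agree {rj} {aDT} s2 s3" by simp
      have r3: "reg s3 rn = n" "reg s3 rm = ?m" "arr s3 2 = arr s 2" "arr s3 aST = arr s2 aST"
        using agree_reg[OF ag3] agree_arr[OF ag3] r2 by simp_all
      show "terminates (Seq (copy 2 aOW rn) find_sources) s3 (31 + 17 * n + 47 * ?m) ?post"
      proof (rule terminates_Seq)
        show "terminates (copy 2 aOW rn) s3 (7 + 13 * n) (\<lambda>s'. \<forall>j<n. arr s' aOW j = arr s 2 j)"
          using terminates_copy[of rn 2 aOW s3] unfolding r3 by simp
        fix s4 assume c4: "\<forall>j<n. arr s4 aOW j = arr s 2 j" and "agree (wregs (copy 2 aOW rn)) (warrs (copy 2 aOW rn)) s3 s4"
        then have ag4: "agree {rj} {aOW} s3 s4" by simp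
        have r4: "reg s4 rn = n" "reg s4 rm = ?m" "arr s4 aST = arr s2 aST" "arr s4 aDT = arr s3 aDT"
          using agree_reg[OF ag4] agree_arr[OF ag4] r3 by simp_all
        have st4: "arr s4 aST v = st v" if "v \<le> n" for v
          using c2 that r4(3) by (simp add: less_Suc_eq_le)
        have "terminates find_sources s4 (20 + 40 * arr s4 aST n) (\<lambda>s'. \<forall>e<arr s4 aST n.
          arr s' aSR e < n \<and> arr s4 aST (arr s' aSR e) \<le> e \<and> e < arr s4 aST (Suc (arr s' aSR e)))"
          using n st0 st_less r4(2) by (intro terminates_find_sources) (simp_all add: st4)
        then show "terminates find_sources s4 (20 + 40 * ?m) ?post"
        proof (rule terminates_conseq)
          fix s5 assume "\<forall>e<arr s4 aST n. arr s5 aSR e < n \<and> arr s4 aST (arr s5 aSR e) \<le> e \<and> e < arr s4 aST (Suc (arr s5 aSR e))"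
            and "agree (wregs find_sources) (warrs find_sources) s4 s5"
          then have src: "\<forall>e<arr s4 aST n. arr s5 aSR e < n \<and> arr s4 aST (arr s5 aSR e) \<le> e \<and> e < arr s4 aST (Suc (arr s5 aSR e))"
            and ag5: "agree {rj, ry} {aSR} s4 s5" by simp_all
          have r5: "reg s5 rn = n" "reg s5 rm = ?m" "arr s5 aST = arr s4 aST" "arr s5 aDT = arr s3 aDT" "arr s5 aOW = arr s4 aOW"
            using agree_reg[OF ag5] agree_arr[OF ag5] r4 by simp_all
          have sets5: "stores_sets (arr s4 aST) (arr s3 aDT) (map (\<lambda>v. edges P `` {v}) [0..<n])"
            using sets st4 c3 by (intro stores_sets_cong[OF sets]) simp_all
          have "bij_betw (\<lambda>e. (arr s5 aSR e, arr s3 aDT e)) {..<arr s4 aST n} (edges P)"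
            using sets5 E src by (rule stores_sets_enum)
          then have enum: "enumerated_mdp P n ?m (arr s5 aSR) (arr s3 aDT)"
            using P verts st4[of n] by unfold_locales simp_all
          have "?m = arr s4 aST n" using st4[of n] by simp
          moreover have "\<forall>e<?m. arr s5 aSR e < n \<and> arr s4 aST (arr s5 aSR e) \<le> e \<and> e < arr s4 aST (Suc (arr s5 aSR e))"
            using src st4[of n] by simp
          moreover have "\<forall>v<n. arr s4 aOW v = (if v \<in> random P then 1 else 0)"
            using c4 owner by simp
          ultimately have "holds_mdp s5 P"
            unfolding holds_mdp_def r5 using sets5 enum by blast
          then show "?post s5" using enum r5(1,4) by (simp add: n_def)
        qed (simp add: st4)
      qed simp
    qed simp
  qed simp
  then have "terminates save_mdp s (80 + 30 * n + 60 * ?m) ?post"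
    unfolding save_mdp_def by (rule terminates_Seq_run[rotated]) simp_all
  \<comment> \<open>The inequality between \<open>n\<close> and \<open>m\<close> comes from the
    enumeration in the final state, so the bound is simplified only after the execution has been
    obtained.\<close>
  then obtain t s' where ex: "exec save_mdp s t s'" "t \<le> 80 + 30 * n + 60 * ?m" "?post s'"
    unfolding terminates_def by blast
  interpret E: enumerated_mdp P n ?m "arr s' aSR" "arr s' aDT"
    using ex(3) by blast
  have "t \<le> 300 * card (edges P)"
    using ex(2) E.n_le_m E.n_pos unfolding E.card_edges by linarith
  then show ?thesis
    using ex unfolding terminates_def by blast
qed

section \<open>Saving the pairs and writing the restricted input\<close>

definition holds_pairs :: "state \<Rightarrow> nat rabin_pairs \<Rightarrow> bool" where
  "holds_pairs s RP \<longleftrightarrow> reg s rk = length RP \<and>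
     stores_sets (arr s aLS) (arr s aLD) (map fst RP) \<and> stores_sets (arr s aUS) (arr s aUD) (map snd RP)"

lemma holds_pairs_agree:
  assumes "holds_pairs s RP" "agree R A s s'" "rk \<notin> R" "{aLS, aLD, aUS, aUD} \<inter> A = {}"
  shows "holds_pairs s' RP"
  using assms unfolding holds_pairs_def agree_def by auto

text \<open>The start arrays are copied before the data, for their last cells tell how much data
  there is.\<close>

definition save_pairs :: com where
  "save_pairs = Seq (Seq (Assign rk (Reg 1)) (Assign rx (Plus (Reg 1) (Const 1))))
     (Seq (copy 3 aLS rx) (Seq (copy 5 aUS rx)
     (Seq (Assign rx (Read aLS (Reg rk))) (Seq (copy 4 aLD rx)
     (Seq (Assign rx (Read aUS (Reg rk))) (copy 6 aUD rx))))))"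

lemma save_pairs_frame [simp]: "wregs save_pairs = {rk, rx, rj}" "warrs save_pairs = {aLS, aLD, aUS, aUD}"
  by (auto simp: save_pairs_def)

lemma terminates_save_pairs:
  assumes s: "stores_pairs s RP" and RP: "is_rabin_pairs P RP" "verts P = {..<n}"
  shows "terminates save_pairs s (150 + 26 * length RP + 26 * (length RP * n)) (\<lambda>s'. holds_pairs s' RP)"
proof -
  define k where "k = length RP"
  have k: "reg s 1 = k" and L: "stores_sets (arr s 3) (arr s 4) (map fst RP)"
    and U: "stores_sets (arr s 5) (arr s 6) (map snd RP)"
    using s by (simp_all add: stores_pairs_def k_def)
  have sub: "card X \<le> n" if X: "X \<in> set (map fst RP) \<union> set (map snd RP)" for X
  proof -
    obtain L U where LU: "(L, U) \<in> set RP" "X = L \<or> X = U" using X by force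
    have "X \<subseteq> {..<n}" using bspec[OF RP(1)[unfolded is_rabin_pairs_def] LU(1)] LU(2) RP(2) by auto
    from card_mono[OF _ this] show ?thesis by simp
  qed
  have bL: "arr s 3 k \<le> k * n" using stores_sets_total[OF L sub, of k] by (simp add: k_def)
  have bU: "arr s 5 k \<le> k * n" using stores_sets_total[OF U sub, of k] by (simp add: k_def)
  let ?s1 = "run (Seq (Assign rk (Reg 1)) (Assign rx (Plus (Reg 1) (Const 1)))) s"
  have r1: "reg ?s1 rk = k" "reg ?s1 rx = Suc k" "arr ?s1 = arr s"
    using k by simp_all
  let ?post = "\<lambda>s'. holds_pairs s' RP"
  have "terminates (Seq (copy 3 aLS rx) (Seq (copy 5 aUS rx) (Seq (Assign rx (Read aLS (Reg rk))) (Seq (copy 4 aLD rx)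
     (Seq (Assign rx (Read aUS (Reg rk))) (copy 6 aUD rx)))))) ?s1 (110 + 26 * k + 26 * (k * n)) ?post"
  proof (rule terminates_Seq)
    show "terminates (copy 3 aLS rx) ?s1 (20 + 13 * k) (\<lambda>s'. \<forall>j<Suc k. arr s' aLS j = arr s 3 j)"
      using terminates_copy[of rx 3 aLS ?s1] unfolding r1 by simp
    fix s2 assume c2: "\<forall>j<Suc k. arr s2 aLS j = arr s 3 j" and "agree (wregs (copy 3 aLS rx)) (warrs (copy 3 aLS rx)) ?s1 s2"
    then have ag2: "agree {rj} {aLS} ?s1 s2" by simp
    have r2: "reg s2 rk = k" "reg s2 rx = Suc k" "arr s2 4 = arr s 4" "arr s2 5 = arr s 5" "arr s2 6 = arr s 6"
      using agree_reg[OF ag2, of rk] agree_reg[OF ag2, of rx] agree_arr[OF ag2] r1 by simp_all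
    show "terminates (Seq (copy 5 aUS rx) (Seq (Assign rx (Read aLS (Reg rk))) (Seq (copy 4 aLD rx)
     (Seq (Assign rx (Read aUS (Reg rk))) (copy 6 aUD rx))))) s2 (80 + 13 * k + 26 * (k * n)) ?post"
    proof (rule terminates_Seq)
      show "terminates (copy 5 aUS rx) s2 (20 + 13 * k) (\<lambda>s'. \<forall>j<Suc k. arr s' aUS j = arr s 5 j)"
        using terminates_copy[of rx 5 aUS s2] unfolding r2 by simp
      fix s3 assume c3: "\<forall>j<Suc k. arr s3 aUS j = arr s 5 j" and "agree (wregs (copy 5 aUS rx)) (warrs (copy 5 aUS rx)) s2 s3"
      then have ag3: "agree {rj} {aUS} s2 s3" by simp
      have r3: "reg s3 rk = k" "arr s3 4 = arr s 4" "arr s3 6 = arr s 6" "arr s3 aLS = arr s2 aLS"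
        using agree_reg[OF ag3] agree_arr[OF ag3] r2 by simp_all
      let ?s4 = "run (Assign rx (Read aLS (Reg rk))) s3"
      have r4: "reg ?s4 rx = arr s 3 k" using r3 c2 by simp
      have "terminates (Seq (copy 4 aLD rx) (Seq (Assign rx (Read aUS (Reg rk))) (copy 6 aUD rx))) ?s4 (30 + 26 * (k * n)) ?post"
      proof (rule terminates_Seq)
        show "terminates (copy 4 aLD rx) ?s4 (7 + 13 * (k * n)) (\<lambda>s'. \<forall>j<arr s 3 k. arr s' aLD j = arr s 4 j)"
          using terminates_conseq[OF terminates_copy[of rx 4 aLD ?s4, unfolded r4]] bL r3 by simp
        fix s5 assume c5: "\<forall>j<arr s 3 k. arr s5 aLD j = arr s 4 j" and "agree (wregs (copy 4 aLD rx)) (warrs (copy 4 aLD rx)) ?s4 s5"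
        then have ag5: "agree {rj} {aLD} ?s4 s5" by simp
        have r5: "reg s5 rk = k" "arr s5 6 = arr s 6" "arr s5 aLS = arr s2 aLS" "arr s5 aUS = arr s3 aUS"
          using agree_reg[OF ag5, of rk] agree_arr[OF ag5] r3 by simp_all
        let ?s6 = "run (Assign rx (Read aUS (Reg rk))) s5"
        have r6: "reg ?s6 rx = arr s 5 k" using r5 c3 by simp
        have "terminates (copy 6 aUD rx) ?s6 (7 + 13 * (k * n)) ?post"
        proof (rule terminates_conseq[OF terminates_copy[of rx 6 aUD ?s6, unfolded r6]])
          fix s7 assume c7: "\<forall>j<arr s 5 k. arr s7 aUD j = arr ?s6 6 j" and "agree (wregs (copy 6 aUD rx)) (warrs (copy 6 aUD rx)) ?s6 s7"
          then have ag7: "agree {rj} {aUD} ?s6 s7" by simp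
          have r7: "reg s7 rk = k" "arr s7 aLS = arr s2 aLS" "arr s7 aUS = arr s3 aUS" "arr s7 aLD = arr s5 aLD"
            using agree_reg[OF ag7, of rk] agree_arr[OF ag7] r5 by simp_all
          have "stores_sets (arr s2 aLS) (arr s5 aLD) (map fst RP)"
            using c2 c5 by (intro stores_sets_cong[OF L]) (simp_all add: less_Suc_eq_le k_def)
          moreover have "stores_sets (arr s3 aUS) (arr s7 aUD) (map snd RP)"
            using c3 c7 r5(2) by (intro stores_sets_cong[OF U]) (simp_all add: less_Suc_eq_le k_def)
          ultimately show "?post s7"
            unfolding holds_pairs_def r7 by (simp add: k_def)
        qed (use bU in simp_all)
        then show "terminates (Seq (Assign rx (Read aUS (Reg rk))) (copy 6 aUD rx)) s5 (15 + 13 * (k * n)) ?post"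
          by (rule terminates_Seq_run[rotated]) simp_all
      qed simp
      then show "terminates (Seq (Assign rx (Read aLS (Reg rk))) (Seq (copy 4 aLD rx)
     (Seq (Assign rx (Read aUS (Reg rk))) (copy 6 aUD rx)))) s3 (40 + 26 * (k * n)) ?post"
        by (rule terminates_Seq_run[rotated]) simp_all
    qed simp
  qed simp
  then show ?thesis
    unfolding save_pairs_def k_def[symmetric] by (rule terminates_Seq_run[rotated]) simp_all
qed

text \<open>Rebuilds an input for the MEC program in arrays 0 to 2, using prefix sums of the new
  block lengths, which are 1 for absorbed vertices. Register 0 and the owners are written again
  because earlier runs of the MEC program may have destroyed them.\<close>

definition restrict_mdp :: com where
  "restrict_mdp = Seq (Write 0 (Const 0) (Const 0))
     (Seq (For rj (Const 0) rn (Cond (Eq (Read aUM (Reg rj)) (Const 0))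
       (Write 0 (Plus (Reg rj) (Const 1))
         (Plus (Read 0 (Reg rj)) (Minus (Read aST (Plus (Reg rj) (Const 1))) (Read aST (Reg rj)))))
       (Write 0 (Plus (Reg rj) (Const 1)) (Plus (Read 0 (Reg rj)) (Const 1)))))
     (Seq (For rj (Const 0) rm (Cond (Eq (Read aUM (Read aSR (Reg rj))) (Const 0))
       (Write 1 (Plus (Read 0 (Read aSR (Reg rj))) (Minus (Reg rj) (Read aST (Read aSR (Reg rj))))) (Read aDT (Reg rj)))
       (Write 1 (Read 0 (Read aSR (Reg rj))) (Read aSR (Reg rj)))))
     (Seq (copy aOW 2 rn) (Assign 0 (Reg rn)))))"

lemma restrict_mdp_frame [simp]: "wregs restrict_mdp = {rj, 0}" "warrs restrict_mdp = {0, 1, 2}"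
  by (auto simp: restrict_mdp_def)

lemma terminates_restrict_mdp:
  assumes P: "holds_mdp s P" and U: "\<And>v. v < reg s rn \<Longrightarrow> arr s aUM v \<noteq> 0 \<longleftrightarrow> v \<in> U"
  shows "terminates restrict_mdp s (200 * reg s rm) (\<lambda>s'. stores_mdp s' (absorb P U))"
proof -
  define n m st src dst um where "n = reg s rn" and "m = reg s rm" and "st = arr s aST"
    and "src = arr s aSR" and "dst = arr s aDT" and "um = arr s aUM"
  interpret E: enumerated_mdp P n m src dst
    unfolding n_def m_def src_def dst_def by (rule holds_mdp_enum[OF P])
  have um: "um v = 0 \<longleftrightarrow> v \<notin> U" if "v < n" for v
    using U[of v] that by (auto simp: um_def n_def)
  have sets: "stores_sets st dst (map (\<lambda>v. edges P `` {v}) [0..<n])" and m: "m = st n"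
    and src: "\<And>e. e < m \<Longrightarrow> src e < n \<and> st (src e) \<le> e \<and> e < st (Suc (src e))"
    using P unfolding holds_mdp_def n_def m_def st_def src_def dst_def by blast+
  have mono: "st i \<le> st j" if "i \<le> j" "j \<le> n" for i j
    using stores_sets_mono[OF sets that(1)] that(2) by simp
  define len where "len v = (if v \<in> U then 1 else st (Suc v) - st v)" for v
  define st' where "st' v = (\<Sum>u<v. len u)" for v
  have st'_Suc: "st' (Suc v) = st' v + len v" for v by (simp add: st'_def)
  have mono': "st' i \<le> st' j" if "i \<le> j" for i j
    unfolding st'_def using that by (intro sum_mono2) auto
  \<comment> \<open>Edge \<open>e\<close> is written to the cell \<open>loc e\<close> with the
    content \<open>val e\<close>; all edges of an absorbed vertex go to its only cell.\<close>
  define loc where "loc e = st' (src e) + (if src e \<in> U then 0 else e - st (src e))" for e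
  define val where "val e = (if src e \<in> U then src e else dst e)" for e
  have loc: "st' (src e) \<le> loc e" "loc e < st' (Suc (src e))" if "e < m" for e
    using src[OF that] unfolding loc_def st'_Suc len_def by auto
  \<comment> \<open>Collisions occur only among the edges of one absorbed vertex, and these all
    write the same self-loop. No edge has to be singled out.\<close>
  have coll: "val e = val e'" if e: "e < m" "e' < m" "loc e = loc e'" for e e'
  proof -
    have se: "src e = src e'"
      using block_unique[where st=st' and n=n and e="loc e" and a="src e" and b="src e'"] mono'
        loc[OF e(1)] loc[OF e(2)] src[OF e(1)] src[OF e(2)] e(3) by simp
    show ?thesis
    proof (cases "src e \<in> U")
      case False
      then have "e - st (src e) = e' - st (src e)" using e(3) se by (simp add: loc_def)
      then have "e = e'" using src[OF e(1)] src[OF e(2)] se eq_diff_iff[of "st (src e)" e e'] by simp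
      then show ?thesis by simp
    qed (use se in \<open>simp add: val_def\<close>)
  qed
  have src_eq: "src e = v \<and> e < m" if "v < n" "st v \<le> e" "e < st (Suc v)" for e v
  proof -
    have "e < m" using mono[of "Suc v" n] that m by simp
    then show ?thesis
      using block_unique[where st=st and n=n and e=e and a="src e" and b=v, OF mono] src[of e] that by simp
  qed
  have new: "stores_sets b d (map (\<lambda>v. edges (absorb P U) `` {v}) [0..<n])"
    if b: "\<And>v. v \<le> n \<Longrightarrow> b v = st' v" and d: "\<And>e. e < m \<Longrightarrow> d (loc e) = val e" for b d
  proof -
    have "distinct (map d [b v..<b (Suc v)]) \<and> set (map d [b v..<b (Suc v)]) = edges (absorb P U) `` {v}"
      if v: "v < n" for v
    proof (cases "v \<in> U")
      case True
      \<comment> \<open>An absorbed vertex has at least one edge, so its only cell is indeed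
        written.\<close>
      obtain w where "(v, w) \<in> edges P" using E.ex_succ[OF v] by blast
      then obtain e where e: "e < m" "src e = v" by (auto elim!: E.edge_cases)
      have "d (st' v) = v" using d[OF e(1)] e(2) True by (simp add: loc_def val_def)
      moreover have "edges (absorb P U) `` {v} = {v}"
        using True v E.verts unfolding edges_absorb by auto
      moreover have "[b v..<b (Suc v)] = [st' v]"
        using b[of v] b[of "Suc v"] v True by (simp add: st'_Suc len_def)
      ultimately show ?thesis by simp
    next
      case False
      have le: "st v \<le> st (Suc v)" using mono[of v "Suc v"] v by simp
      have bS: "b (Suc v) = st' v + (st (Suc v) - st v)" "b v = st' v"
        using b[of v] b[of "Suc v"] v False by (simp_all add: st'_Suc len_def)
      have "map d [b v..<b (Suc v)] = map dst [st v..<st (Suc v)]"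
      proof (rule nth_equalityI)
        fix i assume "i < length (map d [b v..<b (Suc v)])"
        then have i: "i < st (Suc v) - st v" by (simp add: bS)
        have e: "src (st v + i) = v \<and> st v + i < m"
          using src_eq[OF v, of "st v + i"] i by simp
        then have "d (st' v + i) = dst (st v + i)"
          using d[of "st v + i"] False by (simp add: loc_def val_def)
        then show "map d [b v..<b (Suc v)] ! i = map dst [st v..<st (Suc v)] ! i"
          using i by (simp add: bS)
      qed (simp add: bS)
      moreover have "distinct (map dst [st v..<st (Suc v)])" "set (map dst [st v..<st (Suc v)]) = edges P `` {v}"
        using sets v unfolding stores_sets_def by auto
      moreover have "edges (absorb P U) `` {v} = edges P `` {v}"
        using False unfolding edges_absorb by auto
      ultimately show ?thesis by simp
    qed
    moreover have "b v \<le> b (Suc v)" if "v < n" for v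
      using b[of v] b[of "Suc v"] mono'[of v "Suc v"] that by simp
    ultimately show ?thesis
      using b[of 0] unfolding stores_sets_def by (simp add: st'_def)
  qed
  let ?c = "Cond (Eq (Read aUM (Reg rj)) (Const 0))
       (Write 0 (Plus (Reg rj) (Const 1))
         (Plus (Read 0 (Reg rj)) (Minus (Read aST (Plus (Reg rj) (Const 1))) (Read aST (Reg rj)))))
       (Write 0 (Plus (Reg rj) (Const 1)) (Plus (Read 0 (Reg rj)) (Const 1)))"
  let ?d = "Cond (Eq (Read aUM (Read aSR (Reg rj))) (Const 0))
       (Write 1 (Plus (Read 0 (Read aSR (Reg rj))) (Minus (Reg rj) (Read aST (Read aSR (Reg rj))))) (Read aDT (Reg rj)))
       (Write 1 (Read 0 (Read aSR (Reg rj))) (Read aSR (Reg rj)))"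
  let ?s1 = "run (Write 0 (Const 0) (Const 0)) s"
  let ?post = "\<lambda>s'. stores_mdp s' (absorb P U)"
  have "terminates (Seq (For rj (Const 0) rn ?c) (Seq (For rj (Const 0) rm ?d) (Seq (copy aOW 2 rn) (Assign 0 (Reg rn)))))
    ?s1 (50 + 60 * n + 50 * m) ?post"
  proof (rule terminates_Seq)
    let ?I = "\<lambda>i s'. \<forall>v\<le>i. arr s' 0 v = st' v"
    show "terminates (For rj (Const 0) rn ?c) ?s1 (7 + 40 * n) (?I n)"
    proof (rule terminates_For_run[where a=0 and b=n and I="?I"])
      fix i s' assume I: "?I i s'" and ag: "agree (insert rj (wregs ?c)) (warrs ?c) ?s1 s'"
        and i: "reg s' rj = i" "i < n"
      have ag': "agree {rj} {0} ?s1 s'" using ag by simp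
      have same: "arr s' aUM = um" "arr s' aST = st"
        using agree_arr[OF ag'] by (simp_all add: um_def st_def)
      show "?I (Suc i) ((run ?c s')\<lparr>reg := (reg (run ?c s'))(rj := Suc i)\<rparr>)"
        using I i um[OF i(2)] by (simp add: same le_Suc_eq st'_Suc len_def)
    qed (simp_all add: n_def st'_def)
    fix s2 assume I2: "?I n s2" and "agree (wregs (For rj (Const 0) rn ?c)) (warrs (For rj (Const 0) rn ?c)) ?s1 s2"
    then have ag12: "agree {rj} {0} ?s1 s2" by simp
    have ag2: "agree {rj} {0} s s2" using ag12 by (auto simp: agree_def)
    let ?J = "\<lambda>i s'. \<forall>e<i. arr s' 1 (loc e) = val e"
    show "terminates (Seq (For rj (Const 0) rm ?d) (Seq (copy aOW 2 rn) (Assign 0 (Reg rn)))) s2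
      (40 + 20 * n + 50 * m) ?post"
    proof (rule terminates_Seq)
      show "terminates (For rj (Const 0) rm ?d) s2 (7 + 50 * m) (?J m)"
      proof (rule terminates_For_run[where a=0 and b=m and I="?J"])
        fix i s' assume J: "?J i s'" and ag: "agree (insert rj (wregs ?d)) (warrs ?d) s2 s'"
          and i: "reg s' rj = i" "i < m"
        have ag': "agree {rj} {1} s2 s'" using ag by simp
        have same: "arr s' aUM = um" "arr s' aST = st" "arr s' aSR = src" "arr s' aDT = dst" "arr s' 0 = arr s2 0"
          using agree_arr[OF ag'] agree_arr[OF ag2] by (simp_all add: um_def st_def src_def dst_def)
        have "arr s2 0 (src i) = st' (src i)" using I2 src[OF i(2)] by simp
        then have wr: "arr (run ?d s') 1 = (arr s' 1)(loc i := val i)"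
          using um[of "src i"] src[OF i(2)] i(1) by (simp add: same loc_def val_def)
        have "((arr s' 1)(loc i := val i)) (loc e) = val e" if e: "e < Suc i" for e
        proof (cases "loc e = loc i")
          case True
          then show ?thesis using coll[of e i] e i(2) by simp
        next
          case False
          then have "e < i" using e by (auto simp: less_Suc_eq)
          then show ?thesis using J False by simp
        qed
        then show "?J (Suc i) ((run ?d s')\<lparr>reg := (reg (run ?d s'))(rj := Suc i)\<rparr>)"
          by (simp add: wr del: run.simps fun_upd_apply One_nat_def)
      qed (use agree_reg[OF ag2] in \<open>simp_all add: m_def\<close>)
      fix s3 assume J3: "?J m s3" and "agree (wregs (For rj (Const 0) rm ?d)) (warrs (For rj (Const 0) rm ?d)) s2 s3"
      then have ag23: "agree {rj} {1} s2 s3" by simp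
      have r3: "arr s3 0 = arr s2 0" "reg s3 rn = n" "arr s3 aOW = arr s aOW"
        using agree_arr[OF ag23] agree_reg[OF ag23] agree_arr[OF ag2] agree_reg[OF ag2] by (simp_all add: n_def)
      show "terminates (Seq (copy aOW 2 rn) (Assign 0 (Reg rn))) s3 (20 + 20 * n) ?post"
      proof (rule terminates_Seq)
        show "terminates (copy aOW 2 rn) s3 (7 + 13 * n) (\<lambda>s'. \<forall>j<n. arr s' 2 j = arr s aOW j)"
          using terminates_copy[of rn aOW 2 s3] unfolding r3 by simp
        fix s4 assume c4: "\<forall>j<n. arr s4 2 j = arr s aOW j" and "agree (wregs (copy aOW 2 rn)) (warrs (copy aOW 2 rn)) s3 s4"
        then have ag4: "agree {rj} {2} s3 s4" by simp
        have r4: "arr s4 0 = arr s2 0" "reg s4 rn = n" "arr s4 1 = arr s3 1"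
          using agree_arr[OF ag4] agree_reg[OF ag4] r3 by simp_all
        have "stores_sets (arr s2 0) (arr s3 1) (map (\<lambda>v. edges (absorb P U) `` {v}) [0..<n])"
          using I2 J3 by (intro new) simp_all
        moreover have "arr s4 2 v = (if v \<in> random P then 1 else 0)" if "v < n" for v
          using c4 that holds_mdp_owner[OF P, of v] by (simp add: n_def)
        ultimately have "?post (run (Assign 0 (Reg rn)) s4)"
          using E.verts by (simp add: stores_mdp_def r4 del: One_nat_def)
        then show "terminates (Assign 0 (Reg rn)) s4 2 ?post"
          by (rule terminates_run[rotated 2]) simp_all
      qed simp
    qed simp
  qed simp
  then have "terminates restrict_mdp s (60 + 60 * n + 50 * m) ?post"
    unfolding restrict_mdp_def by (rule terminates_Seq_run[rotated]) simp_all
  then show ?thesis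
    by (rule terminates_conseq) (use E.n_le_m E.n_pos in \<open>simp_all add: m_def[symmetric]\<close>)
qed

end

section \<open>The algorithms\<close>

context enumerated_mdp
begin

lemma is_mec_labelling_cong:
  assumes "\<And>v. v < n \<Longrightarrow> lab v = lab' v"
  shows "is_mec_labelling lab \<longleftrightarrow> is_mec_labelling lab'"
proof -
  have "{v. v < n \<and> lab v = l} = {v. v < n \<and> lab' v = l}" for l using assms by auto
  moreover have "lab ` {..<n} = lab' ` {..<n}" using assms by auto
  ultimately show ?thesis
    unfolding is_mec_labelling_def using assms by simp
qed

lemma returns_mecs_iff: "returns_mecs s P \<longleftrightarrow> is_mec_labelling (arr s 7)"
  unfolding returns_mecs_def is_mec_labelling_def verts by (simp add: Ball_def)

text \<open>With nothing to avoid, a whole MEC wins as soon as it contains a vertex of some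
  \<open>L\<close>.\<close>

lemma buchi_marks:
  assumes lab: "is_mec_labelling lab" and RP: "is_rabin_pairs P RP" "\<forall>(L, U)\<in>set RP. U = {}"
    and mk: "\<And>v. v < n \<Longrightarrow> mk v \<longleftrightarrow> (\<exists>(L, U)\<in>set RP. v \<in> L)"
  shows "v < n \<Longrightarrow> mk v \<Longrightarrow> lab v \<noteq> 0 \<Longrightarrow> v \<in> as_win P (Rabin RP)"
    and "winning_ec P RP X \<Longrightarrow> u \<in> X \<Longrightarrow> \<exists>v<n. mk v \<and> lab v = lab u"
proof -
  assume v: "v < n" "mk v" "lab v \<noteq> 0"
  let ?X = "{u. u < n \<and> lab u = lab v}"
  obtain L U where LU: "(L, U) \<in> set RP" "v \<in> L" using mk[OF v(1)] v(2) by blast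
  have "U = {}" using RP(2) LU(1) by blast
  moreover have "v \<in> L \<inter> ?X" using v LU by simp
  ultimately have "winning_ec P RP ?X"
    unfolding winning_ec_def using label_class_end_component[OF lab v(1,3)] LU(1) by blast
  then show "v \<in> as_win P (Rabin RP)"
    using winning_ec_subset_as_win[OF mdp] v(1) by blast
next
  assume X: "winning_ec P RP X" "u \<in> X"
  obtain L U v where LU: "(L, U) \<in> set RP" "v \<in> L" "v \<in> X" "end_component P X"
    using X(1) unfolding winning_ec_def by blast
  have "v < n" using LU(3,4) verts unfolding end_component_def by blast
  moreover have "mk v" using mk[OF \<open>v < n\<close>] LU(1,2) by blast
  moreover have "lab v = lab u" using end_component_label[OF lab LU(4) LU(3) X(2)] by simp
  ultimately show "\<exists>v<n. mk v \<and> lab v = lab u" by blast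
qed

end

lemma card_edges_ge_1:
  assumes "is_mdp P"
  shows "1 \<le> card (edges P)"
proof -
  have "finite (verts P \<times> verts P)" "edges P \<subseteq> verts P \<times> verts P"
    using assms unfolding is_mdp_def by auto
  then have "finite (edges P)" by (rule finite_subset[rotated])
  moreover have "edges P \<noteq> {}" using assms unfolding is_mdp_def by auto
  ultimately have "0 < card (edges P)" by (simp add: card_gt_0_iff)
  then show ?thesis by simp
qed

lemma returns_mecs_nonzero:
  assumes P: "is_mdp P" and s: "returns_mecs s P" and v: "v \<in> verts P"
  shows "arr s 7 v \<noteq> 0 \<longleftrightarrow> (\<exists>X. end_component P X \<and> v \<in> X)"
proof
  assume "arr s 7 v \<noteq> 0"
  then have "{u \<in> verts P. arr s 7 u = arr s 7 v} \<in> mecs P"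
    using s v unfolding returns_mecs_def by blast
  then have "end_component P {u \<in> verts P. arr s 7 u = arr s 7 v}" by (simp add: mecs_def)
  then show "\<exists>X. end_component P X \<and> v \<in> X" using v by blast
next
  assume "\<exists>X. end_component P X \<and> v \<in> X"
  then obtain X where X: "end_component P X" "v \<in> X" by blast
  obtain Y where "Y \<in> mecs P" "X \<subseteq> Y" using end_component_in_mec[OF P X(1)] .
  moreover then obtain l where "Y = {v \<in> verts P. arr s 7 v = l}" "l \<noteq> 0"
    using s unfolding returns_mecs_def by blast
  ultimately show "arr s 7 v \<noteq> 0" using X(2) by auto
qed

section \<open>Preparation, output and loops over the pairs\<close>

locale mec_program = workspace D for D :: nat +
  fixes M :: com and T :: "nat \<Rightarrow> nat \<Rightarrow> nat"
  assumes M: "computes_mecs_in M T"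
    and fresh: "\<And>x. x \<in> wregs M \<union> warrs M \<Longrightarrow> x < D"
begin

lemma fresh_add [simp]: "D + j \<notin> wregs M" "D + j \<notin> warrs M"
  using fresh[of "D + j"] by auto

lemma terminates_M:
  assumes "is_mdp P" "stores_mdp s P" "card (verts P) \<le> n" "card (edges P) \<le> m"
  shows "terminates M s (T n m) (\<lambda>s'. returns_mecs s' P)"
  using M assms unfolding computes_mecs_in_def terminates_def by blast

definition ready :: "state \<Rightarrow> nat mdp \<Rightarrow> bool" where
  "ready s P \<longleftrightarrow> holds_mdp s P \<and> enumerated_mdp.is_mec_labelling P (card (verts P)) (arr s aLAB) \<and>
     reg s rn = card (verts P) \<and> reg s rm = card (edges P)"

lemma ready_agree:
  assumes "ready s P" "agree R A s s'" "{rn, rm} \<inter> R = {}" "{aST, aDT, aOW, aSR, aLAB} \<inter> A = {}"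
  shows "ready s' P"
proof -
  have "holds_mdp s' P" using assms by (intro holds_mdp_agree[of s P R A s']) (auto simp: ready_def)
  moreover have "reg s' rn = reg s rn" "reg s' rm = reg s rm" "arr s' aLAB = arr s aLAB"
    using assms(2-4) by (auto simp: agree_def)
  ultimately show ?thesis using assms(1) by (simp add: ready_def)
qed

definition prepare :: com where
  "prepare = Seq save_mdp (Seq M (copy 7 aLAB rn))"

lemma prepare_frame [simp]:
  "wregs prepare = {rn, rm, rx, rj, ry} \<union> wregs M" "warrs prepare = {aST, aDT, aOW, aSR, aLAB} \<union> warrs M"
  by (auto simp: prepare_def)

lemma holds_mdp_sizes:
  assumes "holds_mdp s P"
  shows "reg s rn = card (verts P)" "reg s rm = card (edges P)"
proof -
  interpret E: enumerated_mdp P "reg s rn" "reg s rm" "arr s aSR" "arr s aDT"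
    by (rule holds_mdp_enum[OF assms])
  show "reg s rn = card (verts P)" "reg s rm = card (edges P)"
    using E.card_edges E.verts by simp_all
qed

lemma mdp_sizes:
  assumes "holds_mdp s P"
  shows "card (verts P) \<le> card (edges P)" "1 \<le> card (edges P)"
proof -
  interpret E: enumerated_mdp P "reg s rn" "reg s rm" "arr s aSR" "arr s aDT"
    by (rule holds_mdp_enum[OF assms])
  show "card (verts P) \<le> card (edges P)" "1 \<le> card (edges P)"
    using E.n_le_m E.n_pos holds_mdp_sizes[OF assms] by linarith+
qed

lemma stores_mdp_agree:
  assumes "stores_mdp s P" "agree R A s s'" "0 \<notin> R" "{0, 1, 2} \<inter> A = {}"
  shows "stores_mdp s' P"
proof -
  have eqs: "reg s' 0 = reg s 0" "arr s' 0 = arr s 0" "arr s' 1 = arr s 1" "arr s' 2 = arr s 2"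
    using assms(2-4) by (auto simp: agree_def)
  show ?thesis using assms(1) unfolding stores_mdp_def eqs .
qed

lemma terminates_prepare:
  assumes P: "is_mdp P" and s: "stores_mdp s P"
  shows "terminates prepare s (400 * card (edges P) + mdp_time T P) (\<lambda>s'. ready s' P)"
proof -
  let ?n = "card (verts P)" and ?m = "card (edges P)"
  have "terminates prepare s (300 * ?m + (20 + 13 * ?n + mdp_time T P)) (\<lambda>s'. ready s' P)"
    unfolding prepare_def
  proof (rule terminates_Seq[OF terminates_save_mdp[OF P s]])
    fix s1 assume s1: "holds_mdp s1 P \<and> reg s1 rn = reg s 0" and "agree (wregs save_mdp) (warrs save_mdp) s s1"
    then have ag1: "agree {rn, rm, rx, rj, ry} {aST, aDT, aOW, aSR} s s1" by simp
    have "stores_mdp s1 P" using s ag1 by (rule stores_mdp_agree) simp_all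
    then have "terminates M s1 (mdp_time T P) (\<lambda>s'. returns_mecs s' P)"
      unfolding mdp_time_def by (rule terminates_M[OF P]) simp_all
    then show "terminates (Seq M (copy 7 aLAB rn)) s1 (mdp_time T P + (8 + 13 * ?n)) (\<lambda>s'. ready s' P)"
    proof (rule terminates_Seq)
      fix s2 assume m2: "returns_mecs s2 P" and ag2: "agree (wregs M) (warrs M) s1 s2"
      have h2: "holds_mdp s2 P" using s1 ag2 by (intro holds_mdp_agree[of s1 P _ _ s2]) auto
      then show "terminates (copy 7 aLAB rn) s2 (7 + 13 * ?n) (\<lambda>s'. ready s' P)"
      proof (intro terminates_conseq[OF terminates_copy])
        fix s3 assume c3: "\<forall>j<reg s2 rn. arr s3 aLAB j = arr s2 7 j"
          and "agree (wregs (copy 7 aLAB rn)) (warrs (copy 7 aLAB rn)) s2 s3"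
        then have ag3: "agree {rj} {aLAB} s2 s3" by simp
        have h3: "holds_mdp s3 P" using h2 ag3 by (intro holds_mdp_agree[of s2 P _ _ s3]) auto
        interpret E: enumerated_mdp P "reg s3 rn" "reg s3 rm" "arr s3 aSR" "arr s3 aDT"
          by (rule holds_mdp_enum[OF h3])
        have "reg s3 rn = reg s2 rn" using agree_reg[OF ag3] by simp
        then have "E.is_mec_labelling (arr s3 aLAB) \<longleftrightarrow> E.is_mec_labelling (arr s2 7)"
          using c3 by (intro E.is_mec_labelling_cong) simp
        then show "ready s3 P"
          using m2 E.returns_mecs_iff h3 unfolding ready_def holds_mdp_sizes[OF h3, symmetric] by blast
      qed (simp_all add: holds_mdp_sizes)
    qed simp
  qed simp
  then obtain t s' where ex: "exec prepare s t s'" "t \<le> 300 * ?m + (20 + 13 * ?n + mdp_time T P)" "ready s' P"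
    unfolding terminates_def by blast
  have "?n \<le> ?m" "1 \<le> ?m" using mdp_sizes ex(3) unfolding ready_def by blast+
  then have "t \<le> 400 * ?m + mdp_time T P" using ex(2) by linarith
  then show ?thesis using ex unfolding terminates_def by blast
qed

definition write_result :: com where
  "write_result = copy aRES 7 rn"

lemma write_result_frame [simp]: "wregs write_result = {rj}" "warrs write_result = {7}"
  by (simp_all add: write_result_def)

lemma terminates_write_result:
  assumes "ready s P" "\<And>v. v < reg s rn \<Longrightarrow> arr s aRES v = (if v \<in> W then 1 else 0)"
  shows "terminates write_result s (7 + 13 * reg s rn) (\<lambda>s'. returns_set s' P W)"
  unfolding write_result_def
proof (intro terminates_conseq[OF terminates_copy])
  interpret E: enumerated_mdp P "reg s rn" "reg s rm" "arr s aSR" "arr s aDT"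
    using assms(1) holds_mdp_enum unfolding ready_def by blast
  fix s' :: state assume "\<forall>j<reg s rn. arr s' 7 j = arr s aRES j"
  then show "returns_set s' P W"
    using assms(2) unfolding returns_set_def E.verts by simp
qed simp_all

definition finish :: com where
  "finish = Seq (fill aRES rn) (Seq reach write_result)"

lemma finish_frame [simp]:
  "wregs finish = {rj, rN, rsp, re, ry}" "warrs finish = {7, aGRP, aGS, aGD, aCNT, aHD, aNX, aSTK, aRES}"
  by (auto simp: finish_def)

lemma terminates_finish:
  assumes s: "ready s P"
    and "\<And>v. v < reg s rn \<Longrightarrow> arr s aMK v \<noteq> 0 \<Longrightarrow> arr s aLAB v \<noteq> 0 \<Longrightarrow> v \<in> as_win P (Rabin RP)"
    and "\<And>X u. winning_ec P RP X \<Longrightarrow> u \<in> X \<Longrightarrow> \<exists>v<reg s rn. arr s aMK v \<noteq> 0 \<and> arr s aLAB v = arr s aLAB u"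
  shows "terminates finish s (1600 * card (edges P)) (\<lambda>s'. returns_set s' P (win_objective P RP))"
proof -
  have h: "holds_mdp s P" using s by (simp add: ready_def)
  let ?n = "reg s rn" and ?m = "reg s rm"
  have "terminates finish s (20 + 25 * ?n + 1500 * ?m) (\<lambda>s'. returns_set s' P (win_objective P RP))"
    unfolding finish_def
  proof (rule terminates_Seq[OF terminates_fill])
    fix s1 assume f1: "\<forall>j<reg s rn. arr s1 aRES j = 0" and "agree (wregs (fill aRES rn)) (warrs (fill aRES rn)) s s1"
    then have ag1: "agree {rj} {aRES} s s1" by simp
    have rd1: "ready s1 P" using s ag1 by (rule ready_agree) simp_all
    have r1: "reg s1 rn = ?n" "reg s1 rm = ?m" "arr s1 aMK = arr s aMK" "arr s1 aLAB = arr s aLAB"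
      using agree_reg[OF ag1] agree_arr[OF ag1] by simp_all
    have "terminates reach s1 (1500 * reg s1 rm) (\<lambda>s'. \<forall>v<reg s1 rn.
      arr s' aRES v = (if v \<in> as_win P (Rabin RP) then 1 else arr s1 aRES v))"
      using rd1 assms(2,3) by (intro terminates_reach) (simp_all add: ready_def r1)
    then show "terminates (Seq reach write_result) s1 (8 + 13 * ?n + 1500 * ?m) (\<lambda>s'. returns_set s' P (win_objective P RP))"
    proof (rule terminates_Seq)
      fix s2 assume c2: "\<forall>v<reg s1 rn. arr s2 aRES v = (if v \<in> as_win P (Rabin RP) then 1 else arr s1 aRES v)"
        and "agree (wregs reach) (warrs reach) s1 s2"
      then have ag2: "agree {rj, rN, rsp, re, ry} {aGRP, aGS, aGD, aCNT, aHD, aNX, aSTK, aRES} s1 s2" by simp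
      have rd2: "ready s2 P" using rd1 ag2 by (rule ready_agree) simp_all
      have "reg s2 rn = ?n" using agree_reg[OF ag2] r1 by simp
      then show "terminates write_result s2 (7 + 13 * ?n) (\<lambda>s'. returns_set s' P (win_objective P RP))"
        using terminates_write_result[OF rd2, of "win_objective P RP"] c2 f1 r1 by (simp add: win_objective_def)
    qed (simp add: r1)
  qed simp_all
  then show ?thesis
    by (rule terminates_conseq) (use mdp_sizes[OF h] holds_mdp_sizes[OF h] in simp_all)
qed

definition start :: com where
  "start = Seq save_pairs prepare"

lemma start_frame [simp]:
  "wregs start = {rk, rx, rj, rn, rm, ry} \<union> wregs M"
  "warrs start = {aLS, aLD, aUS, aUD, aST, aDT, aOW, aSR, aLAB} \<union> warrs M"
  by (auto simp: start_def)

lemma terminates_start: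
  assumes P: "is_mdp P" "is_rabin_pairs P RP" and s: "stores_mdp s P" "stores_pairs s RP"
  shows "terminates start s (600 * card (edges P) + 60 * (length RP * card (edges P)) + mdp_time T P)
    (\<lambda>s'. ready s' P \<and> holds_pairs s' RP)"
proof -
  let ?n = "card (verts P)" and ?m = "card (edges P)" and ?k = "length RP"
  have verts: "verts P = {..<reg s 0}" using s(1) by (simp add: stores_mdp_def)
  then have n: "reg s 0 = ?n" by simp
  have "terminates start s (151 + 26 * ?k + 26 * (?k * ?n) + (400 * ?m + mdp_time T P))
    (\<lambda>s'. ready s' P \<and> holds_pairs s' RP)"
    unfolding start_def
  proof (rule terminates_Seq[OF terminates_save_pairs[OF s(2) P(2) verts]])
    fix s1 assume p1: "holds_pairs s1 RP" and "agree (wregs save_pairs) (warrs save_pairs) s s1"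
    then have ag1: "agree {rk, rx, rj} {aLS, aLD, aUS, aUD} s s1" by simp
    have "stores_mdp s1 P" using s(1) ag1 by (rule stores_mdp_agree) simp_all
    from terminates_prepare[OF P(1) this]
    show "terminates prepare s1 (400 * ?m + mdp_time T P) (\<lambda>s'. ready s' P \<and> holds_pairs s' RP)"
    proof (rule terminates_conseq)
      fix s2 assume "ready s2 P" "agree (wregs prepare) (warrs prepare) s1 s2"
      then show "ready s2 P \<and> holds_pairs s2 RP"
        using p1 by (auto elim!: holds_pairs_agree)
    qed simp
  qed (simp add: n)
  then obtain t s' where ex: "exec start s t s'" "t \<le> 151 + 26 * ?k + 26 * (?k * ?n) + (400 * ?m + mdp_time T P)"
      "ready s' P \<and> holds_pairs s' RP"
    unfolding terminates_def by blast
  have nm: "?n \<le> ?m" "1 \<le> ?m" using mdp_sizes ex(3) unfolding ready_def by blast+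
  have "?k * ?n \<le> ?k * ?m" "?k * 1 \<le> ?k * ?m" using nm by (intro mult_left_mono; simp)+
  then have "t \<le> 600 * ?m + 60 * (?k * ?m) + mdp_time T P" using ex(2) nm by linarith
  then show ?thesis using ex unfolding terminates_def by blast
qed

text \<open>The answer is a union of winning sets, so each pair gets its own final attractor and the
  results accumulate in \<open>aRES\<close>.\<close>

definition query :: "com \<Rightarrow> com" where
  "query c = Seq start (Seq (fill aRES rn) (Seq (For ri (Const 0) rk c) write_result))"

lemma terminates_query:
  assumes P: "is_mdp P" "is_rabin_pairs P RP" and s: "stores_mdp s P" "stores_pairs s RP"
    and frame: "{rn, rm, rk, ri} \<inter> wregs c = {}"
      "{aST, aDT, aOW, aSR, aLAB, aLS, aLD, aUS, aUD} \<inter> warrs c = {}"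
    and body: "\<And>s. ready s P \<Longrightarrow> holds_pairs s RP \<Longrightarrow> reg s ri < length RP \<Longrightarrow>
      terminates c s (B * card (edges P)) (\<lambda>s'. \<forall>v<reg s rn.
        arr s' aRES v = (if v \<in> as_win P (Rabin [RP ! reg s ri]) then 1 else arr s aRES v))"
  shows "terminates (query c) s (700 * card (edges P) + (70 + B) * (length RP * card (edges P)) + mdp_time T P)
    (\<lambda>s'. returns_set s' P (win_query P RP))"
  unfolding query_def
proof (rule terminates_Seq[OF terminates_start[OF P s]])
  let ?n = "card (verts P)" and ?m = "card (edges P)" and ?k = "length RP"
  fix s1 assume s1: "ready s1 P \<and> holds_pairs s1 RP"
  then have h1: "holds_mdp s1 P" by (simp add: ready_def)
  note sizes = holds_mdp_sizes[OF h1]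
  have nm: "?n \<le> ?m" "1 \<le> ?m" by (rule mdp_sizes[OF h1])+
  have km: "?k \<le> ?k * ?m" using nm(2) by simp
  let ?post = "\<lambda>s'. returns_set s' P (win_query P RP)"
  have "terminates (Seq (fill aRES rn) (Seq (For ri (Const 0) rk c) write_result)) s1
    (30 + 26 * ?n + ?k * (B * ?m + 9)) ?post"
  proof (rule terminates_Seq[OF terminates_fill])
    fix s2 assume f2: "\<forall>j<reg s1 rn. arr s2 aRES j = 0" and "agree (wregs (fill aRES rn)) (warrs (fill aRES rn)) s1 s2"
    then have ag2: "agree {rj} {aRES} s1 s2" by simp
    have rd2: "ready s2 P" using ag2 by (rule ready_agree[OF conjunct1[OF s1]]) simp_all
    have hp2: "holds_pairs s2 RP" using ag2 by (rule holds_pairs_agree[OF conjunct2[OF s1]]) simp_all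
    have r2: "reg s2 rn = ?n" "reg s2 rk = ?k"
      using rd2 hp2 by (simp_all add: ready_def holds_pairs_def)
    let ?I = "\<lambda>i s'. \<forall>v<?n. arr s' aRES v = (if \<exists>j<i. v \<in> as_win P (Rabin [RP ! j]) then 1 else 0)"
    have "terminates (For ri (Const 0) rk c) s2 (7 + ?k * (B * ?m + 9)) (?I ?k)"
    proof (rule terminates_For[where a=0 and b="?k" and I="?I" and t="B * ?m"])
      fix i s' assume I: "?I i s'" and ag: "agree (insert ri (wregs c)) (warrs c) s2 s'"
        and i: "reg s' ri = i" "i < ?k"
      have rd: "ready s' P" using rd2 ag by (rule ready_agree) (use frame in auto)
      have hp: "holds_pairs s' RP" using hp2 ag by (rule holds_pairs_agree) (use frame in auto)
      have n': "reg s' rn = ?n" using rd by (simp add: ready_def)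
      from body[OF rd hp, unfolded i(1) n', OF i(2)]
      show "terminates c s' (B * ?m) (\<lambda>s''. reg s'' ri = i \<and> ?I (Suc i) (s''\<lparr>reg := (reg s'')(ri := Suc i)\<rparr>))"
      proof (rule terminates_conseq)
        fix s'' assume c: "\<forall>v<?n. arr s'' aRES v = (if v \<in> as_win P (Rabin [RP ! i]) then 1 else arr s' aRES v)"
          and ag': "agree (wregs c) (warrs c) s' s''"
        have "reg s'' ri = i" using agree_reg[OF ag', of ri] frame(1) i(1) by auto
        moreover have "(\<exists>j<Suc i. v \<in> as_win P (Rabin [RP ! j])) \<longleftrightarrow>
            v \<in> as_win P (Rabin [RP ! i]) \<or> (\<exists>j<i. v \<in> as_win P (Rabin [RP ! j]))" for v
          by (auto simp: less_Suc_eq)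
        ultimately show "reg s'' ri = i \<and> ?I (Suc i) (s''\<lparr>reg := (reg s'')(ri := Suc i)\<rparr>)"
          using c I by simp blast
      qed simp
    qed (use r2 f2 frame sizes in auto)
    then show "terminates (Seq (For ri (Const 0) rk c) write_result) s2 (18 + 13 * ?n + ?k * (B * ?m + 9)) ?post"
    proof (rule terminates_Seq)
      fix s3 assume c3: "?I ?k s3" and "agree (wregs (For ri (Const 0) rk c)) (warrs (For ri (Const 0) rk c)) s2 s3"
      then have ag3: "agree (insert ri (wregs c)) (warrs c) s2 s3" by simp
      have rd3: "ready s3 P" using rd2 ag3 by (rule ready_agree) (use frame in auto)
      have n3: "reg s3 rn = ?n" using rd3 by (simp add: ready_def)
      show "terminates write_result s3 (7 + 13 * ?n) ?post"
        using terminates_write_result[OF rd3, of "win_query P RP", unfolded n3] c3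
        by (simp add: win_query_def Bex_def)
    qed simp
  qed (simp_all add: sizes)
  then show "terminates (Seq (fill aRES rn) (Seq (For ri (Const 0) rk c) write_result)) s1
    (90 * ?m + (10 + B) * (?k * ?m)) ?post"
  proof (rule terminates_conseq)
    have eqs: "?k * (B * ?m + 9) = B * (?k * ?m) + 9 * ?k" "(10 + B) * (?k * ?m) = 10 * (?k * ?m) + B * (?k * ?m)"
      by (simp_all add: algebra_simps)
    have "30 + 26 * ?n + (x + 9 * ?k) \<le> 90 * ?m + (10 * y + x)" if "?k \<le> y" for x y
      using nm that by linarith
    from this[OF km] show "30 + 26 * ?n + ?k * (B * ?m + 9) \<le> 90 * ?m + (10 + B) * (?k * ?m)"
      unfolding eqs .
  qed
qed (use card_edges_ge_1[OF P(1)] in \<open>simp add: algebra_simps\<close>)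

text \<open>Unlike in a query, the marks of all pairs are collected first and followed by one final
  attractor: player 1 may win the disjunction by satisfying different pairs on different plays, so a
  union of winning sets would be too small.\<close>

definition objective :: "com \<Rightarrow> com" where
  "objective c = Seq start (Seq (fill aMK rn) (Seq (For ri (Const 0) rk c) finish))"

text \<open>\<open>G j S\<close> says that \<open>S\<close> is an admissible set of marks for pair
  \<open>j\<close>. It is a relation since the program for coBuechi pairs is specified by two
  inclusions only; completeness must therefore hold for every admissible \<open>S\<close>.\<close>

lemma terminates_objective:
  assumes P: "is_mdp P" "is_rabin_pairs P RP" and s: "stores_mdp s P" "stores_pairs s RP"
    and frame: "{rn, rm, rk, ri} \<inter> wregs c = {}"
      "{aST, aDT, aOW, aSR, aLAB, aLS, aLD, aUS, aUD} \<inter> warrs c = {}"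
    and body: "\<And>s. ready s P \<Longrightarrow> holds_pairs s RP \<Longrightarrow> reg s ri < length RP \<Longrightarrow>
      terminates c s t (\<lambda>s'. \<exists>S. G (reg s ri) S \<and>
        (\<forall>v<reg s rn. arr s' aMK v = (if v \<in> S then 1 else arr s aMK v)))"
    and sound: "\<And>j S. j < length RP \<Longrightarrow> G j S \<Longrightarrow> S \<subseteq> as_win P (Rabin RP)"
    and complete: "\<And>X. winning_ec P RP X \<Longrightarrow> \<exists>j<length RP. \<forall>S. G j S \<longrightarrow> S \<inter> X \<noteq> {}"
  shows "terminates (objective c) s (2300 * card (edges P) + 70 * (length RP * card (edges P)) +
      length RP * t + mdp_time T P) (\<lambda>s'. returns_set s' P (win_objective P RP))"
  unfolding objective_def
proof (rule terminates_Seq[OF terminates_start[OF P s]])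
  let ?n = "card (verts P)" and ?m = "card (edges P)" and ?k = "length RP"
  fix s1 assume s1: "ready s1 P \<and> holds_pairs s1 RP"
  then have h1: "holds_mdp s1 P" by (simp add: ready_def)
  note sizes = holds_mdp_sizes[OF h1]
  have nm: "?n \<le> ?m" "1 \<le> ?m" by (rule mdp_sizes[OF h1])+
  have km: "?k \<le> ?k * ?m" using nm(2) by simp
  let ?post = "\<lambda>s'. returns_set s' P (win_objective P RP)"
  have "terminates (Seq (fill aMK rn) (Seq (For ri (Const 0) rk c) finish)) s1
    (30 + 12 * ?n + 1600 * ?m + ?k * (t + 9)) ?post"
  proof (rule terminates_Seq[OF terminates_fill])
    fix s2 assume f2: "\<forall>j<reg s1 rn. arr s2 aMK j = 0" and "agree (wregs (fill aMK rn)) (warrs (fill aMK rn)) s1 s2"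
    then have ag2: "agree {rj} {aMK} s1 s2" by simp
    have rd2: "ready s2 P" using ag2 by (rule ready_agree[OF conjunct1[OF s1]]) simp_all
    have hp2: "holds_pairs s2 RP" using ag2 by (rule holds_pairs_agree[OF conjunct2[OF s1]]) simp_all
    have r2: "reg s2 rn = ?n" "reg s2 rk = ?k"
      using rd2 hp2 by (simp_all add: ready_def holds_pairs_def)
    \<comment> \<open>The family \<open>S\<close> records the sets marked in earlier rounds; each
      round extends it by one update.\<close>
    let ?I = "\<lambda>i s'. \<exists>S. (\<forall>j<i. G j (S j)) \<and> (\<forall>v<?n. arr s' aMK v = (if \<exists>j<i. v \<in> S j then 1 else 0))"
    have "terminates (For ri (Const 0) rk c) s2 (7 + ?k * (t + 9)) (?I ?k)"
    proof (rule terminates_For[where a=0 and b="?k" and I="?I" and t=t])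
      fix i s' assume I: "?I i s'" and ag: "agree (insert ri (wregs c)) (warrs c) s2 s'"
        and i: "reg s' ri = i" "i < ?k"
      have rd: "ready s' P" using rd2 ag by (rule ready_agree) (use frame in auto)
      have hp: "holds_pairs s' RP" using hp2 ag by (rule holds_pairs_agree) (use frame in auto)
      have n': "reg s' rn = ?n" using rd by (simp add: ready_def)
      from body[OF rd hp, unfolded i(1) n', OF i(2)]
      show "terminates c s' t (\<lambda>s''. reg s'' ri = i \<and> ?I (Suc i) (s''\<lparr>reg := (reg s'')(ri := Suc i)\<rparr>))"
      proof (rule terminates_conseq)
        fix s'' assume "\<exists>S. G i S \<and> (\<forall>v<?n. arr s'' aMK v = (if v \<in> S then 1 else arr s' aMK v))"
          and ag': "agree (wregs c) (warrs c) s' s''"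
        then obtain S' where S': "G i S'" "\<forall>v<?n. arr s'' aMK v = (if v \<in> S' then 1 else arr s' aMK v)" by blast
        obtain S where S: "\<forall>j<i. G j (S j)" "\<forall>v<?n. arr s' aMK v = (if \<exists>j<i. v \<in> S j then 1 else 0)"
          using I by blast
        have "reg s'' ri = i" using agree_reg[OF ag', of ri] frame(1) i(1) by auto
        moreover have "(\<exists>j<Suc i. v \<in> (S(i := S')) j) \<longleftrightarrow> v \<in> S' \<or> (\<exists>j<i. v \<in> S j)" for v
          by (auto simp: less_Suc_eq)
        moreover have "\<forall>j<Suc i. G j ((S(i := S')) j)" using S(1) S'(1) by (simp add: less_Suc_eq)
        ultimately show "reg s'' ri = i \<and> ?I (Suc i) (s''\<lparr>reg := (reg s'')(ri := Suc i)\<rparr>)"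
          using S(2) S'(2) by (intro conjI exI[of _ "S(i := S')"]) (simp_all del: fun_upd_apply, blast)
      qed simp
    qed (use r2 f2 frame sizes in auto)
    then show "terminates (Seq (For ri (Const 0) rk c) finish) s2 (10 + 1600 * ?m + ?k * (t + 9)) ?post"
    proof (rule terminates_Seq)
      fix s3 assume c3: "?I ?k s3" and "agree (wregs (For ri (Const 0) rk c)) (warrs (For ri (Const 0) rk c)) s2 s3"
      then have ag3: "agree (insert ri (wregs c)) (warrs c) s2 s3" by simp
      have rd3: "ready s3 P" using rd2 ag3 by (rule ready_agree) (use frame in auto)
      have n3: "reg s3 rn = ?n" using rd3 by (simp add: ready_def)
      interpret E: enumerated_mdp P ?n "reg s3 rm" "arr s3 aSR" "arr s3 aDT"
        using rd3 holds_mdp_enum[of s3 P] n3 unfolding ready_def by simp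
      have lab: "E.is_mec_labelling (arr s3 aLAB)" using rd3 n3 by (simp add: ready_def)
      obtain S where S: "\<forall>j<?k. G j (S j)" "\<forall>v<?n. arr s3 aMK v = (if \<exists>j<?k. v \<in> S j then 1 else 0)"
        using c3 by blast
      show "terminates finish s3 (1600 * ?m) ?post"
      proof (rule terminates_finish[OF rd3])
        fix v assume "v < reg s3 rn" "arr s3 aMK v \<noteq> 0"
        then have "\<exists>j<?k. v \<in> S j" using S(2) n3 by (auto split: if_splits)
        then show "v \<in> as_win P (Rabin RP)" using sound S(1) by blast
      next
        fix X u assume X: "winning_ec P RP X" "u \<in> X"
        then have ec: "end_component P X" by (simp add: winning_ec_def)
        obtain j v where j: "j < ?k" "v \<in> S j" "v \<in> X" using complete[OF X(1)] S(1) by blast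
        have "v < ?n" using j(3) ec E.verts unfolding end_component_def by blast
        moreover from this have "arr s3 aMK v \<noteq> 0" using S(2) j by auto
        moreover have "arr s3 aLAB v = arr s3 aLAB u"
          using E.end_component_label[OF lab ec j(3) X(2)] by simp
        ultimately show "\<exists>v<reg s3 rn. arr s3 aMK v \<noteq> 0 \<and> arr s3 aLAB v = arr s3 aLAB u"
          unfolding n3 by blast
      qed
    qed simp
  qed (simp_all add: sizes)
  then show "terminates (Seq (fill aMK rn) (Seq (For ri (Const 0) rk c) finish)) s1
    (1690 * ?m + 10 * (?k * ?m) + ?k * t) ?post"
  proof (rule terminates_conseq)
    have "?k * (t + 9) = ?k * t + 9 * ?k" by (simp add: algebra_simps)
    then show "30 + 12 * ?n + 1600 * ?m + ?k * (t + 9) \<le> 1690 * ?m + 10 * (?k * ?m) + ?k * t"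
      using nm km by linarith
  qed
qed (use card_edges_ge_1[OF P(1)] in \<open>simp add: algebra_simps\<close>)

end

text \<open>As the blocks adjoin each other, one sweep over the data visits the union of all sets
  without looking at their boundaries.\<close>

lemma stores_sets_Union:
  assumes "stores_sets st dt Xs"
  shows "dt ` {0..<st (length Xs)} = \<Union>(set Xs)" "st (length Xs) = sum_list (map card Xs)"
proof -
  have "i \<le> length Xs \<Longrightarrow> dt ` {0..<st i} = (\<Union>j<i. Xs ! j) \<and> st i = (\<Sum>j<i. card (Xs ! j))" for i
  proof (induction i)
    case 0
    then show ?case using assms by (simp add: stores_sets_def)
  next
    case (Suc i)
    then have i: "i < length Xs" by simp
    note X = stores_sets_nth[OF assms i]
    have IH: "dt ` {0..<st i} = (\<Union>j<i. Xs ! j)" "st i = (\<Sum>j<i. card (Xs ! j))"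
      using Suc.IH[OF Suc_leD[OF Suc.prems]] by blast+
    have "{0..<st (Suc i)} = {0..<st i} \<union> {st i..<st (Suc i)}" using X(3) by auto
    then have "dt ` {0..<st (Suc i)} = (\<Union>j<i. Xs ! j) \<union> Xs ! i"
      by (simp only: image_Un X(1) IH(1))
    moreover have "st (Suc i) = (\<Sum>j<i. card (Xs ! j)) + card (Xs ! i)"
      using X(2,3) IH(2) by linarith
    ultimately show ?case by (simp add: lessThan_Suc Un_commute)
  qed
  from this[OF order_refl]
  have *: "dt ` {0..<st (length Xs)} = (\<Union>j<length Xs. Xs ! j)" "st (length Xs) = (\<Sum>j<length Xs. card (Xs ! j))"
    by blast+
  have "set Xs = (!) Xs ` {..<length Xs}" by (auto simp: set_conv_nth)
  then show "dt ` {0..<st (length Xs)} = \<Union>(set Xs)" using *(1) by (simp only:)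
  show "st (length Xs) = sum_list (map card Xs)"
    using *(2) by (simp add: sum_list_sum_nth atLeast0LessThan)
qed

text \<open>The sizes of an MDP satisfy n \<le> m \<le> n^2, as every vertex has a successor and
  edges are pairs of vertices, so the lower bound on \<open>T\<close> applies.\<close>

lemma linear_time:
  assumes "at_least_linear T"
  obtains C where "\<And>P :: nat mdp. is_mdp P \<Longrightarrow> card (edges P) \<le> C * mdp_time T P"
proof -
  obtain c :: real where c: "c > 0" "\<And>n m. n \<le> m \<Longrightarrow> m \<le> n ^ 2 \<Longrightarrow> c * real m \<le> real (T n m)"
    using assms unfolding at_least_linear_def by blast
  have "card (edges P) \<le> nat \<lceil>1 / c\<rceil> * mdp_time T P" if P: "is_mdp P" for P :: "nat mdp"
  proof -
    have fin: "finite (verts P)" and E: "edges P \<subseteq> verts P \<times> verts P"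
      and succ: "\<And>v. v \<in> verts P \<Longrightarrow> edges P `` {v} \<noteq> {}"
      using P unfolding is_mdp_def by auto
    have finE: "finite (edges P)" using E fin by (meson finite_SigmaI finite_subset)
    have "verts P \<subseteq> fst ` edges P" using succ by force
    then have 1: "card (verts P) \<le> card (edges P)"
      using card_mono[OF finite_imageI[OF finE]] card_image_le[OF finE, of fst] order_trans by blast
    have 2: "card (edges P) \<le> card (verts P) ^ 2"
      using card_mono[OF _ E] fin by (simp add: card_cartesian_product power2_eq_square)
    have "real (card (edges P)) \<le> 1 / c * real (mdp_time T P)"
      using c(2)[OF 1 2] c(1) by (simp add: mdp_time_def field_simps)
    also have "\<dots> \<le> real (nat \<lceil>1 / c\<rceil>) * real (mdp_time T P)"
      using c(1) by (intro mult_right_mono real_nat_ceiling_ge) simp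
    finally show ?thesis by (simp only: of_nat_mult[symmetric] of_nat_le_iff)
  qed
  then show thesis using that by blast
qed

section \<open>Programs for a single pair and for all Buechi pairs at once\<close>

context mec_program
begin

lemma pair_nth:
  assumes "is_rabin_pairs P RP" "i < length RP"
  shows "fst (RP ! i) \<subseteq> verts P" "snd (RP ! i) \<subseteq> verts P"
  using assms bspec[OF assms(1)[unfolded is_rabin_pairs_def] nth_mem[OF assms(2)]] by auto

text \<open>The marks are cleared for every pair while \<open>aRES\<close> is not, since a query
  combines winning sets and not marks.\<close>

definition buchi_body :: com where
  "buchi_body = Seq (fill aMK rn) (Seq (scatter aLS aLD aMK 1) reach)"

lemma terminates_buchi_body:
  assumes RP: "is_rabin_pairs P RP" "\<forall>(L, U)\<in>set RP. U = {}"
    and s: "ready s P" "holds_pairs s RP" "reg s ri < length RP"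
  shows "terminates buchi_body s (1600 * card (edges P)) (\<lambda>s'. \<forall>v<reg s rn.
    arr s' aRES v = (if v \<in> as_win P (Rabin [RP ! reg s ri]) then 1 else arr s aRES v))"
proof -
  define i where "i = reg s ri"
  have h: "holds_mdp s P" using s(1) by (simp add: ready_def)
  let ?n = "card (verts P)" and ?m = "card (edges P)"
  have n: "reg s rn = ?n" "reg s rm = ?m" using holds_mdp_sizes[OF h] by simp_all
  have "finite (verts P)" using enumerated_mdp.mdp[OF holds_mdp_enum[OF h]] by (simp add: is_mdp_def)
  then have L: "card (fst (RP ! i)) \<le> ?n"
    unfolding i_def by (rule card_mono[OF _ pair_nth(1)[OF RP(1) s(3)]])
  have "terminates buchi_body s (30 + 25 * ?n + 1500 * ?m) (\<lambda>s'. \<forall>v<?n.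
      arr s' aRES v = (if v \<in> as_win P (Rabin [RP ! i]) then 1 else arr s aRES v))"
    unfolding buchi_body_def
  proof (rule terminates_Seq[OF terminates_fill])
    fix s1 assume f1: "\<forall>j<reg s rn. arr s1 aMK j = 0" and "agree (wregs (fill aMK rn)) (warrs (fill aMK rn)) s s1"
    then have ag1: "agree {rj} {aMK} s s1" by simp
    have rd1: "ready s1 P" using s(1) ag1 by (rule ready_agree) simp_all
    have hp1: "holds_pairs s1 RP" using s(2) ag1 by (rule holds_pairs_agree) simp_all
    have i1: "reg s1 ri = i" using agree_reg[OF ag1] by (simp add: i_def)
    have "terminates (scatter aLS aLD aMK 1) s1 (20 + 13 * card (map fst RP ! reg s1 ri))
      (\<lambda>s'. \<forall>x. arr s' aMK x = (if x \<in> map fst RP ! reg s1 ri then 1 else arr s1 aMK x))"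
      using hp1 s(3) by (intro terminates_scatter) (simp_all add: holds_pairs_def i1 i_def)
    then show "terminates (Seq (scatter aLS aLD aMK 1) reach) s1 (22 + 13 * ?n + 1500 * ?m) (\<lambda>s'. \<forall>v<?n.
      arr s' aRES v = (if v \<in> as_win P (Rabin [RP ! i]) then 1 else arr s aRES v))"
    proof (rule terminates_Seq)
      fix s2 assume "\<forall>x. arr s2 aMK x = (if x \<in> map fst RP ! reg s1 ri then 1 else arr s1 aMK x)"
        and "agree (wregs (scatter aLS aLD aMK 1)) (warrs (scatter aLS aLD aMK 1)) s1 s2"
      then have c2: "\<And>x. arr s2 aMK x = (if x \<in> fst (RP ! i) then 1 else arr s1 aMK x)"
        and ag2: "agree {rx, rj} {aMK} s1 s2" using s(3) by (simp_all add: i1 i_def)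
      have rd2: "ready s2 P" using rd1 ag2 by (rule ready_agree) simp_all
      have n2: "reg s2 rn = ?n" "reg s2 rm = ?m" and lab: "enumerated_mdp.is_mec_labelling P ?n (arr s2 aLAB)"
        using rd2 by (simp_all add: ready_def)
      have res: "arr s2 aRES = arr s aRES" using agree_arr[OF ag2] agree_arr[OF ag1] by simp
      interpret E: enumerated_mdp P ?n ?m "arr s2 aSR" "arr s2 aDT"
        using rd2 holds_mdp_enum[of s2 P] n2 unfolding ready_def by simp
      have mk: "arr s2 aMK v \<noteq> 0 \<longleftrightarrow> (\<exists>(L, U)\<in>set [RP ! i]. v \<in> L)" if "v < ?n" for v
        using c2[of v] f1 that n(1) by (cases "RP ! i") simp
      have "RP ! i \<in> set RP" using s(3) unfolding i_def by (rule nth_mem)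
      then have RPi: "is_rabin_pairs P [RP ! i]" "\<forall>(L, U)\<in>set [RP ! i]. U = {}"
        using RP unfolding is_rabin_pairs_def by auto
      have "terminates reach s2 (1500 * reg s2 rm) (\<lambda>s'. \<forall>v<reg s2 rn.
        arr s' aRES v = (if v \<in> as_win P (Rabin [RP ! i]) then 1 else arr s2 aRES v))"
      proof (rule terminates_reach)
        show "holds_mdp s2 P" using rd2 by (simp add: ready_def)
        show "enumerated_mdp.is_mec_labelling P (reg s2 rn) (arr s2 aLAB)" using lab n2 by simp
        show "v \<in> as_win P (Rabin [RP ! i])" if "v < reg s2 rn" "arr s2 aMK v \<noteq> 0" "arr s2 aLAB v \<noteq> 0" for v
          using E.buchi_marks(1)[OF lab RPi mk] that n2 by simp
        show "\<exists>v<reg s2 rn. arr s2 aMK v \<noteq> 0 \<and> arr s2 aLAB v = arr s2 aLAB u" if "winning_ec P [RP ! i] X" "u \<in> X" for X u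
          using E.buchi_marks(2)[OF lab RPi mk that] n2 by simp
      qed
      then show "terminates reach s2 (1500 * ?m) (\<lambda>s'. \<forall>v<?n.
        arr s' aRES v = (if v \<in> as_win P (Rabin [RP ! i]) then 1 else arr s aRES v))"
        unfolding n2 res .
    qed (use L s(3) in \<open>simp add: i1 i_def\<close>)
  qed (simp_all add: n)
  then show ?thesis
    unfolding i_def[symmetric] n(1) by (rule terminates_conseq) (use mdp_sizes[OF h] in simp_all)
qed

definition cobuchi_body :: com where
  "cobuchi_body = Seq (fill aMK rn) (Seq safe reach)"

lemma terminates_cobuchi_body:
  assumes RP: "is_rabin_pairs P RP" "\<forall>(L, U)\<in>set RP. L = verts P"
    and s: "ready s P" "holds_pairs s RP" "reg s ri < length RP"
  shows "terminates cobuchi_body s (3100 * card (edges P)) (\<lambda>s'. \<forall>v<reg s rn.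
    arr s' aRES v = (if v \<in> as_win P (Rabin [RP ! reg s ri]) then 1 else arr s aRES v))"
proof -
  define i where "i = reg s ri"
  have h: "holds_mdp s P" using s(1) by (simp add: ready_def)
  let ?n = "card (verts P)" and ?m = "card (edges P)" and ?U = "snd (RP ! i)"
  have n: "reg s rn = ?n" "reg s rm = ?m" using holds_mdp_sizes[OF h] by simp_all
  have "RP ! i \<in> set RP" using s(3) unfolding i_def by (rule nth_mem)
  from bspec[OF RP(2) this] have RPi: "RP ! i = (verts P, ?U)"
    by (simp add: case_prod_beta prod_eq_iff)
  let ?post = "\<lambda>s'. \<forall>v<?n. arr s' aRES v = (if v \<in> as_win P (Rabin [RP ! i]) then 1 else arr s aRES v)"
  have "terminates cobuchi_body s (10 + 12 * ?n + 3000 * ?m) ?post"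
    unfolding cobuchi_body_def
  proof (rule terminates_Seq[OF terminates_fill])
    fix s1 assume f1: "\<forall>j<reg s rn. arr s1 aMK j = 0" and "agree (wregs (fill aMK rn)) (warrs (fill aMK rn)) s s1"
    then have ag1: "agree {rj} {aMK} s s1" by simp
    have rd1: "ready s1 P" using s(1) ag1 by (rule ready_agree) simp_all
    have hp1: "holds_pairs s1 RP" using s(2) ag1 by (rule holds_pairs_agree) simp_all
    have i1: "reg s1 ri = i" using agree_reg[OF ag1] by (simp add: i_def)
    have n1: "reg s1 rn = ?n" "reg s1 rm = ?m" using rd1 by (simp_all add: ready_def)
    have "terminates safe s1 (1500 * reg s1 rm) (\<lambda>s'. \<exists>S.
      (\<forall>X. end_component P X \<and> X \<inter> ?U = {} \<longrightarrow> X \<subseteq> S) \<and>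
      (\<forall>RP. (verts P, ?U) \<in> set RP \<longrightarrow> S \<subseteq> as_win P (Rabin RP)) \<and>
      (\<forall>v<reg s1 rn. arr s' aMK v = (if v \<in> S then 1 else arr s1 aMK v)))"
      using hp1 rd1 s(3) pair_nth(2)[OF RP(1) s(3)]
      by (intro terminates_safe[where Us="map snd RP"]) (simp_all add: holds_pairs_def ready_def i1 i_def)
    then show "terminates (Seq safe reach) s1 (1 + 3000 * ?m) ?post"
    proof (rule terminates_Seq)
      fix s2 assume "\<exists>S. (\<forall>X. end_component P X \<and> X \<inter> ?U = {} \<longrightarrow> X \<subseteq> S) \<and>
        (\<forall>RP. (verts P, ?U) \<in> set RP \<longrightarrow> S \<subseteq> as_win P (Rabin RP)) \<and>
        (\<forall>v<reg s1 rn. arr s2 aMK v = (if v \<in> S then 1 else arr s1 aMK v))"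
        and "agree (wregs safe) (warrs safe) s1 s2"
      then obtain S where S: "\<And>X. end_component P X \<Longrightarrow> X \<inter> ?U = {} \<Longrightarrow> X \<subseteq> S"
          "\<And>RP. (verts P, ?U) \<in> set RP \<Longrightarrow> S \<subseteq> as_win P (Rabin RP)"
          "\<And>v. v < ?n \<Longrightarrow> arr s2 aMK v = (if v \<in> S then 1 else arr s1 aMK v)"
        and ag2: "agree {rj, rx, rN, rsp, re, ry} {aGS, aGD, aCNT, aHD, aNX, aSTK, aMK} s1 s2"
        using n1 by auto
      have rd2: "ready s2 P" using rd1 ag2 by (rule ready_agree) simp_all
      have n2: "reg s2 rn = ?n" "reg s2 rm = ?m" using rd2 by (simp_all add: ready_def)
      have res: "arr s2 aRES = arr s aRES" using agree_arr[OF ag2] agree_arr[OF ag1] by simp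
      interpret E: enumerated_mdp P ?n ?m "arr s2 aSR" "arr s2 aDT"
        using rd2 holds_mdp_enum[of s2 P] n2 unfolding ready_def by simp
      have mk: "arr s2 aMK v \<noteq> 0 \<longleftrightarrow> v \<in> S" if "v < ?n" for v
        using S(3)[OF that] f1 that n(1) by simp
      have "terminates reach s2 (1500 * reg s2 rm) (\<lambda>s'. \<forall>v<reg s2 rn.
        arr s' aRES v = (if v \<in> as_win P (Rabin [RP ! i]) then 1 else arr s2 aRES v))"
      proof (rule terminates_reach)
        show "holds_mdp s2 P" "enumerated_mdp.is_mec_labelling P (reg s2 rn) (arr s2 aLAB)"
          using rd2 n2 by (simp_all add: ready_def)
        show "v \<in> as_win P (Rabin [RP ! i])" if "v < reg s2 rn" "arr s2 aMK v \<noteq> 0" for v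
        proof -
          have "v \<in> S" using mk that n2 by simp
          moreover have "(verts P, ?U) \<in> set [RP ! i]" using RPi by simp
          ultimately show ?thesis using S(2) by blast
        qed
        show "\<exists>v<reg s2 rn. arr s2 aMK v \<noteq> 0 \<and> arr s2 aLAB v = arr s2 aLAB u"
          if X: "winning_ec P [RP ! i] X" "u \<in> X" for X u
        proof -
          have ec: "end_component P X" and "X \<inter> ?U = {}"
            using X(1) unfolding winning_ec_def by (auto simp: Int_commute)
          then have "u \<in> S" using S(1) X(2) by blast
          moreover have "u < ?n" using ec X(2) E.verts unfolding end_component_def by blast
          ultimately show ?thesis using mk n2 by auto
        qed
      qed
      then show "terminates reach s2 (1500 * ?m) ?post"
        unfolding n2 res .
    qed (simp add: n1)
  qed (simp_all add: n)
  then show ?thesis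
    unfolding i_def[symmetric] n(1) by (rule terminates_conseq) (use mdp_sizes[OF h] in simp_all)
qed

text \<open>An absorbed vertex is an end-component on its own and hence has a nonzero label in the
  restricted MDP; the test on \<open>aUM\<close> excludes it.\<close>

definition mark_good :: com where
  "mark_good = Seq (Assign rx (Read aLS (Plus (Reg ri) (Const 1))))
     (For rj (Read aLS (Reg ri)) rx
       (Cond (Conj (Eq (Read aUM (Read aLD (Reg rj))) (Const 0)) (Neg (Eq (Read 7 (Read aLD (Reg rj))) (Const 0))))
         (Write aMK (Read aLD (Reg rj)) (Const 1)) Skip))"

lemma mark_good_frame [simp]: "wregs mark_good = {rx, rj}" "warrs mark_good = {aMK}"
  by (auto simp: mark_good_def)

lemma terminates_mark_good:
  assumes sets: "stores_sets (arr s aLS) (arr s aLD) Xs" "reg s ri < length Xs"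
  shows "terminates mark_good s (20 + 40 * card (Xs ! reg s ri))
    (\<lambda>s'. \<forall>x. arr s' aMK x = (if x \<in> Xs ! reg s ri \<and> arr s aUM x = 0 \<and> arr s 7 x \<noteq> 0 then 1 else arr s aMK x))"
proof -
  let ?c = "Cond (Conj (Eq (Read aUM (Read aLD (Reg rj))) (Const 0)) (Neg (Eq (Read 7 (Read aLD (Reg rj))) (Const 0))))
         (Write aMK (Read aLD (Reg rj)) (Const 1)) Skip"
  let ?lo = "arr s aLS (reg s ri)" and ?hi = "arr s aLS (Suc (reg s ri))"
  note X = stores_sets_nth[OF sets]
  let ?s = "run (Assign rx (Read aLS (Plus (Reg ri) (Const 1)))) s"
  let ?I = "\<lambda>i s'. \<forall>x. arr s' aMK x =
    (if x \<in> arr s aLD ` {?lo..<i} \<and> arr s aUM x = 0 \<and> arr s 7 x \<noteq> 0 then 1 else arr s aMK x)"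
  have "terminates (For rj (Read aLS (Reg ri)) rx ?c) ?s (10 + 40 * (?hi - ?lo)) (?I ?hi)"
  proof (rule terminates_For_run[where a="?lo" and b="?hi" and I="?I"])
    fix i s' assume I: "?I i s'" and ag: "agree (insert rj (wregs ?c)) (warrs ?c) ?s s'"
      and i: "reg s' rj = i" "?lo \<le> i"
    have ag': "agree {rj} {aMK} ?s s'" using ag by simp
    have "arr s' aLD = arr s aLD" "arr s' aUM = arr s aUM" "arr s' 7 = arr s 7"
      using agree_arr[OF ag'] by simp_all
    moreover have "{?lo..<Suc i} = insert i {?lo..<i}" using i(2) by auto
    ultimately show "?I (Suc i) ((run ?c s')\<lparr>reg := (reg (run ?c s'))(rj := Suc i)\<rparr>)"
      using I i(1) by simp
  qed (use X(3) in simp_all)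
  then have "terminates (For rj (Read aLS (Reg ri)) rx ?c) ?s (10 + 40 * card (Xs ! reg s ri))
    (\<lambda>s'. \<forall>x. arr s' aMK x = (if x \<in> Xs ! reg s ri \<and> arr s aUM x = 0 \<and> arr s 7 x \<noteq> 0 then 1 else arr s aMK x))"
    unfolding X(1) X(2) .
  then show ?thesis
    unfolding mark_good_def by (rule terminates_Seq_run[rotated]) simp_all
qed

text \<open>The labels for the restricted MDP stay in array 7 and are used only to place marks. The
  final attractor works with the labels of the original MDP, which remain in
  \<open>aLAB\<close>.\<close>

definition rabin_body :: com where
  "rabin_body = Seq (fill aUM rn) (Seq (scatter aUS aUD aUM 1) (Seq restrict_mdp (Seq M mark_good)))"

lemma rabin_body_frame [simp]:
  "wregs rabin_body = {rj, rx, 0} \<union> wregs M" "warrs rabin_body = {aUM, 0, 1, 2, aMK} \<union> warrs M"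
  by (auto simp: rabin_body_def)

lemma terminates_rabin_body:
  assumes RP: "is_rabin_pairs P RP"
    and s: "ready s P" "holds_pairs s RP" "reg s ri < length RP"
  shows "terminates rabin_body s (400 * card (edges P) + mdp_time T P) (\<lambda>s'. \<exists>S.
    S = {v \<in> fst (RP ! reg s ri). \<exists>X. end_component P X \<and> X \<inter> snd (RP ! reg s ri) = {} \<and> v \<in> X} \<and>
    (\<forall>v<reg s rn. arr s' aMK v = (if v \<in> S then 1 else arr s aMK v)))"
proof -
  define i where "i = reg s ri"
  have h: "holds_mdp s P" using s(1) by (simp add: ready_def)
  let ?n = "card (verts P)" and ?m = "card (edges P)"
  let ?L = "fst (RP ! i)" and ?U = "snd (RP ! i)"
  have n: "reg s rn = ?n" "reg s rm = ?m" using holds_mdp_sizes[OF h] by simp_all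
  have verts: "v \<in> verts P" if "v < ?n" for v
  proof -
    have "v < reg s rn" using that n(1) by simp
    then show ?thesis by (subst enumerated_mdp.verts[OF holds_mdp_enum[OF h]]) simp
  qed
  have mdp: "is_mdp P" using enumerated_mdp.mdp[OF holds_mdp_enum[OF h]] .
  have fin: "finite (verts P)" using mdp by (simp add: is_mdp_def)
  have L: "card ?L \<le> ?n" "card ?U \<le> ?n"
    unfolding i_def by (rule card_mono[OF fin] pair_nth[OF RP s(3)])+
  let ?S = "{v \<in> ?L. \<exists>X. end_component P X \<and> X \<inter> ?U = {} \<and> v \<in> X}"
  let ?post = "\<lambda>s'. \<forall>v<?n. arr s' aMK v = (if v \<in> ?S then 1 else arr s aMK v)"
  have "terminates rabin_body s (60 + 65 * ?n + 200 * ?m + mdp_time T P) ?post"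
    unfolding rabin_body_def
  proof (rule terminates_Seq[OF terminates_fill])
    fix s1 assume f1: "\<forall>j<reg s rn. arr s1 aUM j = 0" and "agree (wregs (fill aUM rn)) (warrs (fill aUM rn)) s s1"
    then have ag1: "agree {rj} {aUM} s s1" by simp
    have rd1: "ready s1 P" using s(1) ag1 by (rule ready_agree) simp_all
    have hp1: "holds_pairs s1 RP" using s(2) ag1 by (rule holds_pairs_agree) simp_all
    have i1: "reg s1 ri = i" using agree_reg[OF ag1] by (simp add: i_def)
    have mk1: "arr s1 aMK = arr s aMK" using agree_arr[OF ag1] by simp
    have "terminates (scatter aUS aUD aUM 1) s1 (20 + 13 * card (map snd RP ! reg s1 ri))
      (\<lambda>s'. \<forall>x. arr s' aUM x = (if x \<in> map snd RP ! reg s1 ri then 1 else arr s1 aUM x))"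
      using hp1 s(3) by (intro terminates_scatter) (simp_all add: holds_pairs_def i1 i_def)
    then show "terminates (Seq (scatter aUS aUD aUM 1) (Seq restrict_mdp (Seq M mark_good))) s1
      (50 + 53 * ?n + 200 * ?m + mdp_time T P) ?post"
    proof (rule terminates_Seq)
      fix s2 assume "\<forall>x. arr s2 aUM x = (if x \<in> map snd RP ! reg s1 ri then 1 else arr s1 aUM x)"
        and "agree (wregs (scatter aUS aUD aUM 1)) (warrs (scatter aUS aUD aUM 1)) s1 s2"
      then have c2: "\<And>x. arr s2 aUM x = (if x \<in> ?U then 1 else arr s1 aUM x)"
        and ag2: "agree {rx, rj} {aUM} s1 s2" using s(3) by (simp_all add: i1 i_def)
      have rd2: "ready s2 P" using rd1 ag2 by (rule ready_agree) simp_all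
      have h2: "holds_mdp s2 P" using rd2 by (simp add: ready_def)
      have hp2: "holds_pairs s2 RP" using hp1 ag2 by (rule holds_pairs_agree) simp_all
      have n2: "reg s2 rn = ?n" "reg s2 rm = ?m" using rd2 by (simp_all add: ready_def)
      have i2: "reg s2 ri = i" using agree_reg[OF ag2] i1 by simp
      have mk2: "arr s2 aMK = arr s aMK" using agree_arr[OF ag2] mk1 by simp
      have um2: "arr s2 aUM v \<noteq> 0 \<longleftrightarrow> v \<in> ?U" if "v < ?n" for v
        using c2[of v] f1 that n(1) by simp
      have "terminates restrict_mdp s2 (200 * reg s2 rm) (\<lambda>s'. stores_mdp s' (absorb P ?U))"
        using um2 n2 by (intro terminates_restrict_mdp[OF h2]) simp
      then show "terminates (Seq restrict_mdp (Seq M mark_good)) s2 (25 + 40 * ?n + 200 * ?m + mdp_time T P) ?post"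
      proof (rule terminates_Seq)
        fix s3 assume sm3: "stores_mdp s3 (absorb P ?U)" and "agree (wregs restrict_mdp) (warrs restrict_mdp) s2 s3"
        then have ag3: "agree {rj, 0} {0, 1, 2} s2 s3" by simp
        have hp3: "holds_pairs s3 RP" using hp2 ag3 by (rule holds_pairs_agree) simp_all
        have r3: "reg s3 ri = i" "arr s3 aMK = arr s aMK" "arr s3 aUM = arr s2 aUM"
          using agree_reg[OF ag3] agree_arr[OF ag3] i2 mk2 by simp_all
        \<comment> \<open>The restricted MDP has the same vertices and no more edges, so the time
          bound at the size of \<open>P\<close> applies to it.\<close>
        have "terminates M s3 (mdp_time T P) (\<lambda>s'. returns_mecs s' (absorb P ?U))"
          unfolding mdp_time_def using sm3 card_edges_absorb[OF mdp]
          by (intro terminates_M is_mdp_absorb mdp) simp_all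
        then show "terminates (Seq M mark_good) s3 (24 + 40 * ?n + mdp_time T P) ?post"
        proof (rule terminates_Seq)
          fix s4 assume m4: "returns_mecs s4 (absorb P ?U)" and ag4: "agree (wregs M) (warrs M) s3 s4"
          have hp4: "holds_pairs s4 RP" using hp3 ag4 by (rule holds_pairs_agree) simp_all
          have r4: "reg s4 ri = i" "arr s4 aMK = arr s aMK" "arr s4 aUM = arr s2 aUM"
            using agree_reg[OF ag4, of ri] agree_arr[OF ag4, of aMK] agree_arr[OF ag4, of aUM] r3 by simp_all
          have "terminates mark_good s4 (20 + 40 * card (map fst RP ! reg s4 ri))
            (\<lambda>s'. \<forall>x. arr s' aMK x = (if x \<in> map fst RP ! reg s4 ri \<and> arr s4 aUM x = 0 \<and> arr s4 7 x \<noteq> 0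
              then 1 else arr s4 aMK x))"
            using hp4 s(3) by (intro terminates_mark_good) (simp_all add: holds_pairs_def r4 i_def)
          then show "terminates mark_good s4 (20 + 40 * ?n) ?post"
          proof (rule terminates_conseq)
            show "20 + 40 * card (map fst RP ! reg s4 ri) \<le> 20 + 40 * ?n"
              using L(1) s(3) by (simp add: r4 i_def)
            fix s5 assume s5: "\<forall>x. arr s5 aMK x = (if x \<in> map fst RP ! reg s4 ri \<and> arr s4 aUM x = 0 \<and> arr s4 7 x \<noteq> 0
              then 1 else arr s4 aMK x)"
            show "?post s5"
            proof (intro allI impI)
              fix v assume v: "v < ?n"
              have "v \<in> verts (absorb P ?U)" using verts[OF v] by simp
              from returns_mecs_nonzero[OF is_mdp_absorb[OF mdp] m4 this]
              have nz: "arr s4 7 v \<noteq> 0 \<longleftrightarrow> (\<exists>X. end_component (absorb P ?U) X \<and> v \<in> X)" .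
              have "(\<exists>X. end_component (absorb P ?U) X \<and> v \<in> X) \<longleftrightarrow> (\<exists>X. end_component P X \<and> X \<inter> ?U = {} \<and> v \<in> X)"
                if vU: "v \<notin> ?U"
              proof
                assume "\<exists>X. end_component (absorb P ?U) X \<and> v \<in> X"
                then obtain X where X: "end_component (absorb P ?U) X" "v \<in> X" by blast
                have "X \<inter> ?U = {}" by (rule end_component_absorb_disjoint[OF X vU])
                then show "\<exists>X. end_component P X \<and> X \<inter> ?U = {} \<and> v \<in> X"
                  using X end_component_absorb by blast
              next
                assume "\<exists>X. end_component P X \<and> X \<inter> ?U = {} \<and> v \<in> X"
                then show "\<exists>X. end_component (absorb P ?U) X \<and> v \<in> X"
                  using end_component_absorb by blast
              qed
              then have "v \<in> ?S \<longleftrightarrow> v \<in> ?L \<and> arr s4 aUM v = 0 \<and> arr s4 7 v \<noteq> 0"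
                using nz um2[OF v] unfolding r4(3) by blast
              then show "arr s5 aMK v = (if v \<in> ?S then 1 else arr s aMK v)"
                using s5 s(3) by (simp add: r4 i_def)
            qed
          qed
        qed simp
      qed (simp add: n2)
    qed (use L(2) s(3) in \<open>simp add: i1 i_def\<close>)
  qed (simp_all add: n)
  then show ?thesis
    unfolding i_def[symmetric] n(1) by (rule terminates_conseq) (use mdp_sizes[OF h] in simp_all)
qed

text \<open>The number of pairs may exceed both \<open>b\<close> and the size of the MDP, as pairs
  may be empty, so neither a loop over the pairs nor a copy of the start array is affordable. Only
  the last cell of the start array is read, and the data are swept once. This happens on the
  original input, before the MEC program can overwrite it.\<close>

definition mark_all :: com where
  "mark_all = Seq (fill aMK 0) (Seq (Assign rx (Read 3 (Reg 1)))
     (For rj (Const 0) rx (Write aMK (Read 4 (Reg rj)) (Const 1))))"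

lemma mark_all_frame [simp]: "wregs mark_all = {rj, rx}" "warrs mark_all = {aMK}"
  by (auto simp: mark_all_def)

lemma terminates_mark_all:
  assumes s: "stores_pairs s RP"
  shows "terminates mark_all s (30 + 12 * reg s 0 + 13 * pairs_size RP)
    (\<lambda>s'. \<forall>v<reg s 0. arr s' aMK v \<noteq> 0 \<longleftrightarrow> (\<exists>(L, U)\<in>set RP. v \<in> L))"
  unfolding mark_all_def
proof (rule terminates_Seq[OF terminates_fill])
  have k: "reg s 1 = length RP" and L: "stores_sets (arr s 3) (arr s 4) (map fst RP)"
    using s by (simp_all add: stores_pairs_def)
  define b where "b = arr s 3 (length RP)"
  have un: "arr s 4 ` {0..<b} = \<Union>(set (map fst RP))" and b: "b = sum_list (map card (map fst RP))"
    using stores_sets_Union[OF L] by (simp_all add: b_def)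
  have "b \<le> pairs_size RP"
    unfolding b pairs_size_def by (induction RP) auto
  fix s1 assume f1: "\<forall>j<reg s 0. arr s1 aMK j = 0" and "agree (wregs (fill aMK 0)) (warrs (fill aMK 0)) s s1"
  then have ag1: "agree {rj} {aMK} s s1" by simp
  have r1: "reg s1 1 = length RP" "arr s1 3 = arr s 3" "arr s1 4 = arr s 4"
    using agree_reg[OF ag1] agree_arr[OF ag1] k by simp_all
  let ?s2 = "run (Assign rx (Read 3 (Reg 1))) s1"
  let ?c = "Write aMK (Read 4 (Reg rj)) (Const 1)"
  let ?I = "\<lambda>i s'. \<forall>x. arr s' aMK x = (if x \<in> arr s 4 ` {0..<i} then 1 else arr s1 aMK x)"
  let ?post = "\<lambda>s'. \<forall>v<reg s 0. arr s' aMK v \<noteq> 0 \<longleftrightarrow> (\<exists>(L, U)\<in>set RP. v \<in> L)"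
  have "terminates (For rj (Const 0) rx ?c) ?s2 (7 + 13 * b) (?I b)"
  proof (rule terminates_For_run[where a=0 and b=b and I="?I"])
    show "reg ?s2 rx = b" by (simp add: r1[unfolded One_nat_def] b_def)
    fix i s' assume I: "?I i s'" and ag: "agree (insert rj (wregs ?c)) (warrs ?c) ?s2 s'" and i: "reg s' rj = i"
    have ag': "agree {rj} {aMK} ?s2 s'" using ag by simp
    have "arr s' 4 = arr s 4" using agree_arr[OF ag', of 4] r1(3) by simp
    moreover have "{0..<Suc i} = insert i {0..<i}" by auto
    ultimately show "?I (Suc i) ((run ?c s')\<lparr>reg := (reg (run ?c s'))(rj := Suc i)\<rparr>)"
      using I i by simp
  qed simp_all
  then have "terminates (For rj (Const 0) rx ?c) ?s2 (7 + 13 * pairs_size RP) ?post"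
  proof (rule terminates_conseq)
    fix s' assume I: "?I b s'"
    show "?post s'"
    proof (intro allI impI)
      fix v assume v: "v < reg s 0"
      have "v \<in> arr s 4 ` {0..<b} \<longleftrightarrow> (\<exists>(L, U)\<in>set RP. v \<in> L)"
        unfolding un by force
      then show "arr s' aMK v \<noteq> 0 \<longleftrightarrow> (\<exists>(L, U)\<in>set RP. v \<in> L)"
        using I f1 v by simp
    qed
  qed (use \<open>b \<le> pairs_size RP\<close> in simp)
  then show "terminates (Seq (Assign rx (Read 3 (Reg 1))) (For rj (Const 0) rx ?c)) s1 (12 + 13 * pairs_size RP) ?post"
    by (rule terminates_Seq_run[rotated]) simp_all
qed simp_all

definition buchi_objective :: com where
  "buchi_objective = Seq mark_all (Seq prepare finish)"

lemma terminates_buchi_objective: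
  assumes P: "is_mdp P" "is_rabin_pairs P RP" and s: "stores_mdp s P" "stores_pairs s RP"
    and RP: "\<forall>(L, U)\<in>set RP. U = {}"
  shows "terminates buchi_objective s (2100 * card (edges P) + mdp_time T P + 13 * pairs_size RP)
    (\<lambda>s'. returns_set s' P (win_objective P RP))"
proof -
  let ?n = "card (verts P)" and ?m = "card (edges P)"
  have n: "reg s 0 = ?n" using s(1) by (simp add: stores_mdp_def)
  \<comment> \<open>\<open>ready\<close> is kept in the postcondition because it yields n \<le> m
    for simplifying the bound afterwards.\<close>
  let ?post = "\<lambda>s'. ready s' P \<and> returns_set s' P (win_objective P RP)"
  have "terminates buchi_objective s (32 + 12 * ?n + 13 * pairs_size RP + (2000 * ?m + mdp_time T P)) ?post"
    unfolding buchi_objective_def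
  proof (rule terminates_Seq[OF terminates_mark_all[OF s(2)]])
    fix s1 assume mk1: "\<forall>v<reg s 0. arr s1 aMK v \<noteq> 0 \<longleftrightarrow> (\<exists>(L, U)\<in>set RP. v \<in> L)"
      and "agree (wregs mark_all) (warrs mark_all) s s1"
    then have ag1: "agree {rj, rx} {aMK} s s1" by simp
    have sm1: "stores_mdp s1 P" using s(1) ag1 by (rule stores_mdp_agree) simp_all
    show "terminates (Seq prepare finish) s1 (1 + (2000 * ?m + mdp_time T P)) ?post"
    proof (rule terminates_Seq[OF terminates_prepare[OF P(1) sm1]])
      fix s2 assume rd2: "ready s2 P" and ag2: "agree (wregs prepare) (warrs prepare) s1 s2"
      have n2: "reg s2 rn = ?n" "reg s2 rm = ?m" and lab: "enumerated_mdp.is_mec_labelling P ?n (arr s2 aLAB)"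
        using rd2 by (simp_all add: ready_def)
      interpret E: enumerated_mdp P ?n ?m "arr s2 aSR" "arr s2 aDT"
        using rd2 holds_mdp_enum[of s2 P] n2 unfolding ready_def by simp
      have "arr s2 aMK = arr s1 aMK" using agree_arr[OF ag2] by simp
      then have mk: "arr s2 aMK v \<noteq> 0 \<longleftrightarrow> (\<exists>(L, U)\<in>set RP. v \<in> L)" if "v < ?n" for v
        using mk1 that n by simp
      have "terminates finish s2 (1600 * ?m) (\<lambda>s'. returns_set s' P (win_objective P RP))"
      proof (rule terminates_finish[OF rd2])
        show "v \<in> as_win P (Rabin RP)" if "v < reg s2 rn" "arr s2 aMK v \<noteq> 0" "arr s2 aLAB v \<noteq> 0" for v
          using E.buchi_marks(1)[OF lab P(2) RP mk] that n2 by simp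
        show "\<exists>v<reg s2 rn. arr s2 aMK v \<noteq> 0 \<and> arr s2 aLAB v = arr s2 aLAB u" if "winning_ec P RP X" "u \<in> X" for X u
          using E.buchi_marks(2)[OF lab P(2) RP mk that] n2 by simp
      qed
      then show "terminates finish s2 (1600 * ?m) ?post"
        by (rule terminates_conseq) (use rd2 in \<open>auto elim!: ready_agree\<close>)
    qed simp
  qed (simp add: n)
  then obtain t s' where ex: "exec buchi_objective s t s'"
      "t \<le> 32 + 12 * ?n + 13 * pairs_size RP + (2000 * ?m + mdp_time T P)" "?post s'"
    unfolding terminates_def by blast
  have "?n \<le> ?m" "1 \<le> ?m" using mdp_sizes ex(3) unfolding ready_def by blast+
  then have "t \<le> 2100 * ?m + mdp_time T P + 13 * pairs_size RP" using ex(2) by linarith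
  then show ?thesis using ex unfolding terminates_def by blast
qed

section \<open>The queries, and the objectives for coBuechi and general pairs\<close>

lemma terminates_buchi_query:
  assumes "is_mdp P" "is_rabin_pairs P RP" "stores_mdp s P" "stores_pairs s RP" "\<forall>(L, U)\<in>set RP. U = {}"
  shows "terminates (query buchi_body) s
    (700 * card (edges P) + (70 + 1600) * (length RP * card (edges P)) + mdp_time T P)
    (\<lambda>s'. returns_set s' P (win_query P RP))"
  using assms by (intro terminates_query terminates_buchi_body) (auto simp: buchi_body_def)

lemma terminates_cobuchi_query:
  assumes "is_mdp P" "is_rabin_pairs P RP" "stores_mdp s P" "stores_pairs s RP" "\<forall>(L, U)\<in>set RP. L = verts P"
  shows "terminates (query cobuchi_body) s
    (700 * card (edges P) + (70 + 3100) * (length RP * card (edges P)) + mdp_time T P)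
    (\<lambda>s'. returns_set s' P (win_query P RP))"
  using assms by (intro terminates_query terminates_cobuchi_body) (auto simp: cobuchi_body_def)

lemma winning_ec_nth:
  assumes "winning_ec P RP X"
  obtains j where "j < length RP" "end_component P X" "fst (RP ! j) \<inter> X \<noteq> {}" "X \<inter> snd (RP ! j) = {}"
proof -
  obtain L U where "(L, U) \<in> set RP" "end_component P X" "L \<inter> X \<noteq> {}" "U \<inter> X = {}"
    using assms unfolding winning_ec_def by blast
  moreover then obtain j where "j < length RP" "RP ! j = (L, U)" by (metis in_set_conv_nth)
  ultimately show thesis using that[of j] by (simp add: Int_commute)
qed

lemma terminates_cobuchi_objective:
  assumes P: "is_mdp P" "is_rabin_pairs P RP" and s: "stores_mdp s P" "stores_pairs s RP"
    and RP: "\<forall>(L, U)\<in>set RP. L = verts P"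
  shows "terminates (objective safe) s (2300 * card (edges P) + 70 * (length RP * card (edges P)) +
      length RP * (1500 * card (edges P)) + mdp_time T P) (\<lambda>s'. returns_set s' P (win_objective P RP))"
proof (rule terminates_objective[OF P s, where
      G="\<lambda>j S. (\<forall>X. end_component P X \<and> X \<inter> snd (RP ! j) = {} \<longrightarrow> X \<subseteq> S) \<and>
        (\<forall>RP'. (verts P, snd (RP ! j)) \<in> set RP' \<longrightarrow> S \<subseteq> as_win P (Rabin RP'))"])
  fix s assume s: "ready s P" "holds_pairs s RP" "reg s ri < length RP"
  have "terminates safe s (1500 * reg s rm) (\<lambda>s'. \<exists>S.
      (\<forall>X. end_component P X \<and> X \<inter> snd (RP ! reg s ri) = {} \<longrightarrow> X \<subseteq> S) \<and>
      (\<forall>RP'. (verts P, snd (RP ! reg s ri)) \<in> set RP' \<longrightarrow> S \<subseteq> as_win P (Rabin RP')) \<and>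
      (\<forall>v<reg s rn. arr s' aMK v = (if v \<in> S then 1 else arr s aMK v)))"
    using s pair_nth(2)[OF P(2) s(3)]
    by (intro terminates_safe[where Us="map snd RP"]) (simp_all add: holds_pairs_def ready_def)
  moreover have "reg s rm = card (edges P)" using s(1) by (simp add: ready_def)
  ultimately show "terminates safe s (1500 * card (edges P)) (\<lambda>s'. \<exists>S.
      ((\<forall>X. end_component P X \<and> X \<inter> snd (RP ! reg s ri) = {} \<longrightarrow> X \<subseteq> S) \<and>
      (\<forall>RP'. (verts P, snd (RP ! reg s ri)) \<in> set RP' \<longrightarrow> S \<subseteq> as_win P (Rabin RP'))) \<and>
      (\<forall>v<reg s rn. arr s' aMK v = (if v \<in> S then 1 else arr s aMK v)))"
    by (simp only: conj_assoc)
next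
  fix j S assume j: "j < length RP" and S: "(\<forall>X. end_component P X \<and> X \<inter> snd (RP ! j) = {} \<longrightarrow> X \<subseteq> S) \<and>
        (\<forall>RP'. (verts P, snd (RP ! j)) \<in> set RP' \<longrightarrow> S \<subseteq> as_win P (Rabin RP'))"
  have mem: "RP ! j \<in> set RP" using j by (rule nth_mem)
  from bspec[OF RP this] have "RP ! j = (verts P, snd (RP ! j))"
    by (simp add: case_prod_beta prod_eq_iff)
  then have "(verts P, snd (RP ! j)) \<in> set RP" using mem by simp
  then show "S \<subseteq> as_win P (Rabin RP)" using S by blast
next
  fix X assume "winning_ec P RP X"
  then obtain j where j: "j < length RP" "end_component P X" "fst (RP ! j) \<inter> X \<noteq> {}" "X \<inter> snd (RP ! j) = {}"
    by (rule winning_ec_nth)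
  then show "\<exists>j<length RP. \<forall>S. (\<forall>X. end_component P X \<and> X \<inter> snd (RP ! j) = {} \<longrightarrow> X \<subseteq> S) \<and>
        (\<forall>RP'. (verts P, snd (RP ! j)) \<in> set RP' \<longrightarrow> S \<subseteq> as_win P (Rabin RP')) \<longrightarrow> S \<inter> X \<noteq> {}"
    by (intro exI[of _ j] conjI allI impI) blast+
qed auto

text \<open>There is one MEC run for the original MDP and one for each pair. A vertex marked for a
  pair lies in an end-component that is winning by that very pair, hence wins; conversely, a winning
  end-component meets the marks of its pair.\<close>

lemma terminates_rabin_objective:
  assumes P: "is_mdp P" "is_rabin_pairs P RP" and s: "stores_mdp s P" "stores_pairs s RP"
  shows "terminates (objective rabin_body) s (2300 * card (edges P) + 70 * (length RP * card (edges P)) +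
      length RP * (400 * card (edges P) + mdp_time T P) + mdp_time T P) (\<lambda>s'. returns_set s' P (win_objective P RP))"
proof (rule terminates_objective[OF P s, where
      G="\<lambda>j S. S = {v \<in> fst (RP ! j). \<exists>X. end_component P X \<and> X \<inter> snd (RP ! j) = {} \<and> v \<in> X}"])
  fix j S assume j: "j < length RP"
    and S: "S = {v \<in> fst (RP ! j). \<exists>X. end_component P X \<and> X \<inter> snd (RP ! j) = {} \<and> v \<in> X}"
  show "S \<subseteq> as_win P (Rabin RP)"
  proof
    fix v assume "v \<in> S"
    then obtain X where X: "v \<in> fst (RP ! j)" "end_component P X" "X \<inter> snd (RP ! j) = {}" "v \<in> X"
      unfolding S by blast
    have "(fst (RP ! j), snd (RP ! j)) \<in> set RP" using nth_mem[OF j] by simp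
    then have "winning_ec P RP X"
      unfolding winning_ec_def using X by blast
    then show "v \<in> as_win P (Rabin RP)" using winning_ec_subset_as_win[OF P(1)] X(4) by blast
  qed
next
  fix X assume "winning_ec P RP X"
  then obtain j where j: "j < length RP" "end_component P X" "fst (RP ! j) \<inter> X \<noteq> {}" "X \<inter> snd (RP ! j) = {}"
    by (rule winning_ec_nth)
  then show "\<exists>j<length RP. \<forall>S. S = {v \<in> fst (RP ! j). \<exists>X. end_component P X \<and> X \<inter> snd (RP ! j) = {} \<and> v \<in> X} \<longrightarrow> S \<inter> X \<noteq> {}"
    by (intro exI[of _ j] conjI allI impI) blast+
next
  show "{rn, rm, rk, ri} \<inter> wregs rabin_body = {}"
    "{aST, aDT, aOW, aSR, aLAB, aLS, aLD, aUS, aUD} \<inter> warrs rabin_body = {}" by simp_all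
qed (rule terminates_rabin_body[OF P(2)])

end

lemma computable_in_OI:
  assumes "\<And>P RP s. is_mdp P \<Longrightarrow> is_rabin_pairs P RP \<Longrightarrow> D P RP \<Longrightarrow> stores_mdp s P \<Longrightarrow> stores_pairs s RP \<Longrightarrow>
      terminates A s (g P RP) (\<lambda>s'. returns_set s' P (W P RP))"
    and "\<And>P RP. is_mdp P \<Longrightarrow> D P RP \<Longrightarrow> g P RP \<le> C * f P RP"
  shows "computable_in_O D W f"
  unfolding computable_in_O_def
proof (rule exI[of _ A], rule exI[of _ C], intro allI impI)
  fix P :: "nat mdp" and RP and s :: state assume *: "is_mdp P \<and> is_rabin_pairs P RP \<and> D P RP \<and> stores_mdp s P \<and> stores_pairs s RP"
  then obtain t s' where "exec A s t s'" "t \<le> g P RP" "returns_set s' P (W P RP)"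
    using assms(1) unfolding terminates_def by blast
  then show "\<exists>t s'. exec A s t s' \<and> t \<le> C * f P RP \<and> returns_set s' P (W P RP)"
    using assms(2)[of P RP] * by (meson order_trans)
qed

theorem theorem9:
  fixes M :: com and T :: "nat \<Rightarrow> nat \<Rightarrow> nat"
  assumes "computes_mecs_in M T"
    and "at_least_linear T"
  shows
    "computable_in_O (\<lambda>P RP. RP \<noteq> []) win_objective
       (\<lambda>P RP. length RP * mdp_time T P) \<and>
     computable_in_O (\<lambda>P RP. \<forall>(L, U)\<in>set RP. U = {}) win_objective
       (\<lambda>P RP. mdp_time T P + pairs_size RP) \<and>
     computable_in_O (\<lambda>P RP. \<forall>(L, U)\<in>set RP. U = {}) win_query
       (\<lambda>P RP. length RP * card (edges P) + mdp_time T P) \<and>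
     computable_in_O (\<lambda>P RP. \<forall>(L, U)\<in>set RP. L = verts P) win_objective
       (\<lambda>P RP. length RP * card (edges P) + mdp_time T P) \<and>
     computable_in_O (\<lambda>P RP. \<forall>(L, U)\<in>set RP. L = verts P) win_query
       (\<lambda>P RP. length RP * card (edges P) + mdp_time T P)"
proof -
  \<comment> \<open>The program text of \<open>M\<close> is finite, so some bound lies above all
    indices that it writes.\<close>
  obtain D where D: "\<forall>x\<in>wregs M \<union> warrs M. x < D"
    using finite_wregs_warrs[of M] finite_nat_set_iff_bounded by blast
  interpret mec_program D M T
    using assms(1) D by unfold_locales auto
  obtain C where C: "\<And>P :: nat mdp. is_mdp P \<Longrightarrow> card (edges P) \<le> C * mdp_time T P"
    using linear_time[OF assms(2)] by blast
  \<comment> \<open>A fixed number of linear passes is charged to the MEC run, by the lower bound on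
    \<open>T\<close>.\<close>
  have lin: "a * m + b * x + t \<le> (a * C + b + 1) * (x + t)" if "m \<le> C * t" for a b m x t :: nat
  proof -
    have "a * m \<le> a * (C * t)" using that by (rule mult_left_mono) simp
    moreover have "(a * C + b + 1) * (x + t) = a * (C * t) + b * x + t + (a * (C * x) + b * t + x)"
      by (simp add: algebra_simps)
    ultimately show ?thesis by linarith
  qed
  have "computable_in_O (\<lambda>P RP. RP \<noteq> []) win_objective (\<lambda>P RP. length RP * mdp_time T P)"
  proof (rule computable_in_OI[OF terminates_rabin_objective, where C="2770 * C + 2"])
    fix P :: "nat mdp" and RP :: "nat rabin_pairs"
    assume P: "is_mdp P" and RP: "RP \<noteq> []"
    let ?k = "length RP" and ?m = "card (edges P)" and ?t = "mdp_time T P"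
    \<comment> \<open>With at least one pair, work done only once is also bounded by k times its
      cost. The factor 2770 is 2300 + 70 + 400, and the 2 stands for the MEC runs of the pairs
      together with the initial one.\<close>
    have k: "1 \<le> ?k" using RP by (cases RP) auto
    have "?m \<le> ?k * ?m" "?t \<le> ?k * ?t" using k by simp_all
    moreover have "?k * ?m \<le> C * (?k * ?t)" using mult_left_mono[OF C[OF P], of ?k] by (simp add: mult.left_commute)
    moreover have "?k * (400 * ?m + ?t) = 400 * (?k * ?m) + ?k * ?t" by (simp add: algebra_simps)
    moreover have "(2770 * C + 2) * (?k * ?t) = 2770 * (C * (?k * ?t)) + 2 * (?k * ?t)" by (simp add: algebra_simps)
    moreover have "2300 * m + 70 * x + (400 * x + y) + t \<le> 2770 * z + 2 * y"
      if "m \<le> x" "t \<le> y" "x \<le> z" for m t x y z :: nat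
      using that by linarith
    ultimately show "2300 * ?m + 70 * (?k * ?m) + ?k * (400 * ?m + ?t) + ?t \<le> (2770 * C + 2) * (?k * ?t)"
      by (simp only:)
  qed
  moreover have "computable_in_O (\<lambda>P RP. \<forall>(L, U)\<in>set RP. U = {}) win_objective (\<lambda>P RP. mdp_time T P + pairs_size RP)"
  proof (rule computable_in_OI[OF terminates_buchi_objective, where C="2100 * C + 13 + 1"])
    fix P :: "nat mdp" and RP :: "nat rabin_pairs"
    assume P: "is_mdp P"
    show "2100 * card (edges P) + mdp_time T P + 13 * pairs_size RP \<le> (2100 * C + 13 + 1) * (mdp_time T P + pairs_size RP)"
      using lin[OF C[OF P], of 2100 13 "pairs_size RP"] by (simp only: add_ac)
  qed
  moreover have "computable_in_O (\<lambda>P RP. \<forall>(L, U)\<in>set RP. U = {}) win_query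
       (\<lambda>P RP. length RP * card (edges P) + mdp_time T P)"
    by (rule computable_in_OI[OF terminates_buchi_query, where C="700 * C + (70 + 1600) + 1"])
      (simp_all only: lin C)
  moreover have "computable_in_O (\<lambda>P RP. \<forall>(L, U)\<in>set RP. L = verts P) win_objective
       (\<lambda>P RP. length RP * card (edges P) + mdp_time T P)"
  proof (rule computable_in_OI[OF terminates_cobuchi_objective, where C="2300 * C + 1570 + 1"])
    fix P :: "nat mdp" and RP :: "nat rabin_pairs"
    assume P: "is_mdp P"
    let ?k = "length RP" and ?m = "card (edges P)" and ?t = "mdp_time T P"
    \<comment> \<open>The constant 1570 below is 70 + 1500, for saving the pairs and for the
      attractor of each pair.\<close>
    have "?k * (1500 * ?m) = 1500 * (?k * ?m)" by simp
    then show "2300 * ?m + 70 * (?k * ?m) + ?k * (1500 * ?m) + ?t \<le> (2300 * C + 1570 + 1) * (?k * ?m + ?t)"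
      using lin[OF C[OF P], of 2300 1570 "?k * ?m"] by linarith
  qed
  moreover have "computable_in_O (\<lambda>P RP. \<forall>(L, U)\<in>set RP. L = verts P) win_query
       (\<lambda>P RP. length RP * card (edges P) + mdp_time T P)"
    by (rule computable_in_OI[OF terminates_cobuchi_query, where C="700 * C + (70 + 3100) + 1"])
      (simp_all only: lin C)
  ultimately show ?thesis by blast
qed

end
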